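(* Let $n=2$ and let $\bar u$ be a nonconstant $T$-periodic stationary solution of $u_t+f(u)_x=(Bu_x)_x$ with $B$ a constant matrix, with associated rest point $u_-$ and transversality coefficient $\gamma=\det([\tilde z_1],[w_2])$ as defined in the context. Assume: (i) $f\in C^2$; (ii) $\operatorname{Re}\sigma(B)>0$; (iii) $df(u_-)$ is invertible; (iv) $\gamma\neq 0$; and suppose in addition that (v) the traveling-wave ODE is planar Hamiltonian for the value of $s$ associated with $\bar u$ (i.e. $s=0$). Then $$\operatorname{sgn}\gamma=\operatorname{sgn}(dT/da),$$ where $dT/da$ is the derivative, at $\bar u$, of period with respect to amplitude in the family of nearby periodic orbits.
   Context: Setting. Consider $u_t+f(u)_x=(Bu_x)_x$, $x\in\mathbb R$, $u,f(u)\in\mathbb R^2$, $B\in\mathbb R^{2\times 2}$ constant. Periodic traveling waves $\bar u(x-st)$ are taken, in their rest frame (replacing $f(u)$ by $f(u)-su$), to have speed $s=0$. Thus $\bar u(x)$ is a nonconstant $T$-periodic solution of $Bu'=f(u)-f(u_-)$ with $\bar u(0)=\bar u(T)=u_0$, where $u_-\in\mathbb R^2$ is a rest point of this ODE. Coordinates in $\mathbb R^2$ are chosen so that $\bar u'(0)=e_1$ (first standard basis vector) and the outward unit normal at $\bar u(0)$ to the closed orbit is $\pm e_2$. Variations: for parameters $(u_-,u_0,s)$ near the base values (with $s=0$), let $\bar u^{(u_-,u_0,s)}(x)$ solve $Bu'=f(u)-f(u_-)-s(u-u_-)$, $u(0)=u_0$. At the base values put $w_j=(\partial\bar u/\partial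 u_0)e_j$ ($j=1,2$), $\tilde z_1=-\partial\bar u/\partial s$. Write $[g]=g(T)-g(0)$. The transversality coefficient is $\gamma=\det([\tilde z_1],[w_2])$. Planar Hamiltonian: with $s$ fixed at the base value ($s=0$), the vector field $B^{-1}(f(u)-f(u_-)-s(u-u_-))$ is divergence-free in $u$; for constant $B$ this is $\operatorname{Tr}\big(B^{-1}(df(u)-sI)\big)=0$ for all $u$. Consequently the ODE is $u'=\nabla_u^\perp H(u,u_-)$ for a Hamiltonian $H$ and, with $(u_-,s)$ fixed, $\bar u$ is embedded in a one-parameter family of nearby periodic orbits. This family is parametrized by amplitude $a$, measured along a curve through $\bar u(0)$ in the direction of the outward normal to the orbit $\{\bar u(x)\}$ (so $a$ increases outward); $T=T(a)$ denotes the period of the orbit of amplitude $a$. *)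

theory Defs
  imports "HOL-Analysis.Analysis"
begin

text \<open>
  \<open>solves_tw f B v s S u\<close>: the profile \<open>u\<close> solves \<open>B u' = f(u) - f(v) - s (u - v)\<close> on the
  set \<open>S\<close> (one-sided derivatives at end points), where \<open>v\<close> is the rest point and \<open>s\<close> the speed.
\<close>

definition solves_tw ::
    "(real^2 \<Rightarrow> real^2) \<Rightarrow> real^2^2 \<Rightarrow> real^2 \<Rightarrow> real \<Rightarrow> real set \<Rightarrow> (real \<Rightarrow> real^2) \<Rightarrow> bool" where
  "solves_tw f B v s S u \<longleftrightarrow>
     (\<exists>u'. \<forall>x\<in>S. (u has_vector_derivative u' x) (at x within S) \<and>
                 B *v u' x = f (u x) - f v - s *\<^sub>R (u x - v))"

definition tw_field ::
    "(real^2 \<Rightarrow> real^2) \<Rightarrow> real^2^2 \<Rightarrow> real^2 \<Rightarrow> real \<Rightarrow> real^2 \<Rightarrow> real^2" where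
  "tw_field f B v s u = matrix_inv B *v (f u - f v - s *\<^sub>R (u - v))"

text \<open>
  The traveling-wave ODE is called planar Hamiltonian if its vector field is divergence-free in
  \<open>u\<close>; the divergence is the trace of the Jacobian.
\<close>

definition planar_hamiltonian ::
    "(real^2 \<Rightarrow> real^2) \<Rightarrow> real^2^2 \<Rightarrow> real^2 \<Rightarrow> real \<Rightarrow> bool" where
  "planar_hamiltonian f B v s \<longleftrightarrow> (\<forall>u. trace (jacobian (tw_field f B v s) (at u)) = 0)"

definition C2 :: "('a::real_normed_vector \<Rightarrow> 'b::real_normed_vector) \<Rightarrow> bool" where
  "C2 f \<longleftrightarrow>
     (\<exists>(f' :: 'a \<Rightarrow> 'a \<Rightarrow>\<^sub>L 'b) (f'' :: 'a \<Rightarrow> 'a \<Rightarrow>\<^sub>L 'a \<Rightarrow>\<^sub>L 'b).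
        (\<forall>x. (f has_derivative blinfun_apply (f' x)) (at x)) \<and>
        (\<forall>x. (f' has_derivative blinfun_apply (f'' x)) (at x)) \<and>
        continuous_on UNIV f'')"

definition complex_spectrum :: "real^'n^'n \<Rightarrow> complex set" where
  "complex_spectrum A = {l. \<exists>x. x \<noteq> 0 \<and> map_matrix complex_of_real A *v x = l *s x}"

text \<open>
  In the following, \<open>U v p s\<close> is the profile with rest point \<open>v\<close>, speed \<open>s\<close> and value \<open>p\<close> at
  \<open>0\<close>.  Solutions for parameters near the base values need not be global, so only the interval
  \<open>[0, T]\<close>, which is all that enters the transversality coefficient, is prescribed.  There \<open>U\<close> is
  determined by the ODE for all parameters near the base values, hence so are its derivatives.
\<close>

definition tw_variation ::
    "(real^2 \<Rightarrow> real^2) \<Rightarrow> real^2^2 \<Rightarrow> real \<Rightarrow> real^2 \<Rightarrow> real^2 \<Rightarrow>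
     (real^2 \<Rightarrow> real^2 \<Rightarrow> real \<Rightarrow> real \<Rightarrow> real^2) \<Rightarrow> bool" where
  "tw_variation f B T um u0 U \<longleftrightarrow>
     (\<forall>\<^sub>F (v, p, s) in nhds (um, u0, 0). solves_tw f B v s {0..T} (U v p s) \<and> U v p s 0 = p)"

definition w ::
    "(real^2 \<Rightarrow> real^2 \<Rightarrow> real \<Rightarrow> real \<Rightarrow> real^2) \<Rightarrow> real^2 \<Rightarrow> real^2 \<Rightarrow> 2 \<Rightarrow> real \<Rightarrow> real^2" where
  "w U um u0 j x = frechet_derivative (\<lambda>p. U um p 0 x) (at u0) (axis j 1)"

definition z1 ::
    "(real^2 \<Rightarrow> real^2 \<Rightarrow> real \<Rightarrow> real \<Rightarrow> real^2) \<Rightarrow> real^2 \<Rightarrow> real^2 \<Rightarrow> real \<Rightarrow> real^2" where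
  "z1 U um u0 x = - vector_derivative (\<lambda>s. U um u0 s x) (at 0)"

definition jump :: "real \<Rightarrow> (real \<Rightarrow> real^2) \<Rightarrow> real^2" where
  "jump T g = g T - g 0"

text \<open>The transpose makes the two jumps the columns of the matrix.\<close>

definition transversality_coeff ::
    "real \<Rightarrow> real^2 \<Rightarrow> real^2 \<Rightarrow> (real^2 \<Rightarrow> real^2 \<Rightarrow> real \<Rightarrow> real \<Rightarrow> real^2) \<Rightarrow> real" where
  "transversality_coeff T um u0 U =
     det (transpose (vector [jump T (z1 U um u0), jump T (w U um u0 2)] :: real^2^2))"

definition minimal_period :: "(real \<Rightarrow> 'a) \<Rightarrow> real \<Rightarrow> bool" where
  "minimal_period u P \<longleftrightarrow>
     0 < P \<and> (\<forall>x. u (x + P) = u x) \<and> (\<forall>Q. 0 < Q \<and> Q < P \<longrightarrow> (\<exists>x. u (x + Q) \<noteq> u x))"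

text \<open>
  Outward unit normal at \<open>u 0\<close> to the closed orbit \<open>range u\<close>, where \<open>u'(0) \<noteq> 0\<close>; \<^const>\<open>outside\<close>
  is the unbounded complementary region.
\<close>

definition outward_unit_normal :: "(real \<Rightarrow> real^2) \<Rightarrow> real^2 \<Rightarrow> bool" where
  "outward_unit_normal u \<nu> \<longleftrightarrow>
     norm \<nu> = 1 \<and> \<nu> \<bullet> vector_derivative u (at 0) = 0 \<and>
     (\<exists>\<epsilon>>0. \<forall>t. 0 < t \<and> t < \<epsilon> \<longrightarrow> u 0 + t *\<^sub>R \<nu> \<in> outside (range u))"

text \<open>
  \<open>V a\<close> is the periodic solution (for fixed rest point \<open>v\<close> and speed \<open>s\<close>) through the point
  \<open>c a\<close> at amplitude \<open>a\<close> of the curve \<open>c\<close>, and \<open>P a\<close> is the period of its orbit.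
\<close>

definition periodic_family ::
    "(real^2 \<Rightarrow> real^2) \<Rightarrow> real^2^2 \<Rightarrow> real^2 \<Rightarrow> real \<Rightarrow> (real \<Rightarrow> real^2) \<Rightarrow> real \<Rightarrow>
     (real \<Rightarrow> real \<Rightarrow> real^2) \<Rightarrow> (real \<Rightarrow> real) \<Rightarrow> bool" where
  "periodic_family f B v s c \<delta> V P \<longleftrightarrow>
     (\<forall>a. \<bar>a\<bar> < \<delta> \<longrightarrow>
        solves_tw f B v s UNIV (V a) \<and> V a 0 = c a \<and> minimal_period (V a) (P a))"

end

theory Submission
  imports Defs "HOL-Complex_Analysis.Winding_Numbers"
begin

text \<open>
Put \<open>F = B\<^sup>-\<^sup>1 (f - f(u\<^sub>-))\<close> and \<open>G(u) = B\<^sup>-\<^sup>1 (u - u\<^sub>-)\<close>, so that a profile of speed \<open>s\<close> solves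
\<open>u' = F(u) - s G(u)\<close>, and write \<open>a \<and> b\<close> for the area form (\<open>wedge\<close>). As \<open>F\<close> is divergence-free, the
equation linearized along the orbit preserves \<open>\<and>\<close>. One of its solutions is the velocity \<open>p = u'\<close>,
and a second one has the form \<open>\<alpha> p + n\<close>, where \<open>n\<close> is normal to the orbit with \<open>p \<and> n = 1\<close> and
\<open>\<alpha>\<close> (\<open>shear\<close>) is an explicit integral vanishing at \<open>0\<close>. After a period \<open>p\<close> and \<open>n\<close> are again the basis
vectors \<open>e\<^sub>1\<close> and \<open>e\<^sub>2\<close>, so the jump of \<open>w\<^sub>2\<close> is \<open>\<alpha>(T) e\<^sub>1\<close>. Variation of constants in the
frame \<open>p, n\<close> shows that the coefficient of \<open>z\<^sub>1\<close> along \<open>n\<close> is \<open>\<beta>(x) = \<integral> p \<and> G(u)\<close> over \<open>[0, x]\<close> (\<open>flux\<close>).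
Hence \<open>\<gamma> = - \<alpha>(T) \<beta>(T)\<close>.

The period. A first integral \<open>H\<close> with derivative \<open>F \<and> _\<close> is strictly monotone on short vertical
segments near \<open>u(0)\<close>, where \<open>F\<close> is close to \<open>e\<^sub>1\<close>. A solution from \<open>p\<close> near \<open>u(0)\<close> that comes back to the
vertical line through \<open>p\<close> therefore comes back to \<open>p\<close> itself: nearby orbits are closed, and the return
time solves a scalar equation whose linearization is \<open>d\<tau> = - \<alpha>(T\<^sub>0) dp\<^sub>2\<close>, with \<open>T\<^sub>0\<close> the least
period (\<open>return_time\<close>). If the outward normal is \<open>\<sigma> e\<^sub>2\<close>, then \<open>dT/da = - \<sigma> \<alpha>(T\<^sub>0)\<close>.

The flux. Up to an exact term, \<open>\<beta>(T\<^sub>0)\<close> is \<open>tr B\<^sup>-\<^sup>1\<close> times the integral of \<open>u\<^sub>2 du\<^sub>1\<close> over the orbit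
(\<open>flux_linear_field\<close>), and the spectral condition makes the trace positive. The integral of \<open>u\<^sub>2 du\<^sub>1\<close>
is minus the integral of the winding number over the plane (\<open>integral_winding_number\<close>). Inside the orbit
the winding number is \<open>1\<close> or \<open>-1\<close>, and its jump at \<open>u(0)\<close> (\<open>winding_number_jump\<close>) shows that it is
\<open>-\<sigma>\<close>. So \<open>\<beta>(T\<^sub>0)\<close> has the sign \<open>\<sigma>\<close>. If \<open>T = k T\<^sub>0\<close>, then \<open>\<alpha>(T) = k \<alpha>(T\<^sub>0)\<close> and \<open>\<beta>(T) = k \<beta>(T\<^sub>0)\<close>, and
\<open>\<gamma>\<close> and \<open>dT/da\<close> have the same sign.
\<close>

section \<open>Gronwall estimates and expansions of solutions\<close>

text \<open>
With \<open>norm (g x) \<^sup>2 + \<epsilon>\<^sup>2\<close> in place of \<open>norm (g x)\<close> the differential inequality becomes homogeneous with rate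
\<open>2L + 1\<close>, and the zeros of \<open>g\<close> cause no trouble.
\<close>

lemma gronwall_bound:
  fixes g g' :: "real \<Rightarrow> 'a::real_inner"
  assumes deriv: "\<And>x. x \<in> {0..T} \<Longrightarrow> (g has_vector_derivative g' x) (at x within {0..T})"
    and bound: "\<And>x. x \<in> {0..T} \<Longrightarrow> norm (g' x) \<le> L * norm (g x) + \<epsilon>"
    and nonneg: "0 \<le> L" "0 \<le> \<epsilon>" and x: "x \<in> {0..T}"
  shows "norm (g x) \<le> (norm (g 0) + \<epsilon>) * exp ((L + 1) * T)"
proof -
  define E where "E \<equiv> \<lambda>t. exp (- (2 * L + 1) * t) * (g t \<bullet> g t + \<epsilon>\<^sup>2)"
  define E' where "E' \<equiv> \<lambda>t. exp (- (2 * L + 1) * t) * (2 * (g t \<bullet> g' t))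
       - (2 * L + 1) * exp (- (2 * L + 1) * t) * (g t \<bullet> g t + \<epsilon>\<^sup>2)"
  have E_deriv: "(E has_real_derivative E' t) (at t within {0..T})" if "t \<in> {0..T}" for t
  proof -
    have "((\<lambda>t. g t \<bullet> g t) has_real_derivative 2 * (g t \<bullet> g' t)) (at t within {0..T})"
      using has_derivative_inner[OF deriv[OF that, unfolded has_vector_derivative_def]
          deriv[OF that, unfolded has_vector_derivative_def]]
      by (simp add: has_field_derivative_def inner_commute algebra_simps mult_commute_abs)
    then show ?thesis
      unfolding E_def E'_def
      by (auto intro!: derivative_eq_intros simp: algebra_simps)
  qed
  have E'_nonpos: "E' t \<le> 0" if "t \<in> {0..T}" for t
  proof -
    have "2 * (g t \<bullet> g' t) \<le> 2 * (norm (g t) * norm (g' t))"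
      using norm_cauchy_schwarz[of "g t" "g' t"] by simp
    also have "\<dots> \<le> 2 * (norm (g t) * (L * norm (g t) + \<epsilon>))"
      using bound[OF that] by (intro mult_left_mono) auto
    also have "\<dots> \<le> (2 * L + 1) * (g t \<bullet> g t + \<epsilon>\<^sup>2)"
    proof -
      have "0 \<le> (norm (g t) - \<epsilon>)\<^sup>2 + 2 * L * \<epsilon>\<^sup>2" using nonneg by simp
      then show ?thesis
        by (simp add: dot_square_norm power2_eq_square algebra_simps)
    qed
    finally have "exp (- (2 * L + 1) * t) * (2 * (g t \<bullet> g' t))
        \<le> exp (- (2 * L + 1) * t) * ((2 * L + 1) * (g t \<bullet> g t + \<epsilon>\<^sup>2))"
      by (intro mult_left_mono) auto
    then show ?thesis
      unfolding E'_def by (simp add: mult.left_commute mult.assoc)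
  qed
  have "E x \<le> E 0"
  proof (rule DERIV_nonpos_imp_decreasing_open[of 0 x E])
    show "0 \<le> x" using x by simp
    show "\<exists>y. (E has_real_derivative y) (at t) \<and> y \<le> 0" if "0 < t" "t < x" for t
      using E_deriv[of t] E'_nonpos[of t] at_within_Icc_at[of 0 t T] that x by auto
    show "continuous_on {0..x} E"
      by (rule continuous_on_subset[OF DERIV_continuous_on[OF E_deriv]]) (use x in auto)
  qed
  then have "g x \<bullet> g x + \<epsilon>\<^sup>2 \<le> exp ((2 * L + 1) * x) * (g 0 \<bullet> g 0 + \<epsilon>\<^sup>2)"
    using mult_left_mono[of "E x" "E 0" "exp ((2 * L + 1) * x)"]
    by (simp add: E_def mult.assoc[symmetric] exp_add[symmetric] distrib_right[symmetric])
  also have "\<dots> \<le> exp ((2 * L + 2) * T) * (g 0 \<bullet> g 0 + \<epsilon>\<^sup>2)"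
    using x nonneg by (intro mult_right_mono add_nonneg_nonneg iffD2[OF exp_le_cancel_iff] mult_mono) auto
  finally have "(norm (g x))\<^sup>2 \<le> exp ((2 * L + 2) * T) * ((norm (g 0))\<^sup>2 + \<epsilon>\<^sup>2)"
    using zero_le_power2[of \<epsilon>] unfolding dot_square_norm by linarith
  also have "\<dots> \<le> exp ((2 * L + 2) * T) * (norm (g 0) + \<epsilon>)\<^sup>2"
    using nonneg by (intro mult_left_mono) (auto simp: power2_sum)
  also have "\<dots> = ((norm (g 0) + \<epsilon>) * exp ((L + 1) * T))\<^sup>2"
    unfolding power_mult_distrib by (simp add: power2_eq_square exp_add[symmetric] algebra_simps)
  finally show ?thesis
    by (rule power2_le_imp_le) (use nonneg in auto)
qed

text \<open>
All assumptions on \<open>F\<close> concern points within distance 1 of \<open>u\<close>. They suffice because at a first time at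
distance 1 the Gronwall bound, which is less than 1, would already apply.
\<close>

lemma solution_stays_close:
  fixes u v :: "real \<Rightarrow> 'a::real_inner"
  assumes u: "\<And>x. x \<in> {0..T} \<Longrightarrow> (u has_vector_derivative F (u x)) (at x within {0..T})"
    and v: "\<And>x. x \<in> {0..T} \<Longrightarrow> (v has_vector_derivative v' x) (at x within {0..T})"
    and lip: "\<And>x q. x \<in> {0..T} \<Longrightarrow> norm (q - u x) \<le> 1 \<Longrightarrow> norm (F q - F (u x)) \<le> L * norm (q - u x)"
    and res: "\<And>x. x \<in> {0..T} \<Longrightarrow> norm (v x - u x) \<le> 1 \<Longrightarrow> norm (v' x - F (v x)) \<le> \<epsilon>"
    and nonneg: "0 \<le> L" "0 \<le> \<epsilon>"
    and small: "(norm (v 0 - u 0) + \<epsilon>) * exp ((L + 1) * T) < 1"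
    and x: "x \<in> {0..T}"
  shows "norm (v x - u x) \<le> (norm (v 0 - u 0) + \<epsilon>) * exp ((L + 1) * T)"
proof -
  let ?M = "(norm (v 0 - u 0) + \<epsilon>) * exp ((L + 1) * T)"
  have until: "norm (v y - u y) \<le> ?M" if y: "y \<in> {0..T}"
    and le1: "\<And>t. t \<in> {0..y} \<Longrightarrow> norm (v t - u t) \<le> 1" for y
  proof -
    have "norm ((\<lambda>t. v t - u t) y) \<le> (norm ((\<lambda>t. v t - u t) 0) + \<epsilon>) * exp ((L + 1) * y)"
    proof (rule gronwall_bound)
      show "((\<lambda>t. v t - u t) has_vector_derivative v' t - F (u t)) (at t within {0..y})"
        if "t \<in> {0..y}" for t
        using has_vector_derivative_within_subset[OF v, of t "{0..y}"]
          has_vector_derivative_within_subset[OF u, of t "{0..y}"] that y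
        by (intro has_vector_derivative_diff) auto
      show "norm (v' t - F (u t)) \<le> L * norm (v t - u t) + \<epsilon>" if t: "t \<in> {0..y}" for t
        using norm_triangle_ineq[of "v' t - F (v t)" "F (v t) - F (u t)"]
          lip[of t "v t"] res[of t] le1[OF t] t y by auto
    qed (use nonneg y in auto)
    also have "\<dots> \<le> ?M"
      using y nonneg by (auto intro!: mult_left_mono)
    finally show ?thesis .
  qed
  have cont: "continuous_on {0..T} (\<lambda>t. norm (v t - u t))"
    by (intro continuous_intros continuous_on_vector_derivative[OF v]
        continuous_on_vector_derivative[OF u])
  have one: "norm (v t - u t) < 1" if t: "t \<in> {0..T}" for t
  proof (rule ccontr)
    assume "\<not> ?thesis"
    then have ge: "1 \<le> norm (v t - u t)" by simp
    define S where "S = {s \<in> {0..T}. 1 \<le> norm (v s - u s)}"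
    have "S = {0..T} \<inter> (\<lambda>t. norm (v t - u t)) -` {1..}"
      by (auto simp: S_def)
    then have "closed S"
      using continuous_closed_preimage[OF cont] by simp
    moreover have "bounded S"
      by (rule bounded_subset[of "{0..T}"]) (auto simp: S_def)
    ultimately have "compact S"
      by (simp add: compact_eq_bounded_closed)
    moreover have "t \<in> S" using ge t by (simp add: S_def)
    ultimately obtain y where y: "y \<in> S" "\<And>s. s \<in> S \<Longrightarrow> y \<le> s"
      using compact_attains_inf[of S] by blast
    have y0: "y \<in> {0..T}" "1 \<le> norm (v y - u y)" using y(1) by (auto simp: S_def)
    have "norm (v 0 - u 0) \<le> 1"
      using small nonneg mult_left_mono[of 1 "exp ((L + 1) * T)" "norm (v 0 - u 0) + \<epsilon>"] t by auto
    then have "\<exists>s\<ge>0. s \<le> y \<and> norm (v s - u s) = 1"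
      using y0 continuous_on_subset[OF cont, of "{0..y}"] by (intro IVT') auto
    then obtain s where s: "0 \<le> s" "s \<le> y" "norm (v s - u s) = 1"
      by blast
    have "s \<in> S" using s y0 by (simp add: S_def)
    then have "s = y" using y(2)[of s] s by simp
    have "norm (v r - u r) \<le> 1" if "r \<in> {0..y}" for r
    proof (rule ccontr)
      assume far: "\<not> ?thesis"
      then have "r \<in> S" using that y0 by (simp add: S_def)
      from y(2)[OF this] that have "r = y" by simp
      then show False using far s(3) \<open>s = y\<close> by simp
    qed
    from until[OF y0(1) this] s(3) \<open>s = y\<close> small show False by simp
  qed
  show ?thesis
    by (rule until[OF x]) (use one x in \<open>auto intro!: less_imp_le\<close>)
qed

text \<open>
The uniform quadratic Taylor remainder is the form in which second derivatives enter the estimates.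
\<close>

locale smooth_field =
  fixes F :: "'a::euclidean_space \<Rightarrow> 'a" and F' :: "'a \<Rightarrow> 'a \<Rightarrow>\<^sub>L 'a"
  assumes F_deriv: "\<And>x. (F has_derivative blinfun_apply (F' x)) (at x)"
    and F'_cont: "continuous_on UNIV F'"
    and taylor: "\<And>R. \<exists>K\<ge>0. \<forall>x y. norm x \<le> R \<longrightarrow> norm y \<le> R \<longrightarrow>
                   norm (F y - F x - F' x (y - x)) \<le> K * (norm (y - x))\<^sup>2"

begin

definition solves :: "real \<Rightarrow> (real \<Rightarrow> 'a) \<Rightarrow> bool" where
  "solves X u \<longleftrightarrow> (\<forall>x\<in>{0..X}. (u has_vector_derivative F (u x)) (at x within {0..X}))"

lemma F_cont: "continuous_on S F"
  using F_deriv by (meson continuous_at_imp_continuous_on has_derivative_continuous)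

lemma F'_bounded: "\<exists>L\<ge>0. \<forall>x. norm x \<le> R \<longrightarrow> norm (F' x) \<le> L"
proof -
  have "bounded (F' ` cball 0 R)"
    by (intro compact_imp_bounded compact_continuous_image continuous_on_subset[OF F'_cont]) auto
  then obtain L where L: "\<And>x. x \<in> cball 0 R \<Longrightarrow> norm (F' x) \<le> L"
    by (metis bounded_iff imageI)
  have "norm (F' x) \<le> max 0 L" if "norm x \<le> R" for x
    using L[of x] that by auto
  then show ?thesis by (intro exI[of _ "max 0 L"]) auto
qed

lemma F_lipschitz:
  "\<exists>L\<ge>0. \<forall>x y. norm x \<le> R \<longrightarrow> norm y \<le> R \<longrightarrow> norm (F y - F x) \<le> L * norm (y - x)"
proof -
  obtain L where L: "0 \<le> L" "\<And>x. norm x \<le> R \<Longrightarrow> norm (F' x) \<le> L"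
    using F'_bounded by blast
  have "norm (F y - F x) \<le> L * norm (y - x)" if "norm x \<le> R" "norm y \<le> R" for x y
    by (rule differentiable_bound[of "cball 0 R" F "\<lambda>x. blinfun_apply (F' x)"])
       (use that L in \<open>auto intro: has_derivative_at_withinI[OF F_deriv] simp: norm_blinfun.rep_eq[symmetric]\<close>)
  with L(1) show ?thesis by blast
qed

lemma solution_bounded:
  assumes "solves X u"
  obtains R where "\<And>x. x \<in> {0..X} \<Longrightarrow> norm (u x) \<le> R"
proof -
  have "continuous_on {0..X} u"
    by (rule continuous_on_vector_derivative) (use assms in \<open>auto simp: solves_def\<close>)
  then have "bounded (u ` {0..X})"
    by (intro compact_imp_bounded compact_continuous_image) auto
  then show ?thesis using that by (metis bounded_iff imageI)
qed

lemma solution_unique: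
  assumes u: "solves X u" and v: "solves X v" and init: "u 0 = v 0" and x: "x \<in> {0..X}"
  shows "u x = v x"
proof -
  obtain R where R: "\<And>x. x \<in> {0..X} \<Longrightarrow> norm (u x) \<le> R"
    using solution_bounded[OF u] by blast
  obtain L where L: "0 \<le> L" "\<And>x y. norm x \<le> R + 1 \<Longrightarrow> norm y \<le> R + 1 \<Longrightarrow>
      norm (F y - F x) \<le> L * norm (y - x)"
    using F_lipschitz[of "R + 1"] by blast
  have "norm (v x - u x) \<le> (norm (v 0 - u 0) + 0) * exp ((L + 1) * X)"
  proof (rule solution_stays_close)
    show "norm (F q - F (u t)) \<le> L * norm (q - u t)" if "t \<in> {0..X}" "norm (q - u t) \<le> 1" for t q
      using R[OF that(1)] norm_triangle_ineq[of "q - u t" "u t"] that(2) by (intro L) auto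
    show "(u has_vector_derivative F (u t)) (at t within {0..X})" if "t \<in> {0..X}" for t
      using u that by (auto simp: solves_def)
    show "(v has_vector_derivative F (v t)) (at t within {0..X})" if "t \<in> {0..X}" for t
      using v that by (auto simp: solves_def)
  qed (use L init x in auto)
  then show ?thesis using init by simp
qed

text \<open>
The remainder \<open>v - u - y\<close> solves the linearized equation up to the Taylor remainder of \<open>F\<close> and the term
\<open>s (G v - G u)\<close>. Both are quadratic in the data, since \<open>v - u\<close> is of first order.
\<close>

lemma first_variation:
  assumes u: "solves X u" and G: "0 \<le> Lg" "\<And>x y. norm (G y - G x) \<le> Lg * norm (y - x)"
  obtains C \<rho> where "0 < C" "0 < \<rho>"
    "\<And>v s y x. \<lbrakk>\<And>x. x \<in> {0..X} \<Longrightarrow>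
                  (v has_vector_derivative F (v x) - s *\<^sub>R G (v x)) (at x within {0..X});
        \<And>x. x \<in> {0..X} \<Longrightarrow>
                  (y has_vector_derivative F' (u x) (y x) - s *\<^sub>R G (u x)) (at x within {0..X});
        y 0 = v 0 - u 0; norm (v 0 - u 0) + \<bar>s\<bar> < \<rho>; x \<in> {0..X}\<rbrakk>
      \<Longrightarrow> norm (v x - u x) \<le> C * (norm (v 0 - u 0) + \<bar>s\<bar>) \<and>
          norm (v x - u x - y x) \<le> C * (norm (v 0 - u 0) + \<bar>s\<bar>)\<^sup>2"
proof -
  obtain R where R: "\<And>x. x \<in> {0..X} \<Longrightarrow> norm (u x) \<le> R"
    using solution_bounded[OF u] by blast
  have near: "norm q \<le> R + 1" if "t \<in> {0..X}" "norm (q - u t) \<le> 1" for t q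
    using R[OF that(1)] norm_triangle_ineq[of "q - u t" "u t"] that(2) by simp
  obtain L where L: "0 \<le> L" "\<And>x y. norm x \<le> R + 1 \<Longrightarrow> norm y \<le> R + 1 \<Longrightarrow>
      norm (F y - F x) \<le> L * norm (y - x)"
    using F_lipschitz[of "R + 1"] by blast
  obtain L' where L': "0 \<le> L'" "\<And>x. norm x \<le> R + 1 \<Longrightarrow> norm (F' x) \<le> L'"
    using F'_bounded[of "R + 1"] by blast
  obtain K where K: "0 \<le> K" "\<And>x y. norm x \<le> R + 1 \<Longrightarrow> norm y \<le> R + 1 \<Longrightarrow>
      norm (F y - F x - F' x (y - x)) \<le> K * (norm (y - x))\<^sup>2"
    using taylor[of "R + 1"] by blast
  define M where "M = norm (G 0) + Lg * (\<bar>R\<bar> + 1)"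
  have M: "0 \<le> M" using G(1) by (simp add: M_def)
  have GM: "norm (G q) \<le> M" if "norm q \<le> R + 1" for q
  proof -
    have "Lg * norm q \<le> Lg * (\<bar>R\<bar> + 1)"
      using that G(1) by (intro mult_left_mono) auto
    then show ?thesis
      using norm_triangle_ineq[of "G 0" "G q - G 0"] G(2)[where y=q and x=0] by (simp add: M_def)
  qed
  define A1 where "A1 = (1 + M) * exp ((L + 1) * X)"
  define A2 where "A2 = (K * A1\<^sup>2 + Lg * A1) * exp ((L' + 1) * X)"
  have A1: "0 < A1" using M by (simp add: A1_def)
  have A2: "0 \<le> A2" using A1 K(1) G(1) by (simp add: A2_def)
  show ?thesis
  proof (rule that[of "A1 + A2" "1 / A1"])
    fix v s y x
    assume v: "\<And>x. x \<in> {0..X} \<Longrightarrow>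
                  (v has_vector_derivative F (v x) - s *\<^sub>R G (v x)) (at x within {0..X})"
      and y: "\<And>x. x \<in> {0..X} \<Longrightarrow>
                  (y has_vector_derivative F' (u x) (y x) - s *\<^sub>R G (u x)) (at x within {0..X})"
      and y0: "y 0 = v 0 - u 0" and small: "norm (v 0 - u 0) + \<bar>s\<bar> < 1 / A1" and x: "x \<in> {0..X}"
    define d where "d = norm (v 0 - u 0) + \<bar>s\<bar>"
    have d: "0 \<le> d" "\<bar>s\<bar> \<le> d" "A1 * d < 1"
      using small A1 by (auto simp: d_def field_simps)
    have "norm (v 0 - u 0) + \<bar>s\<bar> * M \<le> (1 + M) * d"
      using M mult_nonneg_nonneg[OF M norm_ge_zero[of "v 0 - u 0"]]
      by (simp add: d_def algebra_simps)
    then have init: "(norm (v 0 - u 0) + \<bar>s\<bar> * M) * exp ((L + 1) * X) \<le> A1 * d"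
      using mult_right_mono[of _ _ "exp ((L + 1) * X)"] unfolding A1_def by (simp add: mult_ac)
    have close: "norm (v t - u t) \<le> A1 * d" if t: "t \<in> {0..X}" for t
    proof -
      have "norm (v t - u t) \<le> (norm (v 0 - u 0) + \<bar>s\<bar> * M) * exp ((L + 1) * X)"
      proof (rule solution_stays_close[OF _ v, where F = F])
        show "(u has_vector_derivative F (u t)) (at t within {0..X})" if "t \<in> {0..X}" for t
          using u that by (auto simp: solves_def)
        show "norm (F q - F (u t)) \<le> L * norm (q - u t)" if "t \<in> {0..X}" "norm (q - u t) \<le> 1" for t q
          using near[OF that] R[OF that(1)] by (intro L) auto
        show "norm (F (v t) - s *\<^sub>R G (v t) - F (v t)) \<le> \<bar>s\<bar> * M"
          if "t \<in> {0..X}" "norm (v t - u t) \<le> 1" for t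
          using GM[OF near[OF that]] by (simp add: mult_left_mono)
      qed (use t L M init d in auto)
      with init show ?thesis by linarith
    qed
    have "norm ((\<lambda>t. v t - u t - y t) x)
        \<le> (norm ((\<lambda>t. v t - u t - y t) 0) + (K * A1\<^sup>2 + Lg * A1) * d\<^sup>2) * exp ((L' + 1) * X)"
    proof (rule gronwall_bound)
      fix t assume t: "t \<in> {0..X}"
      let ?q = "F (v t) - F (u t) - F' (u t) (v t - u t)"
      let ?r = "s *\<^sub>R (G (v t) - G (u t))"
      have ut: "(u has_vector_derivative F (u t)) (at t within {0..X})"
        using u t by (auto simp: solves_def)
      show "((\<lambda>t. v t - u t - y t) has_vector_derivative F' (u t) (v t - u t - y t) + ?q - ?r)
              (at t within {0..X})"
        using has_vector_derivative_diff[OF has_vector_derivative_diff[OF v[OF t] ut] y[OF t]]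
        by (simp add: blinfun.diff_right blinfun.add_right scaleR_diff_right algebra_simps)
      have le1: "norm (v t - u t) \<le> 1" using close[OF t] d(3) by linarith
      have "norm ?q \<le> K * (norm (v t - u t))\<^sup>2"
        using near[OF t le1] R[OF t] by (intro K) auto
      also have "\<dots> \<le> K * (A1 * d)\<^sup>2"
        using close[OF t] K(1) by (intro mult_left_mono power_mono) auto
      finally have q: "norm ?q \<le> K * A1\<^sup>2 * d\<^sup>2" by (simp add: power_mult_distrib)
      have "norm ?r \<le> \<bar>s\<bar> * (Lg * norm (v t - u t))"
        using G(2) by (simp add: mult_left_mono)
      also have "\<dots> \<le> d * (Lg * (A1 * d))"
        using close[OF t] d G(1) by (intro mult_mono mult_nonneg_nonneg) auto
      finally have r: "norm ?r \<le> Lg * A1 * d\<^sup>2" by (simp add: power2_eq_square algebra_simps)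
      have "norm (F' (u t) (v t - u t - y t)) \<le> L' * norm (v t - u t - y t)"
        using norm_blinfun[of "F' (u t)" "v t - u t - y t"] L'(2)[of "u t"] R[OF t]
          mult_right_mono[of "norm (F' (u t))" L' "norm (v t - u t - y t)"] by simp
      then show "norm (F' (u t) (v t - u t - y t) + ?q - ?r)
          \<le> L' * norm (v t - u t - y t) + (K * A1\<^sup>2 + Lg * A1) * d\<^sup>2"
        using q r norm_triangle_ineq[of "F' (u t) (v t - u t - y t)" ?q]
          norm_triangle_ineq4[of "F' (u t) (v t - u t - y t) + ?q" ?r]
        by (simp add: algebra_simps)
    qed (use x A1 K G L' in auto)
    then have "norm (v x - u x - y x) \<le> A2 * d\<^sup>2"
      by (simp add: y0 A2_def algebra_simps)
    moreover have "A1 * d \<le> (A1 + A2) * d" "A2 * d\<^sup>2 \<le> (A1 + A2) * d\<^sup>2"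
      using A1 A2 d by (auto intro!: mult_right_mono)
    ultimately show "norm (v x - u x) \<le> (A1 + A2) * (norm (v 0 - u 0) + \<bar>s\<bar>) \<and>
          norm (v x - u x - y x) \<le> (A1 + A2) * (norm (v 0 - u 0) + \<bar>s\<bar>)\<^sup>2"
      using close[OF x] unfolding d_def by linarith
  qed (use A1 A2 in auto)
qed

end

lemma C2_taylor:
  fixes f :: "'a::euclidean_space \<Rightarrow> 'b::real_normed_vector"
    and f' :: "'a \<Rightarrow> 'a \<Rightarrow>\<^sub>L 'b" and f'' :: "'a \<Rightarrow> 'a \<Rightarrow>\<^sub>L 'a \<Rightarrow>\<^sub>L 'b"
  assumes f: "\<And>x. (f has_derivative blinfun_apply (f' x)) (at x)"
    and f': "\<And>x. (f' has_derivative blinfun_apply (f'' x)) (at x)" and cont: "continuous_on UNIV f''"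
  shows "\<exists>K\<ge>0. \<forall>x y. norm x \<le> R \<longrightarrow> norm y \<le> R \<longrightarrow>
      norm (f y - f x - f' x (y - x)) \<le> K * (norm (y - x))\<^sup>2"
proof -
  have "bounded (f'' ` cball 0 R)"
    by (intro compact_imp_bounded compact_continuous_image continuous_on_subset[OF cont]) auto
  then obtain K where K: "\<And>x. x \<in> cball 0 R \<Longrightarrow> norm (f'' x) \<le> K" by (metis bounded_iff imageI)
  have lip: "norm (f' y - f' x) \<le> K * norm (y - x)" if "x \<in> cball 0 R" "y \<in> cball 0 R" for x y
    by (rule differentiable_bound[of "cball 0 R" f' "\<lambda>x. blinfun_apply (f'' x)"])
       (use that K in \<open>auto intro: has_derivative_at_withinI[OF f'] simp: norm_blinfun.rep_eq[symmetric]\<close>)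
  have "norm (f y - f x - f' x (y - x)) \<le> max 0 K * (norm (y - x))\<^sup>2" if xy: "norm x \<le> R" "norm y \<le> R" for x y
  proof -
    have seg: "closed_segment x y \<subseteq> cball 0 R"
      using xy by (intro closed_segment_subset) auto
    have "norm (f y - f x - f' x (y - x)) \<le> norm (y - x) * (K * norm (y - x))"
    proof (rule differentiable_bound_linearization[where S = "closed_segment x y"])
      show "(f has_derivative blinfun_apply (f' z)) (at z within closed_segment x y)" for z
        by (rule has_derivative_at_withinI[OF f])
      fix t :: real assume t: "t \<in> {0..1}"
      then show "x + t *\<^sub>R (y - x) \<in> closed_segment x y"
        by (auto simp: closed_segment_def algebra_simps intro!: exI[of _ t])
    next
      fix z assume z: "z \<in> closed_segment x y"
      have K0: "0 \<le> K" using order_trans[OF norm_ge_zero K[of x]] xy by simp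
      have "norm (f' z - f' x) \<le> K * norm (z - x)" using seg z xy by (intro lip) auto
      also have "\<dots> \<le> K * norm (y - x)"
        using segment_bound1[OF z] K0 by (simp add: mult_left_mono)
      finally have "norm (f' z - f' x) \<le> K * norm (y - x)" .
      moreover have "blinfun_apply (f' z) - blinfun_apply (f' x) = blinfun_apply (f' z - f' x)"
        by (simp add: fun_eq_iff blinfun.diff_left)
      ultimately show "onorm (blinfun_apply (f' z) - blinfun_apply (f' x)) \<le> K * norm (y - x)"
        by (simp add: norm_blinfun.rep_eq)
    qed simp
    also have "\<dots> \<le> max 0 K * (norm (y - x))\<^sup>2"
      by (simp add: power2_eq_square mult.left_commute mult_right_mono)
    finally show ?thesis .
  qed
  then show ?thesis by (intro exI[of _ "max 0 K"]) auto
qed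

lemma has_derivative_quadratic_bound:
  fixes f :: "'a::real_normed_vector \<Rightarrow> 'b::real_normed_vector"
  assumes L: "bounded_linear L" and C: "0 < C" "0 < \<rho>"
    and bound: "\<And>y. norm (y - a) < \<rho> \<Longrightarrow> norm (f y - f a - L (y - a)) \<le> C * (norm (y - a))\<^sup>2"
  shows "(f has_derivative L) (at a)"
proof -
  have "(f has_derivative L) (at a within UNIV)"
    unfolding has_derivative_within_alt
  proof (intro conjI allI impI L)
    fix e :: real assume e: "0 < e"
    show "\<exists>d>0. \<forall>y\<in>UNIV. norm (y - a) < d \<longrightarrow> norm (f y - f a - L (y - a)) \<le> e * norm (y - a)"
    proof (intro exI[of _ "min \<rho> (e / C)"] conjI ballI impI)
      fix y assume y: "norm (y - a) < min \<rho> (e / C)"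
      have "C * norm (y - a) \<le> e" using y C(1) by (simp add: pos_less_divide_eq mult.commute)
      then have "C * norm (y - a) * norm (y - a) \<le> e * norm (y - a)" by (rule mult_right_mono) simp
      then show "norm (f y - f a - L (y - a)) \<le> e * norm (y - a)"
        using bound[of y] y by (simp add: power2_eq_square mult.assoc)
    qed (use e C in auto)
  qed
  then show ?thesis by simp
qed

section \<open>Periodic solutions\<close>

lemma periodic_int_multiple:
  fixes u :: "real \<Rightarrow> 'a"
  assumes "\<And>x. u (x + T) = u x"
  shows "u (x + of_int n * T) = u x"
proof (induction n rule: int_induct[of _ 0])
  case (step1 i)
  then show ?case using assms[of "x + of_int i * T"] by (simp add: distrib_right add.assoc)
next
  case (step2 i)
  then show ?case using assms[of "x + of_int (i - 1) * T"] by (simp add: algebra_simps)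
qed simp

lemma integral_periodic_multiple:
  fixes h :: "real \<Rightarrow> real"
  assumes h: "continuous_on UNIV h" and per: "\<And>x. h (x + T) = h x" and T: "0 \<le> T"
  shows "integral {0..real k * T} h = real k * integral {0..T} h"
proof (induction k)
  case (Suc k)
  have int: "h integrable_on {a..b}" for a b
    by (intro integrable_continuous_real continuous_on_subset[OF h]) auto
  have "integral {0..real (Suc k) * T} h = integral {0..real k * T} h + integral {real k * T..real (Suc k) * T} h"
    using T by (intro Henstock_Kurzweil_Integration.integral_combine[symmetric] int) (auto simp: distrib_right)
  also have "integral {real k * T..real (Suc k) * T} h = integral {0..T} (\<lambda>x. h (x + real k * T))"
    using integral_shift_real_ivl[of "real k * T" "real k * T" "real (Suc k) * T" h]
    by (simp add: distrib_right)
  also have "(\<lambda>x. h (x + real k * T)) = h"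
    using periodic_int_multiple[of h T _ "int k", OF per] by (simp add: fun_eq_iff)
  finally show ?case using Suc by (simp add: distrib_right)
qed simp

context smooth_field
begin

lemma solves_glue:
  assumes v: "solves a v" and v': "solves b v'" and ab: "0 \<le> a" "0 \<le> b" "v a = v' 0"
  shows "solves (a + b) (\<lambda>x. if x \<le> a then v x else v' (x - a))"
  unfolding solves_def
proof
  fix x assume x: "x \<in> {0..a + b}"
  have "((\<lambda>x. if x \<in> {0..a} then v x else v' (x - a)) has_vector_derivative
      (if x \<in> {0..a} then F (v x) else F (v' (x - a)))) (at x within {0..a + b})"
  proof (rule has_vector_derivative_If_within_closures[where T = "{a..a + b}"])
    show "x \<in> {0..a} \<union> {a..a + b}" "{0..a + b} = {0..a} \<union> {a..a + b}" using x ab by auto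
    have cl: "{0..a} \<union> (closure {0..a} \<inter> closure {a..a + b}) = {0..a}"
      "{a..a + b} \<union> (closure {0..a} \<inter> closure {a..a + b}) = {a..a + b}" using ab by auto
    show "(v has_vector_derivative F (v x)) (at x within {0..a} \<union> (closure {0..a} \<inter> closure {a..a + b}))"
      if "x \<in> {0..a} \<union> (closure {0..a} \<inter> closure {a..a + b})"
      using v that unfolding cl solves_def by blast
    show "((\<lambda>x. v' (x - a)) has_vector_derivative F (v' (x - a)))
        (at x within {a..a + b} \<union> (closure {0..a} \<inter> closure {a..a + b}))"
      if "x \<in> {a..a + b} \<union> (closure {0..a} \<inter> closure {a..a + b})"
    proof -
      have "x \<in> {a..a + b}" using that unfolding cl .
      then have "(v' has_vector_derivative F (v' (x - a))) (at (x - a) within {0..b})"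
        using v' by (simp add: solves_def)
      moreover have "(\<lambda>x. x - a) ` {a..a + b} = {0..b}" by simp
      moreover have "((\<lambda>x. x - a) has_vector_derivative 1) (at x within {a..a + b})"
        by (auto intro!: derivative_eq_intros)
      ultimately show ?thesis
        using vector_diff_chain_within[of "\<lambda>x. x - a" 1 x "{a..a + b}" v' "F (v' (x - a))"]
        unfolding cl by (simp add: o_def)
    qed
    show "v x = v' (x - a)" "F (v x) = F (v' (x - a))"
      if "x \<in> closure {0..a}" "x \<in> closure {a..a + b}"
    proof -
      have "x = a" using that by simp
      then show "v x = v' (x - a)" "F (v x) = F (v' (x - a))" using ab(3) by simp_all
    qed
  qed
  moreover have "(if x \<in> {0..a} then F (v x) else F (v' (x - a))) = F (if x \<le> a then v x else v' (x - a))"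
    using x by auto
  ultimately have "((\<lambda>x. if x \<in> {0..a} then v x else v' (x - a)) has_vector_derivative
      F (if x \<le> a then v x else v' (x - a))) (at x within {0..a + b})" by simp
  then show "((\<lambda>x. if x \<le> a then v x else v' (x - a)) has_vector_derivative
      F (if x \<le> a then v x else v' (x - a))) (at x within {0..a + b})"
    by (rule has_vector_derivative_transform[rotated 2]) (use x in auto)
qed

text \<open>
Around every point the extension is a translate of two copies of \<open>v\<close> glued together; a multiple of \<open>\<tau>\<close>
is a junction and not an end point of such a copy.
\<close>

lemma periodic_extension:
  assumes v: "solves \<tau> v" and \<tau>: "0 < \<tau>" "v \<tau> = v 0"
  obtains V where "\<And>x. (V has_vector_derivative F (V x)) (at x)"
    "\<And>x. V (x + \<tau>) = V x" "\<And>x. 0 \<le> x \<Longrightarrow> x < \<tau> \<Longrightarrow> V x = v x"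
proof -
  define V where "V x = v (\<tau> * frac (x / \<tau>))" for x
  have V: "V x = v (x - of_int k * \<tau>)" if "of_int k * \<tau> \<le> x" "x < of_int k * \<tau> + \<tau>" for k x
  proof -
    have "\<lfloor>x / \<tau>\<rfloor> = k"
      using that \<tau>(1) by (intro floor_unique) (auto simp: field_simps)
    then show ?thesis using \<tau>(1) by (simp add: V_def frac_def right_diff_distrib mult.commute)
  qed
  show ?thesis
  proof (rule that[of V])
    show "V x = v x" if "0 \<le> x" "x < \<tau>" for x using V[of 0 x] that by simp
    show "V (x + \<tau>) = V x" for x
    proof -
      have "frac ((x + \<tau>) / \<tau>) = frac (x / \<tau>)"
        using \<tau>(1) by (simp add: add_divide_distrib frac_def)
      then show ?thesis by (simp add: V_def)
    qed
    fix x :: real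
    define k where "k = \<lceil>x / \<tau>\<rceil> - 1"
    define a where "a = of_int k * \<tau>"
    have "of_int k < x / \<tau>" "x / \<tau> \<le> of_int k + 1" unfolding k_def by linarith+
    then have x: "a < x" "x \<le> a + \<tau>" using \<tau>(1) by (simp_all add: a_def field_simps)
    define W where "W y = (if y \<le> \<tau> then v y else v (y - \<tau>))" for y
    have "solves (\<tau> + \<tau>) W"
      unfolding W_def using solves_glue[OF v v] \<tau> by simp
    then have "(W has_vector_derivative F (W (x - a))) (at (x - a) within {0..\<tau> + \<tau>})"
      using x \<tau>(1) unfolding solves_def by (elim ballE[of _ _ "x - a"]) auto
    moreover have "at (x - a) within {0..\<tau> + \<tau>} = at (x - a)"
      using x \<tau>(1) by (intro at_within_Icc_at) auto
    ultimately have "(W has_vector_derivative F (W (x - a))) (at (x - a))" by simp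
    moreover have "((\<lambda>y. y - a) has_vector_derivative 1) (at x)"
      by (auto intro!: derivative_eq_intros)
    ultimately have "((\<lambda>y. W (y - a)) has_vector_derivative F (W (x - a))) (at x)"
      using vector_diff_chain_at[of "\<lambda>y. y - a" 1 x W "F (W (x - a))"] by (simp add: o_def)
    moreover have eq: "W (y - a) = V y" if y: "y \<in> {a<..<a + (\<tau> + \<tau>)}" for y
    proof -
      consider "y < a + \<tau>" | "y = a + \<tau>" | "a + \<tau> < y" by linarith
      then show ?thesis
      proof cases
        case 1
        then show ?thesis using V[of k y] y by (simp add: W_def a_def)
      next
        case 2
        then show ?thesis using V[of "k + 1" y] \<tau> by (simp add: W_def a_def algebra_simps)
      next
        case 3
        then show ?thesis using V[of "k + 1" y] y by (simp add: W_def a_def algebra_simps)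
      qed
    qed
    ultimately have "(V has_vector_derivative F (W (x - a))) (at x)"
      using x \<tau>(1) has_vector_derivative_transform_within_open[of "\<lambda>y. W (y - a)" _ x "{a<..<a + (\<tau> + \<tau>)}" V]
      by simp
    then show "(V has_vector_derivative F (V x)) (at x)"
      using eq[of x] x \<tau>(1) by simp
  qed
qed

lemma autonomous_unique:
  assumes u: "\<And>x. (u has_vector_derivative F (u x)) (at x)"
    and v: "\<And>x. (v has_vector_derivative F (v x)) (at x)" and eq: "u a = v b" and t: "0 \<le> t"
  shows "u (a + t) = v (b + t)"
proof -
  have shift: "solves t (\<lambda>x. u (a + x))" if u: "\<And>x. (u has_vector_derivative F (u x)) (at x)" for u a
    unfolding solves_def
  proof
    fix x assume "x \<in> {0..t}"
    have "((\<lambda>x. a + x) has_vector_derivative 1) (at x)" by (auto intro!: derivative_eq_intros)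
    from vector_diff_chain_at[OF this u] show "((\<lambda>x. u (a + x)) has_vector_derivative F (u (a + x))) (at x within {0..t})"
      by (simp add: o_def has_vector_derivative_at_within)
  qed
  show ?thesis
    using solution_unique[OF shift[OF u, of a] shift[OF v, of b], of t] eq t by simp
qed

text \<open>
After meeting a zero of the field the solution would stay there, and by periodicity it would be at rest
at time 0 too.
\<close>

lemma periodic_orbit_regular:
  assumes u: "\<And>x. (u has_vector_derivative F (u x)) (at x)"
    and T: "0 < T" "\<And>x. u (x + T) = u x" and "F (u 0) \<noteq> 0"
  shows "F (u x) \<noteq> 0"
proof
  assume 0: "F (u x) = 0"
  define n where "n = \<lceil>x / T\<rceil>"
  have "x / T \<le> of_int n" by (simp add: n_def)
  then have n: "0 \<le> of_int n * T - x" using T(1) by (simp add: pos_divide_le_eq)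
  have "u (x + (of_int n * T - x)) = (\<lambda>_. u x) (0 + (of_int n * T - x))"
    by (rule autonomous_unique[OF u _ _ n]) (simp_all add: 0)
  then have "u (0 + of_int n * T) = u x" by simp
  then have "u 0 = u x" using periodic_int_multiple[of u T 0 n] T(2) by simp
  then show False using 0 assms(4) by simp
qed

text \<open>
The return times to \<open>u 0\<close> in \<open>[0, T]\<close>, other than 0, form a compact set. By uniqueness of solutions its
minimum is a period, and the solution is injective until then.
\<close>

lemma least_period:
  assumes u: "\<And>x. (u has_vector_derivative F (u x)) (at x)"
    and T: "0 < T" "\<And>x. u (x + T) = u x" and "F (u 0) \<noteq> 0"
  obtains T0 k where "0 < T0" "\<And>x. u (x + T0) = u x" "\<And>x. 0 < x \<Longrightarrow> x < T0 \<Longrightarrow> u x \<noteq> u 0"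
    "inj_on u {0..<T0}" "T = real k * T0" "0 < k"
proof -
  have cont: "continuous_on S u" for S
    by (intro continuous_at_imp_continuous_on ballI has_vector_derivative_continuous[OF u])
  have "(u has_derivative (\<lambda>h. h *\<^sub>R F (u 0))) (at 0 within UNIV)"
    using u[of 0] by (simp add: has_vector_derivative_def)
  then obtain \<delta> where \<delta>: "0 < \<delta>"
    "\<And>x. \<bar>x\<bar> < \<delta> \<Longrightarrow> norm (u x - u 0 - x *\<^sub>R F (u 0)) \<le> norm (F (u 0)) / 2 * \<bar>x\<bar>"
    unfolding has_derivative_within_alt using assms(4) 
    by (metis UNIV_I diff_zero half_gt_zero real_norm_def zero_less_norm_iff)
  \<comment> \<open>Leaving \<open>u 0\<close> with nonzero velocity, \<open>u\<close> does not return at once.\<close>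
  have early: "u x \<noteq> u 0" if "0 < x" "x < \<delta>" for x
  proof
    assume "u x = u 0"
    then have "x * norm (F (u 0)) \<le> norm (F (u 0)) / 2 * x" using \<delta>(2)[of x] that by simp
    then show False using that(1) assms(4) by simp
  qed
  define S where "S = {\<delta>/2..T} \<inter> u -` {u 0}"
  have "T \<in> S" using early[of T] T(1) T(2)[of 0] \<delta>(1) by (auto simp: S_def not_less[symmetric])
  moreover have "compact S"
  proof -
    have "closed S" unfolding S_def by (intro continuous_closed_preimage cont) auto
    moreover have "bounded S" by (rule bounded_subset[of "{\<delta>/2..T}"]) (auto simp: S_def)
    ultimately show ?thesis by (simp add: compact_eq_bounded_closed)
  qed
  ultimately obtain T0 where T0: "T0 \<in> S" "\<And>x. x \<in> S \<Longrightarrow> T0 \<le> x"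
    using compact_attains_inf[of S] by blast
  have T0_pos: "0 < T0" "T0 \<le> T" "u T0 = u 0" using T0(1) \<delta>(1) by (auto simp: S_def)
  have first: "u x \<noteq> u 0" if "0 < x" "x < T0" for x
    using T0(2)[of x] early[of x] that T0_pos(2) \<delta>(1) by (cases "x < \<delta>") (auto simp: S_def)
  have per: "u (x + T0) = u x" for x
  proof -
    define n where "n = \<lceil>- x / T\<rceil>"
    have "- x / T \<le> of_int n" by (simp add: n_def)
    from mult_right_mono[OF this, of T] have n: "0 \<le> x + of_int n * T" using T(1) by simp
    have "u (T0 + (x + of_int n * T)) = u (0 + (x + of_int n * T))"
      by (rule autonomous_unique[OF u u T0_pos(3) n])
    then show ?thesis
      using periodic_int_multiple[of u T "x + T0" n] periodic_int_multiple[of u T x n] T(2)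
      by (simp add: add_ac)
  qed
  have no_pair: False if xy: "0 \<le> x" "x < y" "y < T0" "u x = u y" for x y
  proof -
    have "u (x + (T0 - y)) = u (y + (T0 - y))"
      by (rule autonomous_unique[OF u u xy(4)]) (use xy in simp)
    then have "u (x + (T0 - y)) = u 0" using T0_pos(3) by simp
    then show False using first[of "x + (T0 - y)"] xy by simp
  qed
  have inj: "inj_on u {0..<T0}"
  proof (rule inj_onI)
    fix x y assume "x \<in> {0..<T0}" "y \<in> {0..<T0}" "u x = u y"
    then show "x = y" using no_pair[of x y] no_pair[of y x] by (cases x y rule: linorder_cases) auto
  qed
  define m where "m = \<lfloor>T / T0\<rfloor>"
  have m: "of_int m \<le> T / T0" "T / T0 < of_int m + 1" unfolding m_def by linarith+
  have m_bounds: "0 \<le> T - of_int m * T0" "T - of_int m * T0 < T0"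
    using m T0_pos(1) by (simp_all add: field_simps)
  have "u (T - of_int m * T0) = u 0"
    using periodic_int_multiple[of u T0 "T - of_int m * T0" m] per T(2)[of 0] by simp
  then have Tm: "T = of_int m * T0" using first[of "T - of_int m * T0"] m_bounds by fastforce
  have "1 \<le> T / T0" using T0_pos(1,2) by simp
  then have "1 \<le> m" unfolding m_def by simp
  then have "T = real (nat m) * T0" "0 < nat m" using Tm by simp_all
  with T0_pos(1) per first inj show ?thesis by (rule that)
qed

end

section \<open>The area form of the plane\<close>

definition wedge :: "real^2 \<Rightarrow> real^2 \<Rightarrow> real" where
  "wedge a b = a $ 1 * b $ 2 - a $ 2 * b $ 1"

definition rot :: "real^2 \<Rightarrow> real^2" where
  "rot a = vector [- (a $ 2), a $ 1]"

lemma rot_nth [simp]: "rot a $ 1 = - (a $ 2)" "rot a $ 2 = a $ 1"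
  by (simp_all add: rot_def)

lemma vec2_eq_iff: "a = b \<longleftrightarrow> a $ 1 = b $ 1 \<and> a $ 2 = b $ 2" for a b :: "real^2"
  by (simp add: vec_eq_iff forall_2)

lemma inner_vec2: "a \<bullet> b = a $ 1 * b $ 1 + a $ 2 * b $ 2" for a b :: "real^2"
  by (simp add: inner_vec_def sum_2)

lemma rot_inner: "rot a \<bullet> b = wedge a b"
  by (simp add: inner_vec2 wedge_def)

lemma bounded_linear_rot: "bounded_linear rot"
  by (rule linear_conv_bounded_linear[THEN iffD1])
     (auto simp: linear_iff vec2_eq_iff)

lemma bounded_bilinear_wedge: "bounded_bilinear wedge"
proof -
  have "bounded_bilinear (\<lambda>a b. rot a \<bullet> b)"
    using bounded_bilinear.comp1[OF bounded_bilinear_inner bounded_linear_rot] .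
  then show ?thesis by (simp add: rot_inner)
qed

lemma wedge_self [simp]: "wedge a a = 0"
  by (simp add: wedge_def)

lemma vec2_decomposition:
  fixes p v :: "real^2"
  assumes "p \<noteq> 0"
  shows "v = ((v \<bullet> p) / (p \<bullet> p)) *\<^sub>R p + wedge p v *\<^sub>R ((1 / (p \<bullet> p)) *\<^sub>R rot p)"
proof -
  have pp: "p \<bullet> p \<noteq> 0" using assms by simp
  have "v $ i * (p \<bullet> p) = (v \<bullet> p) * p $ i + wedge p v * rot p $ i" for i
    using exhaust_2[of i] by (auto simp: inner_vec2 wedge_def algebra_simps)
  then show ?thesis
    using pp by (simp add: vec_eq_iff field_simps)
qed

text \<open>
A linear map changes the area form at the rate given by its trace.
\<close>

lemma wedge_trace:
  fixes A :: "real^2^2"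
  shows "wedge (A *v a) b + wedge a (A *v b) = trace A * wedge a b"
  by (simp add: wedge_def matrix_vector_mult_def sum_2 trace_def algebra_simps)

text \<open>
Apply the trace identity for \<open>C\<close> to the images of the basis vectors under \<open>B\<close>, which span area \<open>det B\<close>.
\<close>

lemma trace_inverse:
  fixes B C :: "real^2^2"
  assumes "C ** B = mat 1"
  shows "trace C * det B = trace B"
proof -
  have CB: "C *v (B *v a) = a" for a by (simp add: matrix_vector_mul_assoc assms)
  have "wedge (B *v axis 1 1) (B *v axis 2 1) = det B"
    by (simp add: wedge_def matrix_vector_mult_def sum_2 axis_def det_2 algebra_simps)
  moreover have "trace C * wedge (B *v axis 1 1) (B *v axis 2 1) = trace B * wedge (axis 1 1) (axis 2 1)"
    using wedge_trace[of C "B *v axis 1 1" "B *v axis 2 1"] wedge_trace[of B "axis 1 1" "axis 2 1"]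
    by (simp add: CB)
  ultimately show ?thesis by (simp add: wedge_def axis_def)
qed

text \<open>
Each of the vectors \<open>?x\<close>, \<open>?y\<close> formed from a row of \<open>B - l\<close> is in the kernel of \<open>B - l\<close>; if both vanish, then the first
basis vector is an eigenvector.
\<close>

lemma root_in_spectrum:
  fixes B :: "real^2^2"
  assumes root: "l\<^sup>2 - of_real (trace B) * l + of_real (det B) = 0"
  shows "l \<in> complex_spectrum B"
proof -
  have tr: "trace B = B$1$1 + B$2$2" by (simp add: trace_def sum_2)
  have char: "l * l = (of_real (B$1$1) + of_real (B$2$2)) * l - (of_real (B$1$1) * of_real (B$2$2) - of_real (B$1$2) * of_real (B$2$1))"
    using root by (simp add: tr det_2 power2_eq_square algebra_simps)
  define M :: "complex^2 \<Rightarrow> bool" where "M x \<longleftrightarrow> map_matrix complex_of_real B *v x = l *s x" for x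
  have M: "M x \<longleftrightarrow> of_real (B$1$1) * x$1 + of_real (B$1$2) * x$2 = l * x$1 \<and>
      of_real (B$2$1) * x$1 + of_real (B$2$2) * x$2 = l * x$2" for x
    by (simp add: M_def vec_eq_iff forall_2 matrix_vector_mult_def sum_2 map_matrix_def)
  have nz: "x \<noteq> 0 \<longleftrightarrow> x$1 \<noteq> 0 \<or> x$2 \<noteq> 0" for x :: "complex^2"
    by (simp add: vec_eq_iff forall_2)
  let ?x = "vector [of_real (B$1$2), l - of_real (B$1$1)] :: complex^2"
  let ?y = "vector [l - of_real (B$2$2), of_real (B$2$1)] :: complex^2"
  let ?z = "vector [1, 0] :: complex^2"
  have "M ?x" "M ?y"
    unfolding M using char by (simp_all add: algebra_simps)
  moreover have "M ?z" if "?x = 0" "?y = 0"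
  proof -
    have "l = of_real (B$1$1)" "B$2$1 = 0"
      using that by (auto simp: vec_eq_iff forall_2)
    then show ?thesis unfolding M by simp
  qed
  moreover have "?z \<noteq> 0" by (simp add: nz)
  ultimately have "\<exists>x. x \<noteq> 0 \<and> M x" by blast
  then show ?thesis by (simp add: M_def complex_spectrum_def)
qed

lemma spectrum_right_half_plane:
  fixes B :: "real^2^2"
  assumes "\<forall>l\<in>complex_spectrum B. Re l > 0"
  shows "0 < det B" "0 < trace B"
proof -
  \<comment> \<open>\<open>l\<close> is the eigenvalue of smallest real part.\<close>
  define d where "d = csqrt (of_real ((trace B)\<^sup>2 - 4 * det B))"
  define l where "l = (of_real (trace B) - d) / 2"
  have dd: "d * d = of_real ((trace B)\<^sup>2 - 4 * det B)"
    using power2_csqrt[of "of_real ((trace B)\<^sup>2 - 4 * det B)"] by (simp add: d_def power2_eq_square)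
  have "l\<^sup>2 - of_real (trace B) * l + of_real (det B)
      = (d * d - of_real ((trace B)\<^sup>2 - 4 * det B)) / 4"
    by (simp add: l_def power2_eq_square field_simps)
  then have "0 < Re l" using dd assms root_in_spectrum[of l B] by simp
  then have less: "Re d < trace B" by (simp add: l_def)
  have "0 \<le> Re d" using csqrt_principal[of "of_real ((trace B)\<^sup>2 - 4 * det B)"] by (auto simp: d_def)
  with less show "0 < trace B" by linarith
  show "0 < det B"
  proof (rule ccontr)
    assume "\<not> 0 < det B"
    then have "(trace B)\<^sup>2 \<le> (trace B)\<^sup>2 - 4 * det B" by simp
    then have "trace B \<le> sqrt ((trace B)\<^sup>2 - 4 * det B)" by (rule real_le_rsqrt)
    moreover have "0 \<le> (trace B)\<^sup>2 - 4 * det B"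
      using \<open>(trace B)\<^sup>2 \<le> _\<close> zero_le_power2[of "trace B"] by linarith
    then have "d = of_real (sqrt ((trace B)\<^sup>2 - 4 * det B))"
      unfolding d_def by (rule of_real_sqrt[symmetric])
    ultimately show False using less by simp
  qed
qed

section \<open>Linearization of a divergence-free field along a closed orbit\<close>

locale divergence_free_field = smooth_field F F' for F :: "real^2 \<Rightarrow> real^2" and F' +
  assumes div_free: "\<And>x a b. wedge (F' x a) b + wedge a (F' x b) = 0"

begin

text \<open>
Poincare's lemma: vanishing divergence says that the 1-form \<open>wedge (F p)\<close> is closed. Its radial primitive is
differentiated under the integral sign, and closedness turns the result into the integral of the
derivative of \<open>t * wedge (F (t p)) h\<close>.
\<close>

lemma first_integral:
  obtains H where "\<And>p. (H has_derivative wedge (F p)) (at p)"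
proof -
  define fx where "fx \<equiv> \<lambda>(p::real^2) (t::real).
      t *\<^sub>R (blinfun_inner_right (- rot p) o\<^sub>L F' (t *\<^sub>R p)) + blinfun_inner_right (rot (F (t *\<^sub>R p)))"
  define H where "H \<equiv> \<lambda>p. integral {0..1} (\<lambda>t. rot (F (t *\<^sub>R p)) \<bullet> p)"
  have fx_apply: "fx p t h = t * wedge (F' (t *\<^sub>R p) h) p + wedge (F (t *\<^sub>R p)) h" for p t h
    by (simp add: fx_def blinfun.bilinear_simps rot_inner wedge_def)
  have "((\<lambda>p. integral (cbox 0 1) (\<lambda>t. rot (F (t *\<^sub>R p)) \<bullet> p)) has_derivative
          integral (cbox 0 1) (fx p)) (at p within UNIV)" for p
  proof (rule leibniz_rule)
    show "((\<lambda>p. rot (F (t *\<^sub>R p)) \<bullet> p) has_derivative blinfun_apply (fx p t)) (at p within UNIV)" for p t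
    proof -
      have "((\<lambda>p. F (t *\<^sub>R p)) has_derivative (\<lambda>h. F' (t *\<^sub>R p) (t *\<^sub>R h))) (at p)"
        by (rule has_derivative_compose[OF _ F_deriv]) (auto intro!: derivative_eq_intros)
      then have "((\<lambda>p. rot (F (t *\<^sub>R p))) has_derivative (\<lambda>h. rot (F' (t *\<^sub>R p) (t *\<^sub>R h)))) (at p)"
        by (rule bounded_linear.has_derivative[OF bounded_linear_rot])
      from has_derivative_inner[OF this has_derivative_ident]
      show ?thesis
        by (rule has_derivative_eq_rhs)
           (auto simp: fun_eq_iff fx_apply rot_inner blinfun.scaleR_right wedge_def algebra_simps)
    qed
    show "(\<lambda>t. rot (F (t *\<^sub>R p)) \<bullet> p) integrable_on cbox 0 1" for p
      by (intro integrable_continuous continuous_intros bounded_linear.continuous_on[OF bounded_linear_rot]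
          continuous_on_compose2[OF F_cont]) auto
    show "continuous_on (UNIV \<times> cbox 0 1) (\<lambda>(p, t). fx p t)"
      unfolding fx_def case_prod_beta
      by (intro continuous_intros bounded_linear.continuous_on[OF bounded_linear_rot]
          bounded_linear.continuous_on[OF bounded_linear_blinfun_inner_right]
          continuous_on_compose2[OF F_cont] continuous_on_compose2[OF F'_cont]) auto
  qed auto
  then have H_deriv: "(H has_derivative integral {0..1} (fx p)) (at p)" for p
    by (simp add: H_def)
  have fx_cont: "continuous_on {0..1} (fx p)" for p
    unfolding fx_def
    by (intro continuous_intros bounded_linear.continuous_on[OF bounded_linear_rot]
          bounded_linear.continuous_on[OF bounded_linear_blinfun_inner_right]
          continuous_on_compose2[OF F_cont] continuous_on_compose2[OF F'_cont]) auto
  have "integral {0..1} (fx p) h = wedge (F p) h" for p h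
  proof -
    have "integral {0..1} (fx p) h = integral {0..1} (\<lambda>t. fx p t h)"
      by (rule blinfun_apply_integral) (rule integrable_continuous_real[OF fx_cont])
    also have "((\<lambda>t. fx p t h) has_integral 1 * wedge (F (1 *\<^sub>R p)) h - 0 * wedge (F (0 *\<^sub>R p)) h) {0..1}"
    proof (rule fundamental_theorem_of_calculus)
      fix t :: real
      have "((\<lambda>t. F (t *\<^sub>R p)) has_vector_derivative F' (t *\<^sub>R p) p) (at t within {0..1})"
        unfolding has_vector_derivative_def
        by (rule has_derivative_eq_rhs[OF has_derivative_compose[OF _ F_deriv]])
           (auto intro!: derivative_eq_intros simp: blinfun.scaleR_right)
      from bounded_bilinear.has_vector_derivative[OF bounded_bilinear_wedge this has_vector_derivative_const[of h]]
      have W: "((\<lambda>t. wedge (F (t *\<^sub>R p)) h) has_vector_derivative wedge (F' (t *\<^sub>R p) p) h) (at t within {0..1})"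
        by (simp add: wedge_def)
      have "((\<lambda>t. t * wedge (F (t *\<^sub>R p)) h) has_vector_derivative
          t * wedge (F' (t *\<^sub>R p) p) h + 1 * wedge (F (t *\<^sub>R p)) h) (at t within {0..1})"
        by (rule has_vector_derivative_mult[OF has_vector_derivative_id W])
      moreover have "wedge (F' (t *\<^sub>R p) p) h = wedge (F' (t *\<^sub>R p) h) p"
        using div_free[of "t *\<^sub>R p" p h] by (simp add: wedge_def algebra_simps)
      ultimately show "((\<lambda>t. t * wedge (F (t *\<^sub>R p)) h) has_vector_derivative fx p t h) (at t within {0..1})"
        by (simp add: fx_apply)
    qed simp
    then have "integral {0..1} (\<lambda>t. fx p t h) = wedge (F p) h" by (simp add: integral_unique)
    finally show ?thesis .
  qed
  then have "blinfun_apply (integral {0..1} (fx p)) = wedge (F p)" for p by (simp add: fun_eq_iff)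
  with H_deriv show ?thesis using that[of H] by simp
qed

lemma first_integral_constant:
  assumes H: "\<And>p. (H has_derivative wedge (F p)) (at p)" and v: "solves X v" and x: "x \<in> {0..X}"
  shows "H (v x) = H (v 0)"
proof -
  have "((\<lambda>t. H (v t)) has_derivative (\<lambda>h. 0)) (at t within {0..X})" if "t \<in> {0..X}" for t
  proof -
    have "(v has_derivative (\<lambda>h. h *\<^sub>R F (v t))) (at t within {0..X})"
      using v that by (simp add: solves_def has_vector_derivative_def)
    from has_derivative_compose[OF this H]
    show ?thesis
      by (rule has_derivative_eq_rhs) (auto simp: wedge_def)
  qed
  then show ?thesis
    using has_derivative_zero_constant[of "{0..X}" "\<lambda>t. H (v t)"] x by fastforce
qed

end

locale closed_orbit = divergence_free_field F F' for F F' +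
  fixes u :: "real \<Rightarrow> real^2"
  assumes u_deriv: "\<And>x. (u has_vector_derivative F (u x)) (at x)"
    and u_start: "F (u 0) = axis 1 1"
    and u_regular: "\<And>x. F (u x) \<noteq> 0"

begin

lemma u_cont: "continuous_on S u"
  by (intro continuous_at_imp_continuous_on ballI has_vector_derivative_continuous[OF u_deriv])

lemma Fu_cont: "continuous_on S (\<lambda>x. F (u x))"
  by (rule continuous_on_compose2[OF F_cont u_cont]) auto

lemma F'u_cont: "continuous_on S (\<lambda>x. F' (u x))"
  by (rule continuous_on_compose2[OF F'_cont u_cont]) auto

lemma solves_u: "solves X u"
  by (simp add: solves_def has_vector_derivative_at_within[OF u_deriv])

lemma Fu_deriv: "((\<lambda>x. F (u x)) has_vector_derivative F' (u x) (F (u x))) (at x within S)"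
proof -
  have "((\<lambda>x. F (u x)) has_derivative (\<lambda>h. F' (u x) (h *\<^sub>R F (u x)))) (at x)"
    using u_deriv[of x, unfolded has_vector_derivative_def] F_deriv by (rule has_derivative_compose)
  then show ?thesis
    by (simp add: has_vector_derivative_def blinfun.scaleR_right has_derivative_at_withinI)
qed

lemma component_deriv: "((\<lambda>x. u x $ i) has_real_derivative F (u x) $ i) (at x within S)"
  using bounded_linear.has_vector_derivative[OF bounded_linear_vec_nth has_vector_derivative_at_within[OF u_deriv]]
  by (simp add: has_real_derivative_iff_has_vector_derivative)

lemma speed_pos: "F (u x) \<bullet> F (u x) \<noteq> 0"
  using u_regular by simp

text \<open>
Scaled so that its wedge product with the velocity is 1.
\<close>

definition normal :: "real \<Rightarrow> real^2" where
  "normal x = (1 / (F (u x) \<bullet> F (u x))) *\<^sub>R rot (F (u x))"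

text \<open>
The amount by which \<open>normal\<close> fails to solve the linearized equation.
\<close>

definition normal_defect :: "real \<Rightarrow> real^2" where
  "normal_defect x = F' (u x) (normal x) - ((1 / (F (u x) \<bullet> F (u x))) *\<^sub>R rot (F' (u x) (F (u x)))
     - (2 * (F (u x) \<bullet> F' (u x) (F (u x))) / (F (u x) \<bullet> F (u x))\<^sup>2) *\<^sub>R rot (F (u x)))"

definition shear_rate :: "real \<Rightarrow> real" where
  "shear_rate x = (normal_defect x \<bullet> F (u x)) / (F (u x) \<bullet> F (u x))"

text \<open>
The multiple of the velocity that turns \<open>normal\<close> into a solution of the linearized equation.
\<close>

definition shear :: "real \<Rightarrow> real" where
  "shear x = integral {0..x} shear_rate"

lemma normal_deriv:
  "(normal has_vector_derivative F' (u x) (normal x) - normal_defect x) (at x within S)"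
proof -
  have sq: "((\<lambda>x. F (u x) \<bullet> F (u x)) has_real_derivative 2 * (F (u x) \<bullet> F' (u x) (F (u x)))) (at x within S)"
    using has_derivative_inner[OF Fu_deriv[unfolded has_vector_derivative_def] Fu_deriv[unfolded has_vector_derivative_def], of x S]
    by (simp add: has_field_derivative_def inner_commute algebra_simps mult_commute_abs)
  have inv: "((\<lambda>x. 1 / (F (u x) \<bullet> F (u x))) has_real_derivative
      - (2 * (F (u x) \<bullet> F' (u x) (F (u x))) / (F (u x) \<bullet> F (u x))\<^sup>2)) (at x within S)"
    using sq speed_pos by (auto intro!: derivative_eq_intros simp: power2_eq_square)
  have "((\<lambda>x. rot (F (u x))) has_vector_derivative rot (F' (u x) (F (u x)))) (at x within S)"
    using bounded_linear.has_vector_derivative[OF bounded_linear_rot Fu_deriv] .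
  from has_vector_derivative_scaleR[OF inv this]
  show ?thesis
    unfolding normal_def normal_defect_def by simp
qed

lemma normal_start: "normal 0 = axis 2 1"
  by (simp add: normal_def u_start vec2_eq_iff inner_vec2 axis_def)

lemma normal_cont: "continuous_on S normal"
  by (rule continuous_on_vector_derivative[OF normal_deriv])

lemma normal_defect_cont: "continuous_on S normal_defect"
  unfolding normal_defect_def
  by (intro continuous_intros bounded_linear.continuous_on[OF bounded_linear_rot] Fu_cont F'u_cont normal_cont)
     (use speed_pos in auto)

lemma shear_rate_cont: "continuous_on S shear_rate"
  unfolding shear_rate_def
  by (intro continuous_intros Fu_cont normal_defect_cont) (use speed_pos in auto)

lemma wedge_velocity_normal: "wedge (F (u x)) (normal x) = 1"
proof -
  have "wedge p (a *\<^sub>R rot p) = a * (p \<bullet> p)" for a p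
    by (simp add: wedge_def inner_vec2 algebra_simps)
  then show ?thesis using speed_pos[of x] by (simp add: normal_def)
qed

text \<open>
The linearized flow and the normal both keep the wedge product with the velocity constant, so the
defect is parallel to the velocity.
\<close>

lemma normal_defect_eq: "normal_defect x = shear_rate x *\<^sub>R F (u x)"
proof -
  have "((\<lambda>x. wedge (F (u x)) (normal x)) has_vector_derivative
      wedge (F (u x)) (F' (u x) (normal x) - normal_defect x) + wedge (F' (u x) (F (u x))) (normal x)) (at x)"
    by (rule bounded_bilinear.has_vector_derivative[OF bounded_bilinear_wedge Fu_deriv normal_deriv])
  moreover have "((\<lambda>x. wedge (F (u x)) (normal x)) has_vector_derivative 0) (at x)"
    by (simp add: wedge_velocity_normal)
  ultimately have "wedge (F (u x)) (F' (u x) (normal x) - normal_defect x) + wedge (F' (u x) (F (u x))) (normal x) = 0"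
    by (rule vector_derivative_unique_at)
  then have "wedge (F (u x)) (normal_defect x) = 0"
    using div_free[of "u x" "F (u x)" "normal x"] by (simp add: wedge_def algebra_simps)
  then show ?thesis
    using vec2_decomposition[OF u_regular[of x], of "normal_defect x"] by (simp add: shear_rate_def)
qed

lemma integral_deriv:
  assumes "continuous_on UNIV h" "x \<in> {0..X}"
  shows "((\<lambda>x. integral {0..x} h) has_real_derivative h x) (at x within {0..X})"
  using integral_has_real_derivative[of 0 X h x] assms continuous_on_subset by blast

lemma transverse_variation:
  assumes x: "x \<in> {0..X}"
  shows "((\<lambda>x. shear x *\<^sub>R F (u x) + normal x) has_vector_derivative
           F' (u x) (shear x *\<^sub>R F (u x) + normal x)) (at x within {0..X})"
proof -
  have "((\<lambda>x. shear x) has_real_derivative shear_rate x) (at x within {0..X})"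
    unfolding shear_def by (rule integral_deriv[OF shear_rate_cont x])
  from has_vector_derivative_add[OF has_vector_derivative_scaleR[OF this Fu_deriv] normal_deriv]
  show ?thesis
    by (simp add: normal_defect_eq blinfun.bilinear_simps)
qed

lemma shear_0 [simp]: "shear 0 = 0"
  by (simp add: shear_def)

text \<open>
The solution of the linearized equation with initial value \<open>d\<close>, as a combination of the velocity and the
second solution; at time 0 these are the two basis vectors.
\<close>

definition variation :: "real^2 \<Rightarrow> real \<Rightarrow> real^2" where
  "variation d x = d $ 1 *\<^sub>R F (u x) + d $ 2 *\<^sub>R (shear x *\<^sub>R F (u x) + normal x)"

lemma variation_deriv:
  assumes "x \<in> {0..X}"
  shows "(variation d has_vector_derivative F' (u x) (variation d x)) (at x within {0..X})"
proof -
  have "((\<lambda>x. d $ 1 *\<^sub>R F (u x) + d $ 2 *\<^sub>R (shear x *\<^sub>R F (u x) + normal x)) has_vector_derivative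
      d $ 1 *\<^sub>R F' (u x) (F (u x)) + d $ 2 *\<^sub>R F' (u x) (shear x *\<^sub>R F (u x) + normal x)) (at x within {0..X})"
    by (intro has_vector_derivative_add bounded_linear.has_vector_derivative[OF bounded_linear_scaleR_right]
        Fu_deriv transverse_variation[OF assms])
  then show ?thesis
    by (simp add: variation_def[abs_def] blinfun.bilinear_simps)
qed

lemma variation_return:
  assumes "u x = u 0"
  shows "variation d x = d + (shear x * d $ 2) *\<^sub>R axis 1 1"
proof -
  have "F (u x) = axis 1 1" "normal x = axis 2 1"
    using assms u_start normal_start by (simp_all add: normal_def)
  then show ?thesis
    by (simp add: variation_def vec2_eq_iff axis_def)
qed

lemma linear_variation: "bounded_linear (\<lambda>d. variation d x)"
  unfolding variation_def
  by (intro bounded_linear_add bounded_linear_scaleR_const bounded_linear_vec_nth)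

text \<open>
The coefficient along \<open>normal\<close> of the solution of the linearized equation forced by \<open>G\<close>. It is the flux
of \<open>G\<close> across the orbit.
\<close>

definition flux :: "(real^2 \<Rightarrow> real^2) \<Rightarrow> real \<Rightarrow> real" where
  "flux G x = integral {0..x} (\<lambda>x. wedge (F (u x)) (G (u x)))"

text \<open>
The coefficient along the velocity of the same solution.
\<close>

definition drift :: "(real^2 \<Rightarrow> real^2) \<Rightarrow> real \<Rightarrow> real" where
  "drift G x = integral {0..x} (\<lambda>x. flux G x * shear_rate x + (G (u x) \<bullet> F (u x)) / (F (u x) \<bullet> F (u x)))"

text \<open>
Variation of constants: along the orbit, \<open>G\<close> is decomposed into multiples of velocity and normal.
\<close>

lemma forced_variation:
  assumes G: "continuous_on UNIV G" and x: "x \<in> {0..X}"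
  shows "((\<lambda>x. drift G x *\<^sub>R F (u x) + flux G x *\<^sub>R normal x) has_vector_derivative
           F' (u x) (drift G x *\<^sub>R F (u x) + flux G x *\<^sub>R normal x) + G (u x)) (at x within {0..X})"
proof -
  have Gu: "continuous_on S (\<lambda>x. G (u x))" for S
    by (rule continuous_on_compose2[OF G u_cont]) auto
  have "continuous_on UNIV (\<lambda>x. wedge (F (u x)) (G (u x)))"
    by (rule bounded_bilinear.continuous_on[OF bounded_bilinear_wedge Fu_cont Gu])
  from integral_deriv[OF this]
  have flux: "(flux G has_real_derivative wedge (F (u x)) (G (u x))) (at x within {0..X})"
    if "x \<in> {0..X}" for x unfolding flux_def using that .
  have "continuous_on {0..X} (\<lambda>x. flux G x * shear_rate x + (G (u x) \<bullet> F (u x)) / (F (u x) \<bullet> F (u x)))"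
    by (intro continuous_intros DERIV_continuous_on[OF flux] shear_rate_cont Gu Fu_cont)
       (use speed_pos in auto)
  then have drift: "(drift G has_real_derivative flux G x * shear_rate x + (G (u x) \<bullet> F (u x)) / (F (u x) \<bullet> F (u x)))
      (at x within {0..X})"
    unfolding drift_def using x by (intro integral_has_real_derivative)
  have eq: "G (u x) = ((G (u x) \<bullet> F (u x)) / (F (u x) \<bullet> F (u x))) *\<^sub>R F (u x)
      + wedge (F (u x)) (G (u x)) *\<^sub>R normal x"
    unfolding normal_def by (rule vec2_decomposition[OF u_regular])
  show ?thesis
    using has_vector_derivative_add[OF has_vector_derivative_scaleR[OF drift Fu_deriv]
        has_vector_derivative_scaleR[OF flux[OF x] normal_deriv]]
    by (subst eq) (simp add: normal_defect_eq blinfun.bilinear_simps algebra_simps)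
qed

lemma periodic_coefficients:
  assumes "\<And>x. u (x + T0) = u x" "0 \<le> T0"
  shows "shear (real k * T0) = real k * shear T0"
    and "continuous_on UNIV G \<Longrightarrow> flux G (real k * T0) = real k * flux G T0"
proof -
  show "shear (real k * T0) = real k * shear T0"
    unfolding shear_def
    by (rule integral_periodic_multiple[OF shear_rate_cont _ assms(2)])
       (simp add: shear_rate_def normal_defect_def normal_def assms(1))
  assume G: "continuous_on UNIV G"
  have "continuous_on UNIV (\<lambda>x. wedge (F (u x)) (G (u x)))"
    by (intro bounded_bilinear.continuous_on[OF bounded_bilinear_wedge Fu_cont] continuous_on_compose2[OF G u_cont]) auto
  then show "flux G (real k * T0) = real k * flux G T0"
    unfolding flux_def by (rule integral_periodic_multiple[OF _ _ assms(2)]) (simp add: assms(1))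
qed

section \<open>Dependence of the solution on initial value and speed\<close>

lemma initial_value_expansion:
  assumes \<Phi>: "\<forall>\<^sub>F p in nhds (u 0). solves X (\<Phi> p) \<and> \<Phi> p 0 = p"
  shows "\<exists>C>0. \<exists>\<rho>>0. \<forall>p. norm (p - u 0) < \<rho> \<longrightarrow> solves X (\<Phi> p) \<and> \<Phi> p 0 = p \<and>
    (\<forall>x\<in>{0..X}. norm (\<Phi> p x - u x) \<le> C * norm (p - u 0) \<and>
       norm (\<Phi> p x - u x - variation (p - u 0) x) \<le> C * (norm (p - u 0))\<^sup>2)"
proof -
  obtain C \<rho>v where C: "0 < C" "0 < \<rho>v" and first:
    "\<And>v y x. \<lbrakk>solves X v;
        \<And>x. x \<in> {0..X} \<Longrightarrow> (y has_vector_derivative F' (u x) (y x)) (at x within {0..X});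
        y 0 = v 0 - u 0; norm (v 0 - u 0) < \<rho>v; x \<in> {0..X}\<rbrakk>
      \<Longrightarrow> norm (v x - u x) \<le> C * norm (v 0 - u 0) \<and>
          norm (v x - u x - y x) \<le> C * (norm (v 0 - u 0))\<^sup>2"
  proof (rule first_variation[OF solves_u[of X], where Lg = 0 and G = "\<lambda>_. 0"])
    fix C \<rho>v :: real
    assume "0 < C" "0 < \<rho>v" and
      *: "\<And>v s y x. \<lbrakk>\<And>x. x \<in> {0..X} \<Longrightarrow>
                  (v has_vector_derivative F (v x) - s *\<^sub>R (0::real^2)) (at x within {0..X});
        \<And>x. x \<in> {0..X} \<Longrightarrow>
                  (y has_vector_derivative F' (u x) (y x) - s *\<^sub>R 0) (at x within {0..X});
        y 0 = v 0 - u 0; norm (v 0 - u 0) + \<bar>s\<bar> < \<rho>v; x \<in> {0..X}\<rbrakk>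
      \<Longrightarrow> norm (v x - u x) \<le> C * (norm (v 0 - u 0) + \<bar>s\<bar>) \<and>
          norm (v x - u x - y x) \<le> C * (norm (v 0 - u 0) + \<bar>s\<bar>)\<^sup>2"
    show thesis
    proof (rule that[OF \<open>0 < C\<close> \<open>0 < \<rho>v\<close>])
      fix v y x
      assume "solves X v"
        "\<And>x. x \<in> {0..X} \<Longrightarrow> (y has_vector_derivative F' (u x) (y x)) (at x within {0..X})"
        "y 0 = v 0 - u 0" "norm (v 0 - u 0) < \<rho>v" "x \<in> {0..X}"
      then show "norm (v x - u x) \<le> C * norm (v 0 - u 0) \<and>
          norm (v x - u x - y x) \<le> C * (norm (v 0 - u 0))\<^sup>2"
        using *[of v 0 y x] by (simp add: solves_def)
    qed
  qed simp_all
  obtain r where r: "0 < r" "\<And>p. norm (p - u 0) < r \<Longrightarrow> solves X (\<Phi> p) \<and> \<Phi> p 0 = p"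
    using \<Phi> unfolding eventually_nhds_metric dist_norm by blast
  have "solves X (\<Phi> p) \<and> \<Phi> p 0 = p \<and>
    (\<forall>x\<in>{0..X}. norm (\<Phi> p x - u x) \<le> C * norm (p - u 0) \<and>
       norm (\<Phi> p x - u x - variation (p - u 0) x) \<le> C * (norm (p - u 0))\<^sup>2)"
    if p: "norm (p - u 0) < min r \<rho>v" for p
  proof -
    have sol: "solves X (\<Phi> p)" "\<Phi> p 0 = p" using r(2)[of p] p by auto
    have y0: "variation (p - u 0) 0 = \<Phi> p 0 - u 0"
      using variation_return[of 0 "p - u 0"] sol(2) by simp
    have small: "norm (\<Phi> p 0 - u 0) < \<rho>v" using p sol(2) by simp
    have "norm (\<Phi> p x - u x) \<le> C * norm (p - u 0) \<and>
        norm (\<Phi> p x - u x - variation (p - u 0) x) \<le> C * (norm (p - u 0))\<^sup>2" if "x \<in> {0..X}" for x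
      using first[OF sol(1) variation_deriv y0 small that] sol(2) by simp
    with sol show ?thesis by blast
  qed
  then show ?thesis
    using C r(1) by (intro exI[of _ C] conjI exI[of _ "min r \<rho>v"]) auto
qed

lemma first_variation_initial:
  assumes \<Phi>: "\<forall>\<^sub>F p in nhds (u 0). solves X (\<Phi> p) \<and> \<Phi> p 0 = p" and x: "x \<in> {0..X}"
  shows "((\<lambda>p. \<Phi> p x) has_derivative (\<lambda>d. variation d x)) (at (u 0))" "\<Phi> (u 0) x = u x"
proof -
  obtain C \<rho> where C: "0 < C" "0 < \<rho>" and expansion:
    "\<forall>p. norm (p - u 0) < \<rho> \<longrightarrow> solves X (\<Phi> p) \<and> \<Phi> p 0 = p \<and>
      (\<forall>x\<in>{0..X}. norm (\<Phi> p x - u x) \<le> C * norm (p - u 0) \<and>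
         norm (\<Phi> p x - u x - variation (p - u 0) x) \<le> C * (norm (p - u 0))\<^sup>2)"
    using initial_value_expansion[OF \<Phi>] by blast
  have "norm (\<Phi> (u 0) x - u x) \<le> C * norm (u 0 - u 0)"
    using expansion C(2) x by (metis diff_self norm_zero)
  then show base: "\<Phi> (u 0) x = u x" by simp
  show "((\<lambda>p. \<Phi> p x) has_derivative (\<lambda>d. variation d x)) (at (u 0))"
    by (rule has_derivative_quadratic_bound[OF linear_variation C]) (use expansion x base in simp)
qed

lemma first_variation_speed:
  assumes \<Psi>: "\<forall>\<^sub>F s in nhds 0. (\<forall>x\<in>{0..X}. (\<Psi> s has_vector_derivative F (\<Psi> s x) - s *\<^sub>R G (\<Psi> s x)) (at x within {0..X}))
                  \<and> \<Psi> s 0 = u 0"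
    and G: "0 \<le> Lg" "\<And>x y. norm (G y - G x) \<le> Lg * norm (y - x)" "continuous_on UNIV G" and x: "x \<in> {0..X}"
  shows "((\<lambda>s. \<Psi> s x) has_vector_derivative - (drift G x *\<^sub>R F (u x) + flux G x *\<^sub>R normal x)) (at 0)"
proof -
  define z where "z x = drift G x *\<^sub>R F (u x) + flux G x *\<^sub>R normal x" for x
  have z: "(z has_vector_derivative F' (u x) (z x) + G (u x)) (at x within {0..X})" if "x \<in> {0..X}" for x
    unfolding z_def by (rule forced_variation[OF G(3) that])
  have z0: "z 0 = 0" by (simp add: z_def drift_def flux_def)
  obtain r where r: "0 < r" "\<And>s. \<bar>s\<bar> < r \<Longrightarrow>
      (\<forall>x\<in>{0..X}. (\<Psi> s has_vector_derivative F (\<Psi> s x) - s *\<^sub>R G (\<Psi> s x)) (at x within {0..X})) \<and> \<Psi> s 0 = u 0"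
    using \<Psi> unfolding eventually_nhds_metric dist_norm by auto
  have base: "\<Psi> 0 x = u x"
    using solution_unique[OF _ solves_u[of X], of "\<Psi> 0" x] r(2)[of 0] r(1) x by (simp add: solves_def)
  have "((\<lambda>s. \<Psi> s x) has_derivative (\<lambda>s. s *\<^sub>R - z x)) (at 0)"
  proof (rule first_variation[OF solves_u[of X] G(1,2)])
    fix C \<rho> :: real
    assume C: "0 < C" "0 < \<rho>" and
      *: "\<And>v s y x. \<lbrakk>\<And>x. x \<in> {0..X} \<Longrightarrow>
                  (v has_vector_derivative F (v x) - s *\<^sub>R G (v x)) (at x within {0..X});
        \<And>x. x \<in> {0..X} \<Longrightarrow>
                  (y has_vector_derivative F' (u x) (y x) - s *\<^sub>R G (u x)) (at x within {0..X});
        y 0 = v 0 - u 0; norm (v 0 - u 0) + \<bar>s\<bar> < \<rho>; x \<in> {0..X}\<rbrakk>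
      \<Longrightarrow> norm (v x - u x) \<le> C * (norm (v 0 - u 0) + \<bar>s\<bar>) \<and>
          norm (v x - u x - y x) \<le> C * (norm (v 0 - u 0) + \<bar>s\<bar>)\<^sup>2"
    show ?thesis
    proof (rule has_derivative_quadratic_bound[of _ C "min r \<rho>"])
      show "bounded_linear (\<lambda>s. s *\<^sub>R - z x)" by (rule bounded_linear_scaleR_left)
      fix s :: real assume s: "norm (s - 0) < min r \<rho>"
      have "((\<lambda>x. - (s *\<^sub>R z x)) has_vector_derivative F' (u x) (- (s *\<^sub>R z x)) - s *\<^sub>R G (u x)) (at x within {0..X})"
        if "x \<in> {0..X}" for x
        by (rule has_vector_derivative_eq_rhs[OF has_vector_derivative_minus[OF
              bounded_linear.has_vector_derivative[OF bounded_linear_scaleR_right[of s] z[OF that]]]])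
           (simp add: blinfun.minus_right blinfun.scaleR_right scaleR_add_right)
      then have "norm (\<Psi> s x - u x - - (s *\<^sub>R z x)) \<le> C * (norm (\<Psi> s 0 - u 0) + \<bar>s\<bar>)\<^sup>2"
        using *[of "\<Psi> s" s "\<lambda>x. - (s *\<^sub>R z x)" x] r(2)[of s] s x z0 by simp
      then show "norm (\<Psi> s x - \<Psi> 0 x - (s - 0) *\<^sub>R - z x) \<le> C * (norm (s - 0))\<^sup>2"
        using r(2)[of s] s by (simp add: base)
    qed (use C r in auto)
  qed
  then show ?thesis by (simp add: has_vector_derivative_def z_def)
qed

section \<open>Return times of nearby orbits\<close>

text \<open>
The return time to \<open>p\<close> is obtained in two steps. Near time \<open>T0\<close> the first coordinate increases with speed
close to 1, so the solution meets the vertical line through \<open>p\<close>; conservation of the first integral then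
forces the meeting point to be \<open>p\<close>. At time \<open>T0\<close> the solution misses the line by \<open>shear T0\<close> times the
second coordinate of \<open>p - u 0\<close>, up to second order, and this gives the derivative of the return time.
\<close>

lemma return_time:
  assumes T0: "0 < T0" "u T0 = u 0" "\<And>x. 0 < x \<Longrightarrow> x < T0 \<Longrightarrow> u x \<noteq> u 0" and X: "T0 < X"
    and \<Phi>: "\<forall>\<^sub>F p in nhds (u 0). solves X (\<Phi> p) \<and> \<Phi> p 0 = p"
  shows "\<exists>\<rho> \<tau>. 0 < \<rho> \<and>
    (\<forall>p. norm (p - u 0) < \<rho> \<longrightarrow> solves X (\<Phi> p) \<and> \<Phi> p 0 = p \<and> 0 < \<tau> p \<and> \<tau> p \<le> X \<and>
       \<Phi> p (\<tau> p) = p \<and> (\<forall>x. 0 < x \<and> x < \<tau> p \<longrightarrow> \<Phi> p x \<noteq> p)) \<and>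
    \<tau> (u 0) = T0 \<and> (\<tau> has_derivative (\<lambda>h. - (shear T0 * h $ 2))) (at (u 0))"
proof -
  define D where "D \<equiv> \<lambda>p. norm (p - u 0)"
  obtain H where H: "\<And>p. (H has_derivative wedge (F p)) (at p)"
    using first_integral by blast
  obtain C \<rho>0 where C: "0 < C" and \<rho>0: "0 < \<rho>0" and expansion:
    "\<forall>p. norm (p - u 0) < \<rho>0 \<longrightarrow> solves X (\<Phi> p) \<and> \<Phi> p 0 = p \<and>
      (\<forall>x\<in>{0..X}. norm (\<Phi> p x - u x) \<le> C * norm (p - u 0) \<and>
         norm (\<Phi> p x - u x - variation (p - u 0) x) \<le> C * (norm (p - u 0))\<^sup>2)"
    using initial_value_expansion[OF \<Phi>] by blast
  have sol: "solves X (\<Phi> p)" "\<Phi> p 0 = p" if "D p < \<rho>0" for p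
    using expansion that by (auto simp: D_def)
  have close: "norm (\<Phi> p x - u x) \<le> C * D p"
    and close2: "norm (\<Phi> p x - u x - variation (p - u 0) x) \<le> C * (D p)\<^sup>2"
    if "D p < \<rho>0" "x \<in> {0..X}" for p x
    using expansion that by (auto simp: D_def)
  have T0X: "T0 \<in> {0..X}" using T0(1) X by simp
  have gap: "\<bar>\<Phi> p T0 $ 1 - p $ 1 - shear T0 * (p - u 0) $ 2\<bar> \<le> C * (D p)\<^sup>2" if "D p < \<rho>0" for p
    using order_trans[OF component_le_norm_cart close2[OF that T0X], of 1]
    by (simp add: variation_return[OF T0(2)] T0(2) axis_def algebra_simps)
  define K where "K = \<bar>shear T0\<bar> + C"
  have K: "0 < K" using C by (simp add: K_def)
  have gap_bound: "\<bar>\<Phi> p T0 $ 1 - p $ 1\<bar> \<le> K * D p" if "D p < \<rho>0" "D p \<le> 1" for p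
  proof -
    have "\<bar>shear T0 * (p - u 0) $ 2\<bar> \<le> \<bar>shear T0\<bar> * D p"
      using component_le_norm_cart[of "p - u 0" 2] by (simp add: abs_mult D_def mult_left_mono)
    moreover have "C * (D p)\<^sup>2 \<le> C * D p"
      using C that(2) by (simp add: D_def power2_eq_square mult_left_le)
    ultimately show ?thesis using gap[OF that(1)] by (simp add: K_def distrib_right)
  qed
  have near_velocity: "\<exists>r>0. \<forall>q. norm (q - u 0) < r \<longrightarrow> \<bar>F q $ 1 - 1\<bar> < \<epsilon>" if "0 < \<epsilon>" for \<epsilon> :: real
  proof -
    have "continuous (at (u 0)) (\<lambda>q. F q $ 1)"
      using F_cont[of UNIV] by (intro continuous_intros) (simp add: continuous_on_eq_continuous_at)
    then show ?thesis
      using that unfolding continuous_at_eps_delta dist_norm by (auto simp: u_start axis_def)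
  qed
  \<comment> \<open>At times when \<open>u\<close> is near \<open>u 0\<close>, nearby solutions move to the right with speed close to 1.\<close>
  have slope: "\<exists>\<eta>>0. \<exists>\<rho>>0. \<forall>p a b. D p < \<rho> \<longrightarrow> a \<in> {0..X} \<inter> {c-\<eta>..c+\<eta>} \<longrightarrow> b \<in> {0..X} \<inter> {c-\<eta>..c+\<eta>} \<longrightarrow>
      \<bar>\<Phi> p b $ 1 - \<Phi> p a $ 1 - (b - a)\<bar> \<le> \<epsilon> * \<bar>b - a\<bar>" if \<epsilon>: "0 < \<epsilon>" and c: "u c = u 0" for \<epsilon> c
  proof -
    obtain r where r: "0 < r" "\<And>q. norm (q - u 0) < r \<Longrightarrow> \<bar>F q $ 1 - 1\<bar> < \<epsilon>"
      using near_velocity[OF \<epsilon>] by auto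
    have "continuous (at c) u" using u_deriv by (rule has_vector_derivative_continuous)
    then obtain \<eta> where \<eta>: "0 < \<eta>" "\<And>x. \<bar>x - c\<bar> < \<eta> \<Longrightarrow> norm (u x - u 0) < r / 2"
      using r(1) unfolding continuous_at_eps_delta dist_norm c by (metis half_gt_zero real_norm_def)
    have "\<bar>\<Phi> p b $ 1 - \<Phi> p a $ 1 - (b - a)\<bar> \<le> \<epsilon> * \<bar>b - a\<bar>"
      if p: "D p < min \<rho>0 (r / (2 * C))" and ab: "a \<in> {0..X} \<inter> {c-\<eta>/2..c+\<eta>/2}" "b \<in> {0..X} \<inter> {c-\<eta>/2..c+\<eta>/2}" for p a b
    proof -
      have "norm ((\<lambda>x. \<Phi> p x $ 1 - x) b - (\<lambda>x. \<Phi> p x $ 1 - x) a) \<le> \<epsilon> * norm (b - a)"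
      proof (rule field_differentiable_bound)
        fix x assume x: "x \<in> {0..X} \<inter> {c-\<eta>/2..c+\<eta>/2}"
        have "(\<Phi> p has_vector_derivative F (\<Phi> p x)) (at x within {0..X})"
          using sol(1)[of p] p x by (simp add: solves_def)
        then have "(\<Phi> p has_vector_derivative F (\<Phi> p x)) (at x within {0..X} \<inter> {c-\<eta>/2..c+\<eta>/2})"
          by (rule has_vector_derivative_within_subset) auto
        from bounded_linear.has_vector_derivative[OF bounded_linear_vec_nth this]
        have "((\<lambda>x. \<Phi> p x $ 1) has_real_derivative F (\<Phi> p x) $ 1) (at x within {0..X} \<inter> {c-\<eta>/2..c+\<eta>/2})"
          by (simp add: has_real_derivative_iff_has_vector_derivative)
        then show "((\<lambda>x. \<Phi> p x $ 1 - x) has_field_derivative F (\<Phi> p x) $ 1 - 1) (at x within {0..X} \<inter> {c-\<eta>/2..c+\<eta>/2})"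
          by (auto intro!: derivative_eq_intros)
        have "\<bar>x - c\<bar> < \<eta>" using x \<eta>(1) by (auto simp: abs_le_iff abs_less_iff)
        then have "norm (u x - u 0) < r / 2" by (rule \<eta>(2))
        moreover have "norm (\<Phi> p x - u x) \<le> r / 2"
        proof -
          have "C * D p \<le> r / 2" using p C by (simp add: pos_less_divide_eq mult_ac)
          then show ?thesis using close[of p x] p x by simp
        qed
        ultimately have "norm (\<Phi> p x - u 0) < r"
          using norm_triangle_ineq[of "\<Phi> p x - u x" "u x - u 0"] by simp
        then show "norm (F (\<Phi> p x) $ 1 - 1) \<le> \<epsilon>" using r(2) by (simp add: less_imp_le)
      qed (use ab in \<open>auto intro!: convex_Int\<close>)
      then show ?thesis by (simp add: algebra_simps)
    qed
    then show ?thesis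
      using \<eta>(1) \<rho>0 r(1) C
      by (intro exI[of _ "\<eta>/2"] conjI exI[of _ "min \<rho>0 (r / (2 * C))"]) auto
  qed
  obtain \<eta>0 \<sigma>0 where s0: "0 < \<eta>0" "0 < \<sigma>0"
    "\<And>p a b. D p < \<sigma>0 \<Longrightarrow> a \<in> {0..X} \<inter> {0-\<eta>0..0+\<eta>0} \<Longrightarrow> b \<in> {0..X} \<inter> {0-\<eta>0..0+\<eta>0} \<Longrightarrow>
      \<bar>\<Phi> p b $ 1 - \<Phi> p a $ 1 - (b - a)\<bar> \<le> (1/2) * \<bar>b - a\<bar>"
    using slope[of "1/2" 0] by fastforce
  obtain \<eta>1 \<sigma>1 where s1: "0 < \<eta>1" "0 < \<sigma>1"
    "\<And>p a b. D p < \<sigma>1 \<Longrightarrow> a \<in> {0..X} \<inter> {T0-\<eta>1..T0+\<eta>1} \<Longrightarrow> b \<in> {0..X} \<inter> {T0-\<eta>1..T0+\<eta>1} \<Longrightarrow>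
      \<bar>\<Phi> p b $ 1 - \<Phi> p a $ 1 - (b - a)\<bar> \<le> (1/2) * \<bar>b - a\<bar>"
    using slope[of "1/2" T0] T0(2) by fastforce
  obtain r where r: "0 < r" "\<And>q. norm (q - u 0) < r \<Longrightarrow> \<bar>F q $ 1 - 1\<bar> < 1"
    using near_velocity[of 1] by auto
  have "continuous (at T0) u" using u_deriv by (rule has_vector_derivative_continuous)
  then obtain \<eta>2 where \<eta>2: "0 < \<eta>2" "\<And>x. \<bar>x - T0\<bar> < \<eta>2 \<Longrightarrow> norm (u x - u 0) < r / 2"
    using r(1) unfolding continuous_at_eps_delta dist_norm T0(2) by (metis half_gt_zero real_norm_def)
  define \<eta> where "\<eta> = Min {\<eta>0, \<eta>1, \<eta>2 / 2, X - T0, T0 / 3}"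
  have \<eta>_pos: "0 < \<eta>"
    using s0(1) s1(1) \<eta>2(1) X T0(1) unfolding \<eta>_def by (subst Min_gr_iff) auto
  have \<eta>_le: "\<eta> \<le> \<eta>0" "\<eta> \<le> \<eta>1" "\<eta> \<le> \<eta>2 / 2" "\<eta> \<le> X - T0" "\<eta> \<le> T0 / 3"
    unfolding \<eta>_def by (rule Min_le, simp, blast)+
  have \<eta>: "0 < \<eta>" "\<eta> \<le> \<eta>0" "\<eta> \<le> \<eta>1" "\<eta> < \<eta>2" "\<eta> \<le> X - T0" "\<eta> \<le> T0 / 3"
    using \<eta>_pos \<eta>_le \<eta>2(1) by linarith+
  have "\<exists>x\<in>{\<eta>..T0-\<eta>}. \<forall>y\<in>{\<eta>..T0-\<eta>}. norm (u x - u 0) \<le> norm (u y - u 0)"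
    using \<eta> T0(1) by (intro continuous_attains_inf continuous_intros u_cont) auto
  then obtain x0 where x0: "x0 \<in> {\<eta>..T0-\<eta>}" "\<And>y. y \<in> {\<eta>..T0-\<eta>} \<Longrightarrow> norm (u x0 - u 0) \<le> norm (u y - u 0)"
    by blast
  define \<mu> where "\<mu> = norm (u x0 - u 0)"
  have \<mu>: "0 < \<mu>" "\<And>y. y \<in> {\<eta>..T0-\<eta>} \<Longrightarrow> \<mu> \<le> norm (u y - u 0)"
    using x0 T0(3)[of x0] \<eta>(1) by (auto simp: \<mu>_def)
  define \<rho> where "\<rho> = Min {\<rho>0, \<sigma>0, \<sigma>1, 1, r, r / (2 * C), \<mu> / (C + 1), \<eta> / (2 * K)}"
  have \<rho>_pos: "0 < \<rho>"
    using \<rho>0 s0(2) s1(2) r(1) C \<mu>(1) \<eta>(1) K unfolding \<rho>_def by (subst Min_gr_iff) auto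
  have \<rho>_le: "\<rho> \<le> \<rho>0" "\<rho> \<le> \<sigma>0" "\<rho> \<le> \<sigma>1" "\<rho> \<le> 1" "\<rho> \<le> r" "\<rho> \<le> r / (2 * C)" "\<rho> \<le> \<mu> / (C + 1)" "\<rho> \<le> \<eta> / (2 * K)"
    unfolding \<rho>_def by (rule Min_le, simp, blast)+
  \<comment> \<open>The solution from \<open>p\<close> crosses the vertical line through \<open>p\<close> near time \<open>T0\<close>.\<close>
  have "\<exists>x. \<bar>x - T0\<bar> \<le> \<eta> \<and> \<Phi> p x $ 1 = p $ 1" if p: "D p < \<rho>" for p
  proof -
    have "K * D p < \<eta> / 2" 
    proof -
      have "D p < \<eta> / (2 * K)" using p \<rho>_le(8) by linarith
      then show ?thesis using K by (simp add: pos_less_divide_eq mult_ac)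
    qed
    then have g: "\<bar>\<Phi> p T0 $ 1 - p $ 1\<bar> < \<eta> / 2" using gap_bound[of p] p \<rho>_le by simp
    have "\<bar>\<Phi> p (T0 + \<eta>) $ 1 - \<Phi> p T0 $ 1 - \<eta>\<bar> \<le> 1/2 * \<eta>"
      using s1(3)[of p T0 "T0 + \<eta>"] p \<rho>_le(3) \<eta> T0 X by simp
    moreover have "\<bar>\<Phi> p (T0 - \<eta>) $ 1 - \<Phi> p T0 $ 1 + \<eta>\<bar> \<le> 1/2 * \<eta>"
      using s1(3)[of p T0 "T0 - \<eta>"] p \<rho>_le(3) \<eta> T0 X by simp
    ultimately have "\<Phi> p (T0 - \<eta>) $ 1 \<le> p $ 1" "p $ 1 \<le> \<Phi> p (T0 + \<eta>) $ 1"
      using g by linarith+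
    moreover have "continuous_on {T0 - \<eta>..T0 + \<eta>} (\<lambda>x. \<Phi> p x $ 1)"
    proof -
      have "continuous_on {0..X} (\<Phi> p)"
        using sol(1)[of p] p \<rho>_le(1) unfolding solves_def
        by (intro continuous_on_vector_derivative[where f' = "\<lambda>x. F (\<Phi> p x)"]) auto
      then show ?thesis
        by (intro continuous_intros) (erule continuous_on_subset, use \<eta> T0 in auto)
    qed
    ultimately have "\<exists>x\<ge>T0 - \<eta>. x \<le> T0 + \<eta> \<and> \<Phi> p x $ 1 = p $ 1"
      using \<eta>(1) by (intro IVT') auto
    then obtain x where "T0 - \<eta> \<le> x" "x \<le> T0 + \<eta>" "\<Phi> p x $ 1 = p $ 1" by blast
    then show ?thesis by (intro exI[of _ x]) (simp add: abs_le_iff)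
  qed
  then obtain \<tau> where \<tau>: "\<bar>\<tau> p - T0\<bar> \<le> \<eta>" "\<Phi> p (\<tau> p) $ 1 = p $ 1" if "D p < \<rho>" for p
    by metis
  have \<tau>_range: "0 < \<tau> p" "\<tau> p \<le> X" "\<tau> p \<in> {0..X} \<inter> {T0-\<eta>..T0+\<eta>}" if "D p < \<rho>" for p
    using \<tau>(1)[OF that] \<eta> T0(1) X by (auto simp: abs_le_iff)
  \<comment> \<open>Along the vertical line through \<open>p\<close> the first integral has derivative \<open>F q $ 1 > 0\<close>,
    so it distinguishes the points of that line.\<close>
  have vertical: "q = p" if pq: "norm (p - u 0) < r" "norm (q - u 0) < r" "q $ 1 = p $ 1" "H q = H p" for p q
  proof (rule ccontr)
    assume "q \<noteq> p"
    then have "q $ 2 \<noteq> p $ 2" using pq(3) by (simp add: vec2_eq_iff)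
    have "\<exists>x\<in>{0<..<1}. H (p + 1 *\<^sub>R (q - p)) - H (p + 0 *\<^sub>R (q - p)) = (\<lambda>h. wedge (F (p + x *\<^sub>R (q - p))) (h *\<^sub>R (q - p))) (1 - 0)"
    proof (rule mvt_simple)
      fix x :: real
      show "((\<lambda>x. H (p + x *\<^sub>R (q - p))) has_derivative (\<lambda>h. wedge (F (p + x *\<^sub>R (q - p))) (h *\<^sub>R (q - p)))) (at x within {0..1})"
        by (rule has_derivative_compose[OF _ H]) (auto intro!: derivative_eq_intros)
    qed simp
    then obtain x where x: "0 < x" "x < 1" "wedge (F (p + x *\<^sub>R (q - p))) (q - p) = 0"
      using pq(4) by auto
    have "p + x *\<^sub>R (q - p) - u 0 = (1 - x) *\<^sub>R (p - u 0) + x *\<^sub>R (q - u 0)"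
      by (simp add: algebra_simps)
    also have "norm \<dots> \<le> (1 - x) * norm (p - u 0) + x * norm (q - u 0)"
      using x by (intro order_trans[OF norm_triangle_ineq]) simp
    also have "\<dots> < (1 - x) * r + x * r"
      using x pq by (intro add_strict_mono mult_strict_left_mono) auto
    finally have "norm (p + x *\<^sub>R (q - p) - u 0) < r" by (simp add: algebra_simps)
    then have "0 < F (p + x *\<^sub>R (q - p)) $ 1" using r(2) by force
    moreover have "F (p + x *\<^sub>R (q - p)) $ 1 * (q $ 2 - p $ 2) = 0"
      using x(3) pq(3) by (simp add: wedge_def)
    ultimately show False using \<open>q $ 2 \<noteq> p $ 2\<close> by simp
  qed
  have closed: "\<Phi> p (\<tau> p) = p" if p: "D p < \<rho>" for p
  proof (rule vertical)
    show "norm (p - u 0) < r" using p \<rho>_le(5) by (simp add: D_def)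
    have "\<bar>\<tau> p - T0\<bar> < \<eta>2" using \<tau>(1)[OF p] \<eta>(4) by simp
    then have "norm (u (\<tau> p) - u 0) < r / 2" by (rule \<eta>2(2))
    moreover have "norm (\<Phi> p (\<tau> p) - u (\<tau> p)) \<le> r / 2"
    proof -
      have "D p < r / (2 * C)" using p \<rho>_le(6) by linarith
      then have "C * D p \<le> r / 2" using C by (simp add: pos_less_divide_eq mult_ac)
      then show ?thesis using close[of p "\<tau> p"] p \<rho>_le(1) \<tau>_range[OF p] by simp
    qed
    ultimately show "norm (\<Phi> p (\<tau> p) - u 0) < r"
      using norm_triangle_ineq[of "\<Phi> p (\<tau> p) - u (\<tau> p)" "u (\<tau> p) - u 0"] by simp
    show "H (\<Phi> p (\<tau> p)) = H p"
      using first_integral_constant[OF H, of X "\<Phi> p" "\<tau> p"] sol[of p] p \<rho>_le(1) \<tau>_range[OF p] by simp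
  qed (rule \<tau>(2)[OF p])
  have no_return: "\<Phi> p x \<noteq> p" if p: "D p < \<rho>" and x: "0 < x" "x < \<tau> p" for p x
  proof -
    have xX: "x \<in> {0..X}" using x \<tau>_range[OF p] by simp
    \<comment> \<open>Just after the start and just before \<open>\<tau> p\<close> the first coordinate is strictly monotone;
      in between, \<open>u\<close> stays away from \<open>u 0\<close>.\<close>
    consider "x \<le> \<eta>" | "x \<in> {\<eta>..T0 - \<eta>}" | "T0 - \<eta> \<le> x" by force
    then show ?thesis
    proof cases
      case 1
      have "\<bar>\<Phi> p x $ 1 - \<Phi> p 0 $ 1 - (x - 0)\<bar> \<le> (1/2) * \<bar>x - 0\<bar>"
        using 1 x xX p \<rho>_le(2) \<eta>(2) X T0(1) by (intro s0(3)) auto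
      then show ?thesis using x(1) sol(2)[of p] p \<rho>_le(1) by auto
    next
      case 2
      have "D p < \<mu> / (C + 1)" using p \<rho>_le(7) by linarith
      then have "D p * (C + 1) < \<mu>" using C by (simp add: pos_less_divide_eq)
      then have "norm (\<Phi> p x - u x) + norm (p - u 0) < \<mu>"
        using close[of p x] p \<rho>_le(1) xX by (simp add: D_def algebra_simps)
      then show ?thesis
        using \<mu>(2)[OF 2] norm_triangle_ineq4[of "p - u 0" "\<Phi> p x - u x"] by (auto simp: algebra_simps)
    next
      case 3
      have "\<bar>\<Phi> p (\<tau> p) $ 1 - \<Phi> p x $ 1 - (\<tau> p - x)\<bar> \<le> (1/2) * \<bar>\<tau> p - x\<bar>"
        using 3 x xX p \<rho>_le(3) \<eta>(3) \<tau>_range[OF p] by (intro s1(3)) auto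
      then show ?thesis using x(2) \<tau>(2)[OF p] by auto
    qed
  qed
  have u0: "D (u 0) = 0" by (simp add: D_def)
  have \<tau>_base: "\<tau> (u 0) = T0"
  proof -
    have base: "D (u 0) < \<rho>" using \<rho>_pos u0 by simp
    have eq: "\<Phi> (u 0) x = u x" if "x \<in> {0..X}" for x
      using close[of "u 0" x] that u0 \<rho>0 by simp
    have "\<not> \<tau> (u 0) < T0"
      using T0(3)[of "\<tau> (u 0)"] closed[OF base] \<tau>_range[OF base] eq[of "\<tau> (u 0)"] by auto
    moreover have "\<not> T0 < \<tau> (u 0)"
      using no_return[OF base T0(1)] eq[OF T0X] T0(2) by auto
    ultimately show ?thesis by linarith
  qed
  have \<tau>_lipschitz: "\<bar>\<tau> p - T0\<bar> \<le> 2 * (K * D p)" if p: "D p < \<rho>" for p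
  proof -
    have "\<bar>\<Phi> p (\<tau> p) $ 1 - \<Phi> p T0 $ 1 - (\<tau> p - T0)\<bar> \<le> (1/2) * \<bar>\<tau> p - T0\<bar>"
      using p \<rho>_le(3) \<eta>(3) \<tau>_range[OF p] T0X s1(1) by (intro s1(3)) auto
    then have "\<bar>p $ 1 - \<Phi> p T0 $ 1 - (\<tau> p - T0)\<bar> \<le> (1/2) * \<bar>\<tau> p - T0\<bar>"
      by (simp only: \<tau>(2)[OF p])
    moreover have "\<bar>\<Phi> p T0 $ 1 - p $ 1\<bar> \<le> K * D p"
      using gap_bound[of p] p \<rho>_le(1,4) by simp
    ultimately show ?thesis by argo
  qed
  have "(\<tau> has_derivative (\<lambda>h. - (shear T0 * h $ 2))) (at (u 0) within UNIV)"
    unfolding has_derivative_within_alt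
  proof (intro conjI allI impI)
    show "bounded_linear (\<lambda>h::real^2. - (shear T0 * h $ 2))"
      by (intro bounded_linear_minus bounded_linear_const_mult bounded_linear_vec_nth)
    fix e :: real assume e: "0 < e"
    define \<epsilon> where "\<epsilon> = e / (4 * K)"
    have \<epsilon>: "0 < \<epsilon>" using e K by (simp add: \<epsilon>_def)
    obtain \<eta>' \<sigma>' where s': "0 < \<eta>'" "0 < \<sigma>'"
      "\<And>p a b. D p < \<sigma>' \<Longrightarrow> a \<in> {0..X} \<inter> {T0-\<eta>'..T0+\<eta>'} \<Longrightarrow> b \<in> {0..X} \<inter> {T0-\<eta>'..T0+\<eta>'} \<Longrightarrow>
        \<bar>\<Phi> p b $ 1 - \<Phi> p a $ 1 - (b - a)\<bar> \<le> \<epsilon> * \<bar>b - a\<bar>"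
      using slope[OF \<epsilon> T0(2)] by fastforce
    define d where "d = Min {\<rho>, \<sigma>', \<eta>' / (2 * K), e / (2 * C)}"
    have d: "0 < d" "d \<le> \<rho>" "d \<le> \<sigma>'" "d \<le> \<eta>' / (2 * K)" "d \<le> e / (2 * C)"
    proof -
      show "0 < d" using \<rho>_pos s'(1,2) K C e unfolding d_def by (subst Min_gr_iff) auto
    qed (unfold d_def, (rule Min_le, simp, blast)+)
    show "\<exists>d>0. \<forall>p\<in>UNIV. norm (p - u 0) < d \<longrightarrow>
        norm (\<tau> p - \<tau> (u 0) - - (shear T0 * (p - u 0) $ 2)) \<le> e * norm (p - u 0)"
    proof (intro exI[of _ d] conjI ballI impI d(1))
      fix p assume "norm (p - u 0) < d"
      then have p: "D p < d" by (simp add: D_def)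
      then have p\<rho>: "D p < \<rho>" using d(2) by simp
      have D0: "0 \<le> D p" by (simp add: D_def)
      have "D p < \<eta>' / (2 * K)" using p d(4) by linarith
      then have "2 * (K * D p) < \<eta>'" using K by (simp add: pos_less_divide_eq mult_ac)
      then have "\<bar>\<tau> p - T0\<bar> \<le> \<eta>'" using \<tau>_lipschitz[OF p\<rho>] by linarith
      then have "\<bar>\<Phi> p (\<tau> p) $ 1 - \<Phi> p T0 $ 1 - (\<tau> p - T0)\<bar> \<le> \<epsilon> * \<bar>\<tau> p - T0\<bar>"
        using p d(3) \<tau>_range[OF p\<rho>] T0X s'(1) by (intro s'(3)) (auto simp: abs_le_iff)
      also have "\<dots> \<le> \<epsilon> * (2 * (K * D p))"
        using \<tau>_lipschitz[OF p\<rho>] \<epsilon> by (intro mult_left_mono) auto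
      also have "\<dots> = e / 2 * D p" using K by (simp add: \<epsilon>_def)
      finally have 1: "\<bar>p $ 1 - \<Phi> p T0 $ 1 - (\<tau> p - T0)\<bar> \<le> e / 2 * D p"
        using \<tau>(2)[OF p\<rho>] by simp
      have "D p < e / (2 * C)" using p d(5) by linarith
      then have "C * D p \<le> e / 2" using C by (simp add: pos_less_divide_eq mult_ac)
      then have "C * (D p)\<^sup>2 \<le> e / 2 * D p"
        using D0 mult_right_mono[of "C * D p" "e / 2" "D p"] by (simp add: power2_eq_square mult_ac)
      then have 2: "\<bar>\<Phi> p T0 $ 1 - p $ 1 - shear T0 * (p - u 0) $ 2\<bar> \<le> e / 2 * D p"
        using gap[of p] p\<rho> \<rho>_le(1) by linarith
      from 1 2 have "\<bar>\<tau> p - T0 + shear T0 * (p - u 0) $ 2\<bar> \<le> e / 2 * D p + e / 2 * D p" by linarith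
      then show "norm (\<tau> p - \<tau> (u 0) - - (shear T0 * (p - u 0) $ 2)) \<le> e * norm (p - u 0)"
        by (simp add: \<tau>_base D_def)
    qed
  qed
  moreover have "\<forall>p. norm (p - u 0) < \<rho> \<longrightarrow> solves X (\<Phi> p) \<and> \<Phi> p 0 = p \<and> 0 < \<tau> p \<and> \<tau> p \<le> X \<and>
       \<Phi> p (\<tau> p) = p \<and> (\<forall>x. 0 < x \<and> x < \<tau> p \<longrightarrow> \<Phi> p x \<noteq> p)"
    using sol closed no_return \<tau>_range(1,2) \<rho>_le(1) by (simp add: D_def)
  ultimately show ?thesis
    using \<rho>_pos \<tau>_base by (intro exI[of _ \<rho>] exI[of _ \<tau>]) simp
qed

end

section \<open>Winding numbers on the two sides of a loop\<close>

locale C1_loop =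
  fixes g g' :: "real \<Rightarrow> complex"
  assumes g_deriv: "\<And>t. (g has_vector_derivative g' t) (at t)"
    and g'_cont: "continuous_on UNIV g'"
    and g_periodic: "\<And>t. g (t + 1) = g t"
    and g_inj: "inj_on g {0..<1}"

begin

lemma g_cont: "continuous_on S g"
  by (intro continuous_at_imp_continuous_on ballI has_vector_derivative_continuous[OF g_deriv])

lemma closed_path: "pathfinish g = pathstart g"
  using g_periodic[of 0] by (simp add: pathfinish_def pathstart_def)

lemma simple: "simple_path g"
proof -
  have g1: "g 1 = g 0" using g_periodic[of 0] by simp
  have "x = y \<or> x = 0 \<and> y = 1 \<or> x = 1 \<and> y = 0"
    if xy: "x \<in> {0..1}" "y \<in> {0..1}" "g x = g y" for x y
  proof -
    have *: "t = 1 \<or> t \<in> {0..<1}" if "t \<in> {0..1}" for t :: real using that by auto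
    show ?thesis
      using *[OF xy(1)] *[OF xy(2)]
    proof (elim disjE)
      assume "x = 1" "y \<in> {0..<1}"
      moreover from this have "g 0 = g y" using g1 xy(3) by metis
      then have "0 = y" using calculation by (intro inj_onD[OF g_inj]) auto
      ultimately show ?thesis by simp
    next
      assume "x \<in> {0..<1}" "y = 1"
      moreover from this have "g x = g 0" using g1 xy(3) by metis
      then have "x = 0" using calculation by (intro inj_onD[OF g_inj]) auto
      ultimately show ?thesis by simp
    next
      assume "x \<in> {0..<1}" "y \<in> {0..<1}"
      then have "x = y" using xy(3) by (intro inj_onD[OF g_inj])
      then show ?thesis by simp
    qed simp
  qed
  then have "loop_free g"
    unfolding loop_free_def by blast
  then show ?thesis
    by (simp add: simple_path_def path_def g_cont)
qed

lemma g_frac: "g (frac t) = g t"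
  using periodic_int_multiple[of g 1 "frac t" "\<lfloor>t\<rfloor>"] g_periodic by (simp add: frac_def)

lemma path_image_eq_range: "path_image g = range g"
proof -
  have "g t \<in> g ` {0..1}" for t
    using g_frac[of t] frac_lt_1[of t] frac_ge_0[of t] by (metis atLeastAtMost_iff image_eqI less_imp_le)
  then show ?thesis by (auto simp: path_image_def)
qed

lemma valid: "valid_path g"
proof -
  have "vector_derivative g (at t) = g' t" for t
    by (rule vector_derivative_at[OF g_deriv])
  then have "g C1_differentiable_on {0..1}"
    unfolding C1_differentiable_on_eq
    using differentiableI_vector[OF g_deriv] continuous_on_subset[OF g'_cont] by auto
  then show ?thesis
    by (simp add: valid_path_def C1_differentiable_imp_piecewise)
qed

lemma winding_number_integral:
  assumes "z \<notin> path_image g"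
  shows "((\<lambda>t. g' t / (g t - z)) has_integral 2 * of_real pi * \<i> * winding_number g z) {0..1}"
proof -
  have "((\<lambda>w. 1 / (w - z)) has_contour_integral 2 * of_real pi * \<i> * winding_number g z) g"
    using has_contour_integral_winding_number[OF valid assms] by simp
  then show ?thesis
    unfolding has_contour_integral_def
  proof (rule has_integral_eq[rotated])
    show "1 / (g t - z) * vector_derivative g (at t within {0..1}) = g' t / (g t - z)"
      if "t \<in> {0..1}" for t
      using vector_derivative_within_cbox[of 0 1 t g "g' t"] that g_deriv[of t]
      by (simp add: has_vector_derivative_at_within)
  qed
qed

text \<open>
The difference of the winding numbers at \<open>g 0 + \<sigma> t \<i>\<close> and \<open>g 0 - \<sigma> t \<i>\<close> is \<open>\<sigma> / \<pi>\<close> times the integral of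
\<open>t g' / ((g - g 0)\<^sup>2 + t\<^sup>2)\<close>. Near the base point the real part of the integrand is at least a positive multiple of
\<open>t / (x\<^sup>2 + t\<^sup>2)\<close> and contributes a positive amount independent of \<open>t\<close>; the rest of the loop contributes
\<open>O(t)\<close>. If the winding number vanishes at the first point, this determines its sign at the second.
\<close>

lemma winding_number_jump:
  fixes \<sigma> k :: real
  assumes k: "g' 0 = of_real k" "0 < k" and \<sigma>: "\<sigma> = 1 \<or> \<sigma> = -1"
  obtains \<epsilon> where "0 < \<epsilon>"
    "\<And>t. \<lbrakk>0 < t; t < \<epsilon>; winding_number g (g 0 + of_real (\<sigma> * t) * \<i>) = 0;
           g 0 + of_real (\<sigma> * t) * \<i> \<notin> path_image g\<rbrakk>
      \<Longrightarrow> g 0 - of_real (\<sigma> * t) * \<i> \<notin> path_image g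
        \<and> \<sigma> * Re (winding_number g (g 0 - of_real (\<sigma> * t) * \<i>)) < 0"
proof -
  obtain \<delta> where \<delta>: "0 < \<delta>" "\<delta> < 1/2" "\<And>x. \<bar>x\<bar> \<le> \<delta> \<Longrightarrow> norm (g' x - k) \<le> k / 10"
  proof -
    have "continuous (at 0) g'" using g'_cont by (simp add: continuous_on_eq_continuous_at)
    then obtain d where d: "0 < d" "\<And>x. dist x 0 < d \<Longrightarrow> dist (g' x) (g' 0) < k / 10"
      unfolding continuous_at_eps_delta using k(2) by (meson divide_pos_pos zero_less_numeral)
    show ?thesis
      by (rule that[of "min (d/2) (1/4)"]) (use d k(1) in \<open>auto simp: dist_norm less_imp_le\<close>)
  qed
  have secant: "norm (g x - g 0 - k * of_real x) \<le> k / 10 * \<bar>x\<bar>" if "\<bar>x\<bar> \<le> \<delta>" for x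
  proof -
    have "norm (g x - g 0 - (x - 0) *\<^sub>R g' 0) \<le> norm (x - 0) * (k / 10)"
    proof (rule vector_differentiable_bound_linearization[where S = "{-\<delta>..\<delta>}" and f' = g'])
      show "closed_segment 0 x \<subseteq> {-\<delta>..\<delta>}"
        using that by (auto simp: closed_segment_eq_real_ivl)
      show "(g has_vector_derivative g' t) (at t within {-\<delta>..\<delta>})" for t
        by (rule has_vector_derivative_at_within[OF g_deriv])
      show "norm (g' t - g' 0) \<le> k / 10" if "t \<in> {-\<delta>..\<delta>}" for t
        using that \<delta>(3)[of t] k(1) by auto
      show "0 \<in> {-\<delta>..\<delta>}" using \<delta> by auto
    qed
    then show ?thesis by (simp add: k(1) scaleR_conv_of_real mult.commute)
  qed
  \<comment> \<open>The product of the two denominators \<open>g x - (g 0 \<plusminus> \<sigma> t \<i>)\<close>.\<close>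
  define den where "den \<equiv> \<lambda>t x. (g x - g 0)\<^sup>2 + of_real (t\<^sup>2)"
  \<comment> \<open>\<open>e1\<close> and \<open>e2\<close> are the relative errors of \<open>g x - g 0 \<approx> k x\<close> and \<open>g' x \<approx> k\<close>; with both at most
    1/10, the two terms of \<open>g' x * cnj (den t x)\<close> keep a positive real part.\<close>
  have near: "den t x \<noteq> 0 \<and> k / 4 / (2 * k\<^sup>2 * x\<^sup>2 + t\<^sup>2) \<le> Re (g' x / den t x)"
    if x: "\<bar>x\<bar> \<le> \<delta>" and t: "0 < t" for t x
  proof -
    define e1 where "e1 = (if x = 0 then 0 else (g x - g 0) / of_real (k * x) - 1)"
    define e2 where "e2 = g' x / of_real k - 1"
    have q: "g x - g 0 = of_real (k * x) * (1 + e1)"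
      using k(2) by (simp add: e1_def)
    have "g x - g 0 - k * of_real x = of_real (k * x) * e1"
      unfolding q by (simp add: algebra_simps)
    then have scaled: "k * \<bar>x\<bar> * norm e1 \<le> k * \<bar>x\<bar> * (1/10)"
      using secant[OF x] k(2) by (simp add: norm_mult abs_mult)
    have e1: "norm e1 \<le> 1/10"
    proof (cases "x = 0")
      case False
      then have "0 < k * \<bar>x\<bar>" using k(2) by simp
      with scaled show ?thesis by (simp only: mult_le_cancel_left_pos)
    qed (simp add: e1_def)
    have g': "g' x = of_real k * (1 + e2)" using k(2) by (simp add: e2_def)
    have "g' x - k = of_real k * e2" unfolding g' by (simp add: algebra_simps)
    then have e2: "norm e2 \<le> 1/10"
      using \<delta>(3)[OF x] k(2) by (simp add: norm_mult)
    have cubic: "1/2 \<le> Re ((1 + e2) * (cnj (1 + e1))\<^sup>2)"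
    proof -
      have split: "(1 + e2) * (cnj (1 + e1))\<^sup>2 - 1
          = e2 * (1 + cnj e1)\<^sup>2 + cnj e1 * (2 + cnj e1)"
        by (simp add: power2_eq_square algebra_simps)
      have "norm (1 + cnj e1) \<le> 11/10"
        using norm_triangle_ineq[of 1 "cnj e1"] e1 by simp
      then have 1: "norm (e2 * (1 + cnj e1)\<^sup>2) \<le> 1/10 * (11/10)\<^sup>2"
        unfolding norm_mult norm_power using e2 by (intro mult_mono power_mono) auto
      have "norm (2 + cnj e1) \<le> 21/10"
        using norm_triangle_ineq[of 2 "cnj e1"] e1 by simp
      then have 2: "norm (cnj e1 * (2 + cnj e1)) \<le> 1/10 * (21/10)"
        unfolding norm_mult using e1 by (intro mult_mono) auto
      have "norm ((1 + e2) * (cnj (1 + e1))\<^sup>2 - 1) \<le> 1/10 * (11/10)\<^sup>2 + 1/10 * (21/10)"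
        unfolding split using 1 2 by (rule norm_triangle_mono)
      then show ?thesis
        using abs_Re_le_cmod[of "(1 + e2) * (cnj (1 + e1))\<^sup>2 - 1"] by (simp add: power2_eq_square)
    qed
    have lin: "1/2 \<le> Re (1 + e2)"
      using abs_Re_le_cmod[of e2] e2 by simp
    have den_eq: "den t x = of_real (k\<^sup>2 * x\<^sup>2) * (1 + e1)\<^sup>2 + of_real (t\<^sup>2)"
      unfolding den_def q by (simp add: power_mult_distrib)
    have "Re (g' x * cnj (den t x))
        = k * (k\<^sup>2 * x\<^sup>2) * Re ((1 + e2) * (cnj (1 + e1))\<^sup>2) + k * t\<^sup>2 * Re (1 + e2)"
    proof -
      have "g' x * cnj (den t x) = of_real (k * (k\<^sup>2 * x\<^sup>2)) * ((1 + e2) * (cnj (1 + e1))\<^sup>2)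
          + of_real (k * t\<^sup>2) * (1 + e2)"
        unfolding den_eq g' by (simp add: algebra_simps)
      then show ?thesis by simp
    qed
    also have "\<dots> \<ge> k * (k\<^sup>2 * x\<^sup>2) * (1/2) + k * t\<^sup>2 * (1/2)"
      using cubic lin k(2) by (intro add_mono mult_left_mono) auto
    finally have "k * (k\<^sup>2 * x\<^sup>2) * (1/2) + k * t\<^sup>2 * (1/2) \<le> Re (g' x * cnj (den t x))" .
    moreover have "0 \<le> k * t\<^sup>2" using k(2) by simp
    moreover have "k / 4 * (2 * k\<^sup>2 * x\<^sup>2 + t\<^sup>2) = k * (k\<^sup>2 * x\<^sup>2) * (1/2) + k * t\<^sup>2 * (1/4)"
      by (simp add: algebra_simps)
    ultimately have num: "k / 4 * (2 * k\<^sup>2 * x\<^sup>2 + t\<^sup>2) \<le> Re (g' x * cnj (den t x))"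
      by linarith
    have pos: "0 < 2 * k\<^sup>2 * x\<^sup>2 + t\<^sup>2" using t by (simp add: add_nonneg_pos)
    have "0 < k / 4 * (2 * k\<^sup>2 * x\<^sup>2 + t\<^sup>2)"
      using pos k(2) by (intro mult_pos_pos) auto
    then have numpos: "0 < Re (g' x * cnj (den t x))" using num by linarith
    then have nz: "den t x \<noteq> 0" by auto
    have "norm (1 + e1) \<le> 11/10" using norm_triangle_ineq[of 1 e1] e1 by simp
    then have "(norm (1 + e1))\<^sup>2 \<le> (11/10)\<^sup>2" by (intro power_mono) auto
    then have "(norm (1 + e1))\<^sup>2 \<le> 2" by (simp add: power2_eq_square)
    then have "norm (den t x) \<le> k\<^sup>2 * x\<^sup>2 * 2 + t\<^sup>2"
      unfolding den_eq
      by (intro order_trans[OF norm_triangle_ineq] add_mono)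
         (auto simp: norm_mult norm_power mult_left_mono)
    then have den2: "(norm (den t x))\<^sup>2 \<le> (2 * k\<^sup>2 * x\<^sup>2 + t\<^sup>2)\<^sup>2"
      by (intro power_mono) (auto simp: mult_ac)
    have "k / 4 * (2 * k\<^sup>2 * x\<^sup>2 + t\<^sup>2) / (2 * k\<^sup>2 * x\<^sup>2 + t\<^sup>2)\<^sup>2
        \<le> Re (g' x * cnj (den t x)) / (norm (den t x))\<^sup>2"
    proof (rule frac_le[OF less_imp_le[OF numpos] num _ den2])
      show "0 < (norm (den t x))\<^sup>2" using nz by simp
    qed
    moreover have "Re (g' x / den t x) = Re (g' x * cnj (den t x)) / (norm (den t x))\<^sup>2"
      unfolding complex_div_cnj[of "g' x" "den t x"]
      by (simp only: of_real_power[symmetric] Re_divide_of_real)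
    moreover have "k / 4 * (2 * k\<^sup>2 * x\<^sup>2 + t\<^sup>2) / (2 * k\<^sup>2 * x\<^sup>2 + t\<^sup>2)\<^sup>2 = k / 4 / (2 * k\<^sup>2 * x\<^sup>2 + t\<^sup>2)"
    proof -
      have cancel: "a * q / q\<^sup>2 = a / q" if "q \<noteq> 0" for a q :: real
        using that by (simp add: power2_eq_square)
      show ?thesis by (rule cancel) (use pos in simp)
    qed
    ultimately show ?thesis using nz by (simp only: simp_thms)
  qed
  \<comment> \<open>Away from the base point the denominator is bounded below uniformly in \<open>t\<close>.\<close>
  have far: "\<exists>m>0. \<forall>x\<in>{\<delta>..1-\<delta>}. m \<le> norm (g x - g 0)"
  proof -
    have "\<exists>x\<in>{\<delta>..1-\<delta>}. \<forall>y\<in>{\<delta>..1-\<delta>}. norm (g x - g 0) \<le> norm (g y - g 0)"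
      using \<delta>(1,2) by (intro continuous_attains_inf continuous_intros g_cont) auto
    then obtain x where x: "x \<in> {\<delta>..1-\<delta>}" "\<And>y. y \<in> {\<delta>..1-\<delta>} \<Longrightarrow> norm (g x - g 0) \<le> norm (g y - g 0)"
      by blast
    have "g x \<noteq> g 0"
    proof
      assume "g x = g 0"
      then have "x = 0" using x(1) \<delta>(1,2) by (intro inj_onD[OF g_inj]) auto
      then show False using x(1) \<delta>(1) by simp
    qed
    then have "0 < norm (g x - g 0)" by simp
    with x(2) show ?thesis by blast
  qed
  then obtain m where m: "0 < m" "\<And>x. x \<in> {\<delta>..1-\<delta>} \<Longrightarrow> m \<le> norm (g x - g 0)" by blast
  have "bounded (g' ` {0..1})"
    by (intro compact_imp_bounded compact_continuous_image continuous_on_subset[OF g'_cont]) auto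
  then obtain M where M: "\<And>x. x \<in> {0..1} \<Longrightarrow> norm (g' x) \<le> M" by (metis bounded_iff imageI)
  have M0: "0 \<le> M" using order_trans[OF norm_ge_zero M[of 0]] by simp
  define c where "c = k / 4 / (2 * k\<^sup>2 + 1)"
  have c: "0 < c" using k(2) by (simp add: c_def add_nonneg_pos)
  define \<epsilon> where "\<epsilon> = Min {\<delta>, m / 2, c * m\<^sup>2 / (4 * (M + 1))}"
  have \<epsilon>: "0 < \<epsilon>" "\<epsilon> \<le> \<delta>" "\<epsilon> \<le> m / 2" "\<epsilon> \<le> c * m\<^sup>2 / (4 * (M + 1))"
  proof -
    show "0 < \<epsilon>"
      unfolding \<epsilon>_def using \<delta>(1) m(1) c M0 by (subst Min_gr_iff) auto
  qed (unfold \<epsilon>_def, intro Min_le; simp)+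
  show ?thesis
  proof (rule that[OF \<epsilon>(1)])
    fix t assume t: "0 < t" "t < \<epsilon>"
      and out: "winding_number g (g 0 + of_real (\<sigma> * t) * \<i>) = 0"
        "g 0 + of_real (\<sigma> * t) * \<i> \<notin> path_image g"
    have far: "den t x \<noteq> 0 \<and> norm (g' x / den t x) \<le> 2 * M / m\<^sup>2" if x: "x \<in> {\<delta>..1-\<delta>}" for x
    proof -
      have "m\<^sup>2 \<le> (norm (g x - g 0))\<^sup>2" using m x by (intro power_mono) auto
      moreover have "t\<^sup>2 \<le> (m / 2)\<^sup>2" using t \<epsilon>(3) by (intro power_mono) auto
      moreover have "(norm (g x - g 0))\<^sup>2 \<le> norm (den t x) + t\<^sup>2"
        using norm_triangle_ineq4[of "den t x" "of_real (t\<^sup>2)"]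
        by (simp add: den_def norm_power)
      moreover have "(m / 2)\<^sup>2 = m\<^sup>2 / 4" by (simp add: power_divide)
      ultimately have den: "m\<^sup>2 / 2 \<le> norm (den t x)"
        using zero_le_power2[of m] by linarith
      moreover have "0 < m\<^sup>2 / 2" using m(1) by simp
      ultimately have "den t x \<noteq> 0" by auto
      moreover have "norm (g' x) / norm (den t x) \<le> M / (m\<^sup>2 / 2)"
        using M[of x] M0 x \<delta>(1) den m(1) by (intro frac_le) auto
      ultimately show ?thesis by (simp add: norm_divide mult.commute)
    qed
    have near_ends: "den t x \<noteq> 0 \<and> 0 \<le> Re (g' x / den t x)"
      if "x \<in> {0..1}" "x \<notin> {\<delta>..1-\<delta>}" for x
    proof -
      have nonneg: "0 \<le> k / 4 / (2 * k\<^sup>2 * y\<^sup>2 + t\<^sup>2)" for y using k(2) by simp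
      show ?thesis
      proof (cases "x < \<delta>")
        case True
        then show ?thesis using near[of x t] that t nonneg[of x] by (auto intro: order_trans)
      next
        case False
        have per: "g x = g (x - 1)" using g_periodic[of "x - 1"] by simp
        have "((\<lambda>s. g (s - 1)) has_vector_derivative g' (x - 1)) (at x)"
        proof -
          have "((\<lambda>s. s - 1) has_vector_derivative 1) (at x)"
            by (auto intro!: derivative_eq_intros)
          from vector_diff_chain_at[OF this g_deriv[of "x - 1"]] show ?thesis by (simp add: o_def)
        qed
        moreover have "(\<lambda>s. g (s - 1)) = g" using g_periodic[of "_ - 1"] by auto
        ultimately have "g' x = g' (x - 1)"
          using g_deriv[of x] by (metis vector_derivative_unique_at)
        then show ?thesis using near[of "x - 1" t] False that t per nonneg[of "x - 1"]
          by (auto simp: den_def intro: order_trans)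
      qed
    qed
    have den_nz: "den t x \<noteq> 0" if "x \<in> {0..1}" for x
      using far near_ends that by blast
    have fact: "den t x = (g x - (g 0 + of_real (\<sigma> * t) * \<i>)) * (g x - (g 0 - of_real (\<sigma> * t) * \<i>))" for x
      using \<sigma> by (auto simp: den_def power2_eq_square algebra_simps)
    show "g 0 - of_real (\<sigma> * t) * \<i> \<notin> path_image g
        \<and> \<sigma> * Re (winding_number g (g 0 - of_real (\<sigma> * t) * \<i>)) < 0"
    proof
      show notin: "g 0 - of_real (\<sigma> * t) * \<i> \<notin> path_image g"
        using den_nz fact by (fastforce simp: path_image_def)
      let ?w = "winding_number g (g 0 - of_real (\<sigma> * t) * \<i>)"
      have "((\<lambda>x. g' x / (g x - (g 0 + of_real (\<sigma> * t) * \<i>)) - g' x / (g x - (g 0 - of_real (\<sigma> * t) * \<i>)))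
          has_integral 2 * of_real pi * \<i> * 0 - 2 * of_real pi * \<i> * ?w) {0..1}"
        using has_integral_diff[OF winding_number_integral[OF out(2)] winding_number_integral[OF notin]]
        unfolding out(1) .
      then have "((\<lambda>x. 2 * of_real (\<sigma> * t) * \<i> * (g' x / den t x))
          has_integral 2 * of_real pi * \<i> * 0 - 2 * of_real pi * \<i> * ?w) {0..1}"
      proof (rule has_integral_eq[rotated])
        fix x :: real assume "x \<in> {0..1}"
        have partial: "d / A - d / B = (B - A) * (d / (A * B))" if "A * B \<noteq> 0" for A B d :: complex
          using that by (simp add: field_simps)
        have "(g x - (g 0 - of_real (\<sigma> * t) * \<i>)) - (g x - (g 0 + of_real (\<sigma> * t) * \<i>))
            = 2 * of_real (\<sigma> * t) * \<i>" by simp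
        then show "g' x / (g x - (g 0 + of_real (\<sigma> * t) * \<i>)) - g' x / (g x - (g 0 - of_real (\<sigma> * t) * \<i>))
            = 2 * of_real (\<sigma> * t) * \<i> * (g' x / den t x)"
          using partial den_nz[OF \<open>x \<in> {0..1}\<close>] unfolding fact by presburger
      qed
      from has_integral_mult_right[OF this, of "1 / (2 * of_real (\<sigma> * t) * \<i>)"]
      have "((\<lambda>x. g' x / den t x) has_integral - (of_real pi * ?w / of_real (\<sigma> * t))) {0..1}"
        using \<sigma> t by (auto simp: field_simps)
      then have J: "((\<lambda>x. Re (g' x / den t x)) has_integral - (pi * Re ?w / (\<sigma> * t))) {0..1}"
        by (auto dest!: has_integral_Re simp del: of_real_mult)
      then have int: "(\<lambda>x. Re (g' x / den t x)) integrable_on {0..1}" by blast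
      have t1: "t < 1" "t \<le> \<delta>" using t \<epsilon>(2) \<delta>(2) by auto
      have int1: "(\<lambda>x. Re (g' x / den t x)) integrable_on {0..t}"
        and int2: "(\<lambda>x. Re (g' x / den t x)) integrable_on {t..1}"
        using integrable_on_subinterval[OF int] t t1 by auto
      have "t * (c / t\<^sup>2) \<le> integral {0..t} (\<lambda>x. Re (g' x / den t x))"
      proof -
        have "integral {0..t} (\<lambda>x. c / t\<^sup>2) \<le> integral {0..t} (\<lambda>x. Re (g' x / den t x))"
        proof (rule integral_le[OF _ int1])
          fix x assume x: "x \<in> {0..t}"
          have "x\<^sup>2 \<le> t\<^sup>2" using x by (intro power_mono) auto
          then have "2 * k\<^sup>2 * x\<^sup>2 + t\<^sup>2 \<le> (2 * k\<^sup>2 + 1) * t\<^sup>2"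
            by (simp add: distrib_right mult_left_mono)
          then have "k / 4 / ((2 * k\<^sup>2 + 1) * t\<^sup>2) \<le> k / 4 / (2 * k\<^sup>2 * x\<^sup>2 + t\<^sup>2)"
            using k(2) t(1) by (intro divide_left_mono mult_pos_pos add_nonneg_pos) auto
          also have "\<dots> \<le> Re (g' x / den t x)" using near[of x t] x t t1 by auto
          finally show "c / t\<^sup>2 \<le> Re (g' x / den t x)"
            by (simp only: c_def divide_divide_eq_left mult.assoc)
        qed (rule integrable_const_ivl)
        then show ?thesis using t(1) by simp
      qed
      moreover have "- (2 * M / m\<^sup>2) \<le> integral {t..1} (\<lambda>x. Re (g' x / den t x))"
      proof -
        have M2: "0 \<le> 2 * M / m\<^sup>2" using M0 by simp
        have "integral {t..1} (\<lambda>x. - (2 * M / m\<^sup>2)) \<le> integral {t..1} (\<lambda>x. Re (g' x / den t x))"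
        proof (rule integral_le[OF _ int2])
          fix x assume x: "x \<in> {t..1}"
          show "- (2 * M / m\<^sup>2) \<le> Re (g' x / den t x)"
          proof (cases "x \<in> {\<delta>..1-\<delta>}")
            case True
            then show ?thesis using far[OF True] abs_Re_le_cmod[of "g' x / den t x"] by linarith
          next
            case False
            then show ?thesis using near_ends[of x] x t(1) M2 by auto
          qed
        qed (rule integrable_const_ivl)
        moreover have "integral {t..1} (\<lambda>x. - (2 * M / m\<^sup>2)) = (1 - t) * - (2 * M / m\<^sup>2)"
          using t1 by simp
        moreover have "t * (2 * M / m\<^sup>2) \<ge> 0" using t(1) M2 by (intro mult_nonneg_nonneg) auto
        ultimately show ?thesis by (simp only: left_diff_distrib)
      qed
      moreover have "2 * M / m\<^sup>2 < t * (c / t\<^sup>2)"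
      proof -
        have "t * (4 * (M + 1)) < \<epsilon> * (4 * (M + 1))"
          using t(2) M0 by (intro mult_strict_right_mono) auto
        also have "\<dots> \<le> c * m\<^sup>2"
          using \<epsilon>(4) M0 by (subst (asm) pos_le_divide_eq) auto
        finally have "t * (4 * (M + 1)) < c * m\<^sup>2" .
        then have "4 * (t * M) + 4 * t < c * m\<^sup>2" by (simp add: algebra_simps)
        moreover have "0 \<le> t * M" using t(1) M0 by simp
        ultimately have "2 * (t * M) < c * m\<^sup>2" using t(1) by linarith
        then have "2 * M * t < c * m\<^sup>2" by (simp add: mult_ac)
        then have "2 * M / m\<^sup>2 < c / t" using t(1) m(1) by (simp add: field_simps)
        then show ?thesis using t(1) by (simp add: power2_eq_square)
      qed
      moreover have "integral {0..t} (\<lambda>x. Re (g' x / den t x)) + integral {t..1} (\<lambda>x. Re (g' x / den t x))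
          = - (pi * Re ?w / (\<sigma> * t))"
        using Henstock_Kurzweil_Integration.integral_combine[OF _ _ int, of t] t t1 integral_unique[OF J]
        by simp
      ultimately have "0 < - (pi * Re ?w / (\<sigma> * t))" by linarith
      then have "0 < t * - (pi * Re ?w / (\<sigma> * t))" using t(1) by (rule mult_pos_pos[rotated])
      also have "\<dots> = - (pi * (\<sigma> * Re ?w))" using t(1) \<sigma> by (auto simp: field_simps)
      finally show "\<sigma> * Re ?w < 0"
        using pi_gt_zero by (simp add: zero_less_mult_iff mult_less_0_iff)
    qed
  qed
qed

end

section \<open>Area as the integral of the winding number\<close>

text \<open>
Since the Cauchy kernel at \<open>a + b \<i>\<close> is at most \<open>\<bar>a\<bar> powr (-1/2) * \<bar>b\<bar> powr (-1/2)\<close>, its integrability over the plane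
reduces to that of this function on the line.
\<close>

definition inverse_sqrt_near :: "real \<Rightarrow> real \<Rightarrow> real" where
  "inverse_sqrt_near R s = indicator {-R..R} s * \<bar>s\<bar> powr (-1/2)"

lemma integrable_inverse_sqrt_near: "integrable lborel (inverse_sqrt_near R)"
proof (cases "0 \<le> R")
  case True
  define h where "h \<equiv> \<lambda>s::real. indicator {0..R} s * s powr (-1/2)"
  have h_eq: "h = (\<lambda>s. if s \<in> {0..R} then s powr (-1/2) else 0)" by (auto simp: h_def)
  have meas: "h \<in> borel_measurable borel" unfolding h_def by measurable
  have "((\<lambda>x. x powr (-1/2)) has_integral (R powr (-1/2 + 1) / (-1/2 + 1))) {0..R}"
    using True by (intro has_integral_powr_from_0) auto
  then have "(h has_integral (R powr (-1/2 + 1) / (-1/2 + 1))) UNIV"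
    unfolding h_eq has_integral_restrict_UNIV .
  then have nn: "(\<integral>\<^sup>+ x. ennreal (h x) \<partial>lborel) = ennreal (R powr (-1/2 + 1) / (-1/2 + 1))"
    by (intro nn_integral_has_integral_lborel[OF meas]) (auto simp: h_def)
  have h: "integrable lborel h"
    by (rule integrableI_nn_integral_finite[OF _ _ nn]) (use meas in \<open>auto simp: h_def\<close>)
  have "integrable lborel (\<lambda>s. h (0 + (-1) * s))"
    by (rule lborel_integrable_real_affine[OF h]) simp
  then have "integrable lborel (\<lambda>s. h s + h (- s))" using h by simp
  moreover have "h s + h (- s) = inverse_sqrt_near R s" for s
    using True by (auto simp: h_def inverse_sqrt_near_def indicator_def)
  ultimately show ?thesis by simp
next
  case False
  then have "inverse_sqrt_near R = (\<lambda>_. 0)" by (auto simp: inverse_sqrt_near_def)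
  then show ?thesis by simp
qed

lemma inverse_sqrt_near_nonneg: "0 \<le> inverse_sqrt_near R s"
  by (simp add: inverse_sqrt_near_def)

lemma norm_inverse_le_inverse_sqrt:
  fixes a b :: real assumes "a \<noteq> 0" "b \<noteq> 0"
  shows "norm (1 / Complex a b) \<le> \<bar>a\<bar> powr (-1/2) * \<bar>b\<bar> powr (-1/2)"
proof -
  have "2 * (\<bar>a\<bar> * \<bar>b\<bar>) \<le> a\<^sup>2 + b\<^sup>2"
    using sum_squares_bound[of "\<bar>a\<bar>" "\<bar>b\<bar>"] by (simp add: mult.assoc)
  moreover have "0 \<le> \<bar>a\<bar> * \<bar>b\<bar>" by simp
  ultimately have "\<bar>a\<bar> * \<bar>b\<bar> \<le> a\<^sup>2 + b\<^sup>2" by linarith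
  then have "sqrt (\<bar>a\<bar> * \<bar>b\<bar>) \<le> norm (Complex a b)"
    by (simp add: cmod_def)
  moreover have "0 < sqrt (\<bar>a\<bar> * \<bar>b\<bar>)" using assms by simp
  ultimately have "inverse (norm (Complex a b)) \<le> inverse (sqrt (\<bar>a\<bar> * \<bar>b\<bar>))"
    by (rule le_imp_inverse_le)
  also have "\<dots> = \<bar>a\<bar> powr (-1/2) * \<bar>b\<bar> powr (-1/2)"
    by (simp add: real_sqrt_mult powr_minus powr_half_sqrt)
  finally show ?thesis by (simp add: norm_divide inverse_eq_divide)
qed

text \<open>
The pair \<open>(\<eta>, \<xi>)\<close> stands for the point \<open>\<xi> + \<eta> \<i>\<close>: with this order the inner one of two iterated integrals
runs along horizontal segments, where the kernel has a logarithm as primitive.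
\<close>

definition cauchy_kernel :: "real \<Rightarrow> complex \<Rightarrow> real \<times> real \<Rightarrow> complex" where
  "cauchy_kernel R z = (\<lambda>(\<eta>, \<xi>). indicator {-R..R} \<eta> *\<^sub>R indicator {-R..R} \<xi> *\<^sub>R (1 / (z - Complex \<xi> \<eta>)))"

lemma measurable_Complex [measurable]:
  assumes "f \<in> borel_measurable M" "h \<in> borel_measurable M"
  shows "(\<lambda>x. Complex (f x) (h x)) \<in> borel_measurable M"
proof -
  have "(\<lambda>x. of_real (f x) + \<i> * of_real (h x)) \<in> borel_measurable M"
    using assms by measurable
  then show ?thesis by (simp add: Complex_eq)
qed

lemma cauchy_kernel_measurable:
  assumes "z \<in> borel_measurable M" "p \<in> M \<rightarrow>\<^sub>M lborel"
  shows "(\<lambda>x. cauchy_kernel R (z x) (p x)) \<in> borel_measurable M"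
proof -
  have p: "p \<in> M \<rightarrow>\<^sub>M borel \<Otimes>\<^sub>M borel" using assms(2) by (simp add: borel_prod)
  have [measurable]: "(\<lambda>x. fst (p x)) \<in> borel_measurable M" "(\<lambda>x. snd (p x)) \<in> borel_measurable M"
    using measurable_compose[OF p measurable_fst] measurable_compose[OF p measurable_snd] by auto
  note assms(1)[measurable]
  show ?thesis
    unfolding cauchy_kernel_def case_prod_beta by measurable
qed

lemma cauchy_kernel_slice_bound:
  assumes z: "\<bar>Re z\<bar> \<le> R" "\<bar>Im z\<bar> \<le> R" and "\<eta> \<noteq> Im z"  "\<xi> \<noteq> Re z"
  shows "norm (cauchy_kernel R z (\<eta>, \<xi>))
      \<le> inverse_sqrt_near (2 * R) (Im z - \<eta>) * inverse_sqrt_near (2 * R) (Re z - \<xi>)"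
proof (cases "\<eta> \<in> {-R..R} \<and> \<xi> \<in> {-R..R}")
  case True
  have "z - Complex \<xi> \<eta> = Complex (Re z - \<xi>) (Im z - \<eta>)" by (simp add: complex_eq_iff)
  moreover have "Re z - \<xi> \<in> {-(2 * R)..2 * R}" "Im z - \<eta> \<in> {-(2 * R)..2 * R}"
    using True z by auto
  ultimately show ?thesis
    using True norm_inverse_le_inverse_sqrt[of "Re z - \<xi>" "Im z - \<eta>"] assms(3,4)
    by (simp add: cauchy_kernel_def inverse_sqrt_near_def mult.commute)
next
  case False
  then show ?thesis
    by (auto simp: cauchy_kernel_def inverse_sqrt_near_nonneg)
qed

lemma cauchy_kernel_integrable:
  assumes z: "\<bar>Re z\<bar> \<le> R" "\<bar>Im z\<bar> \<le> R"
  shows "integrable lborel (cauchy_kernel R z)"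
    and "(\<integral>p. norm (cauchy_kernel R z p) \<partial>lborel) \<le> (\<integral>s. inverse_sqrt_near (2 * R) s \<partial>lborel)\<^sup>2"
proof -
  let ?h = "inverse_sqrt_near (2 * R)" and ?k = "cauchy_kernel R z"
  let ?H = "\<integral>s. ?h s \<partial>lborel"
  have h_shift: "integrable lborel (\<lambda>s. ?h (a - s))" for a
    using lborel_integrable_real_affine[OF integrable_inverse_sqrt_near, of "-1" "2 * R" a] by simp
  have int_shift: "(\<integral>s. ?h (a - s) \<partial>lborel) = ?H" for a
    using lborel_integral_real_affine[of "-1" ?h a] by simp
  have meas: "?k \<in> borel_measurable (lborel \<Otimes>\<^sub>M lborel)"
    unfolding lborel_prod by (rule cauchy_kernel_measurable[where p="\<lambda>x. x"]) auto
  have slice_meas: "(\<lambda>\<xi>. ?k (\<eta>, \<xi>)) \<in> borel_measurable lborel" for \<eta>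
    using measurable_Pair2[OF meas, of \<eta>] by simp
  have bound: "AE \<xi> in lborel. norm (?k (\<eta>, \<xi>)) \<le> ?h (Im z - \<eta>) * ?h (Re z - \<xi>)"
    if "\<eta> \<noteq> Im z" for \<eta>
    using AE_lborel_singleton[of "Re z"]
    by eventually_elim (rule cauchy_kernel_slice_bound[OF z that])
  have slice: "integrable lborel (\<lambda>\<xi>. ?k (\<eta>, \<xi>))" if "\<eta> \<noteq> Im z" for \<eta>
  proof (rule Bochner_Integration.integrable_bound[OF _ slice_meas])
    show "integrable lborel (\<lambda>\<xi>. ?h (Im z - \<eta>) * ?h (Re z - \<xi>))" using h_shift by simp
    show "AE \<xi> in lborel. norm (?k (\<eta>, \<xi>)) \<le> norm (?h (Im z - \<eta>) * ?h (Re z - \<xi>))"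
      using bound[OF that] by eventually_elim (simp add: abs_mult inverse_sqrt_near_nonneg)
  qed
  have slice_norm: "(\<integral>\<xi>. norm (?k (\<eta>, \<xi>)) \<partial>lborel) \<le> ?h (Im z - \<eta>) * ?H" if "\<eta> \<noteq> Im z" for \<eta>
    using integral_mono_AE[OF integrable_norm[OF slice[OF that]] integrable_mult_right[OF h_shift] bound[OF that]]
    by (simp add: int_shift)
  have norm_slice_int: "integrable lborel (\<lambda>\<eta>. \<integral>\<xi>. norm (?k (\<eta>, \<xi>)) \<partial>lborel)"
  proof (rule Bochner_Integration.integrable_bound[OF integrable_mult_left[OF h_shift[of "Im z"], of ?H]])
    show "(\<lambda>\<eta>. \<integral>\<xi>. norm (?k (\<eta>, \<xi>)) \<partial>lborel) \<in> borel_measurable lborel"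
      using meas by (intro lborel.borel_measurable_lebesgue_integral) (simp add: case_prod_beta)
    show "AE \<eta> in lborel. norm (\<integral>\<xi>. norm (?k (\<eta>, \<xi>)) \<partial>lborel) \<le> norm (?h (Im z - \<eta>) * ?H)"
      using AE_lborel_singleton[of "Im z"]
      by eventually_elim (use slice_norm in \<open>force intro: order_trans[OF _ abs_ge_self]\<close>)
  qed
  have int: "integrable (lborel \<Otimes>\<^sub>M lborel) ?k"
  proof (rule lborel_pair.Fubini_integrable[OF meas norm_slice_int])
    show "AE \<eta> in lborel. integrable lborel (\<lambda>\<xi>. ?k (\<eta>, \<xi>))"
      using AE_lborel_singleton[of "Im z"] by eventually_elim (rule slice)
  qed
  then show "integrable lborel ?k" by (simp add: lborel_prod)
  have "(\<integral>p. norm (?k p) \<partial>lborel) = (\<integral>\<eta>. \<integral>\<xi>. norm (?k (\<eta>, \<xi>)) \<partial>lborel \<partial>lborel)"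
    using lborel_pair.integral_fst'[OF integrable_norm[OF int]] by (simp add: lborel_prod)
  also have "\<dots> \<le> (\<integral>\<eta>. ?h (Im z - \<eta>) * ?H \<partial>lborel)"
  proof (rule integral_mono_AE[OF norm_slice_int])
    show "AE \<eta> in lborel. (\<integral>\<xi>. norm (?k (\<eta>, \<xi>)) \<partial>lborel) \<le> ?h (Im z - \<eta>) * ?H"
      using AE_lborel_singleton[of "Im z"] by eventually_elim (rule slice_norm)
  qed (use h_shift in simp)
  also have "\<dots> = ?H\<^sup>2" by (simp add: int_shift power2_eq_square)
  finally show "(\<integral>p. norm (?k p) \<partial>lborel) \<le> ?H\<^sup>2" .
qed

text \<open>
Both logarithms are holomorphic for \<open>\<bar>Re z\<bar> < R\<close>, because their arguments have positive real part there.
\<close>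

definition slice_log :: "real \<Rightarrow> real \<Rightarrow> complex \<Rightarrow> complex" where
  "slice_log R \<eta> z = Ln (z + of_real R - \<i> * of_real \<eta>) - Ln (of_real R - z + \<i> * of_real \<eta>)"

text \<open>
The primitive \<open>- Ln (z - \<xi> - \<eta> \<i>)\<close> takes at \<open>\<xi> = R\<close> an argument in the left half-plane. Replacing it by its negative
costs \<open>\<pi> \<i>\<close> or \<open>- \<pi> \<i>\<close>, according to the side of the horizontal line on which \<open>z\<close> lies.
\<close>

lemma cauchy_kernel_slice_integral:
  assumes z: "\<bar>Re z\<bar> < R" and \<eta>: "\<eta> \<in> {-R..R}" "\<eta> \<noteq> Im z"
  shows "(\<integral>\<xi>. cauchy_kernel R z (\<eta>, \<xi>) \<partial>lborel) = slice_log R \<eta> z - \<i> * pi * sgn (Im z - \<eta>)"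
proof -
  define F where "F \<equiv> \<lambda>\<xi>::real. - Ln (z - Complex \<xi> \<eta>)"
  have im: "Im (z - Complex \<xi> \<eta>) \<noteq> 0" for \<xi> using \<eta>(2) by simp
  then have nz: "z - Complex \<xi> \<eta> \<noteq> 0" for \<xi> by (metis zero_complex.sel(2))
  have F: "(F has_vector_derivative 1 / (z - Complex \<xi> \<eta>)) (at \<xi> within S)" for \<xi> S
  proof -
    have "((\<lambda>w. - Ln w) has_field_derivative - (1 / (z - Complex \<xi> \<eta>))) (at (z - Complex \<xi> \<eta>))"
      using im[of \<xi>] by (auto intro!: derivative_eq_intros simp: complex_nonpos_Reals_iff inverse_eq_divide)
    moreover have "((\<lambda>\<xi>. z - Complex \<xi> \<eta>) has_vector_derivative -1) (at \<xi> within S)"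
      unfolding Complex_eq by (auto intro!: derivative_eq_intros)
    ultimately show ?thesis
      using field_vector_diff_chain_within[OF _ has_field_derivative_at_within]
      by (fastforce simp: F_def o_def)
  qed
  have "((\<lambda>\<xi>. 1 / (z - Complex \<xi> \<eta>)) has_integral F R - F (-R)) {-R..R}"
    using z by (intro fundamental_theorem_of_calculus F) auto
  moreover have "set_integrable lborel {-R..R} (\<lambda>\<xi>. 1 / (z - Complex \<xi> \<eta>))"
    unfolding Complex_eq using nz[unfolded Complex_eq]
    by (intro borel_integrable_atLeastAtMost' continuous_intros) auto
  ultimately have "(LINT \<xi>:{-R..R}|lborel. 1 / (z - Complex \<xi> \<eta>)) = F R - F (-R)"
    by (simp add: set_borel_integral_eq_integral(2) integral_unique)
  then have "(\<integral>\<xi>. cauchy_kernel R z (\<eta>, \<xi>) \<partial>lborel) = F R - F (-R)"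
    using \<eta>(1) by (simp add: set_lebesgue_integral_def cauchy_kernel_def)
  also have "\<dots> = slice_log R \<eta> z - \<i> * pi * sgn (Im z - \<eta>)"
  proof -
    define v where "v = of_real R - z + \<i> * of_real \<eta>"
    have v: "Im v = \<eta> - Im z" by (simp add: v_def)
    then have "v \<noteq> 0" using \<eta>(2) by auto
    have zR: "z - Complex R \<eta> = - v" by (simp add: v_def Complex_eq)
    have zmR: "z - Complex (-R) \<eta> = z + of_real R - \<i> * of_real \<eta>" by (simp add: Complex_eq)
    have "Ln (- v) = Ln v + \<i> * pi * sgn (Im z - \<eta>)"
      using Ln_minus[OF \<open>v \<noteq> 0\<close>] v \<eta>(2) by (auto simp: sgn_if)
    then show ?thesis
      unfolding F_def slice_log_def zR zmR v_def[symmetric] by simp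
  qed
  finally show ?thesis .
qed

lemma integral_sgn_diff:
  fixes R y :: real assumes "\<bar>y\<bar> \<le> R"
  shows "((\<lambda>\<eta>. sgn (y - \<eta>)) has_integral 2 * y) {-R..R}"
proof -
  have y: "-R \<le> y" "y \<le> R" using assms by auto
  have "((\<lambda>\<eta>. sgn (y - \<eta>)) has_integral (y + R)) {-R..y}"
    by (rule has_integral_spike_finite[where f = "\<lambda>_. 1" and S = "{y}"])
       (use y has_integral_const_real[of "1::real" "-R" y] in auto)
  moreover have "((\<lambda>\<eta>. sgn (y - \<eta>)) has_integral - (R - y)) {y..R}"
    by (rule has_integral_spike_finite[where f = "\<lambda>_. -1" and S = "{y}"])
       (use y has_integral_const_real[of "-1::real" y R] in auto)
  ultimately have "((\<lambda>\<eta>. sgn (y - \<eta>)) has_integral (y + R) + - (R - y)) {-R..R}"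
    using y by (intro has_integral_combine[of "-R" y R]) auto
  then show ?thesis by simp
qed

context C1_loop
begin

lemma null_set_loop: "{p. Complex (snd p) (fst p) \<in> path_image g} \<in> null_sets lborel"
proof -
  let ?c = "\<lambda>t. (Im (g t), Re (g t))"
  have eq: "{p. Complex (snd p) (fst p) \<in> path_image g} = ?c ` {0..1}"
    by (force simp: path_image_def complex_eq_iff image_iff)
  have "compact (?c ` {0..1})"
    by (intro compact_continuous_image continuous_intros g_cont) auto
  then have "?c ` {0..1} \<in> sets lborel" by (simp add: borel_compact)
  moreover have "negligible (?c ` {0..1})"
  proof (rule negligible_differentiable_image_lowdim)
    have "?c differentiable (at t)" for t
    proof -
      have "g differentiable (at t)" by (rule differentiableI_vector[OF g_deriv])
      then obtain D where D: "(g has_derivative D) (at t)" by (auto simp: differentiable_def)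
      have "(?c has_derivative (\<lambda>x. (Im (D x), Re (D x)))) (at t)"
        by (intro has_derivative_Pair has_derivative_Im has_derivative_Re D)
      then show ?thesis by (auto simp: differentiable_def)
    qed
    then show "?c differentiable_on {0..1}"
      by (simp add: differentiable_at_imp_differentiable_on)
  qed simp
  ultimately show ?thesis
    unfolding eq by (simp add: negligible_iff_null_sets null_sets_completion_iff)
qed

lemma integral_slice_log:
  assumes "\<And>t. \<bar>Re (g t)\<bar> < R"
  shows "((\<lambda>t. g' t * slice_log R \<eta> (g t)) has_integral 0) {0..1}"
proof -
  let ?S = "{z. Re z < R} \<inter> {z. - R < Re z}"
  have "(slice_log R \<eta> has_contour_integral 0) g"
  proof (rule Cauchy_theorem_convex_simple[of _ ?S])
    show "slice_log R \<eta> holomorphic_on ?S"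
      unfolding slice_log_def by (intro holomorphic_intros) (auto simp: complex_nonpos_Reals_iff)
    show "convex ?S"
      by (intro convex_Int convex_halfspace_Re_lt convex_halfspace_Re_gt)
    show "path_image g \<subseteq> ?S"
    proof
      fix z assume "z \<in> path_image g"
      then obtain t where "z = g t" by (auto simp: path_image_def)
      then show "z \<in> ?S" using assms[of t] by auto
    qed
  qed (use valid closed_path in auto)
  then show ?thesis
    unfolding has_contour_integral_def
  proof (rule has_integral_eq[rotated])
    show "slice_log R \<eta> (g t) * vector_derivative g (at t within {0..1}) = g' t * slice_log R \<eta> (g t)"
      if "t \<in> {0..1}" for t
      using vector_derivative_within_cbox[of 0 1 t g "g' t"] that g_deriv[of t]
      by (simp add: has_vector_derivative_at_within)
  qed
qed

lemma continuous_slice_log: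
  assumes "\<And>t. \<bar>Re (g t)\<bar> < R"
  shows "continuous_on S (\<lambda>(t, \<eta>). g' t * slice_log R \<eta> (g t))"
proof -
  have "\<not> R \<le> Re (g t)" "\<not> Re (g t) + R \<le> 0" for t using assms[of t] by auto
  then show ?thesis
    unfolding slice_log_def case_prod_beta
    by (intro continuous_intros continuous_on_compose2[OF g'_cont] continuous_on_compose2[OF g_cont[of UNIV]])
       (auto simp: complex_nonpos_Reals_iff)
qed

text \<open>
Insert the Cauchy integral for the winding number and integrate over the square first. On each horizontal
slice this gives \<open>slice_log\<close>, whose integral over the loop vanishes by Cauchy's theorem, and a sign function,
whose integral over \<open>\<eta>\<close> is \<open>2 Im (g t)\<close>.
\<close>

theorem integral_winding_number:
  assumes R: "\<And>t. \<bar>Re (g t)\<bar> < R" "\<And>t. \<bar>Im (g t)\<bar> < R"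
  obtains W where "integrable lborel W"
    and "\<And>p. Complex (snd p) (fst p) \<notin> path_image g \<Longrightarrow>
           W p = indicator ({-R..R} \<times> {-R..R}) p *\<^sub>R winding_number g (Complex (snd p) (fst p))"
    and "(\<integral>p. W p \<partial>lborel) = - integral {0..1} (\<lambda>t. of_real (Im (g t)) * g' t)"
proof -
  have R': "\<bar>Re (g t)\<bar> \<le> R" "\<bar>Im (g t)\<bar> \<le> R" for t using R[of t] by auto
  define f where "f \<equiv> \<lambda>t p. indicator {0..1} t *\<^sub>R (g' t * cauchy_kernel R (g t) p)"
  define H where "H = (\<integral>s. inverse_sqrt_near (2 * R) s \<partial>lborel)\<^sup>2"
  have g_meas: "g \<in> borel_measurable borel" and g'_meas: "g' \<in> borel_measurable borel"
    using g_cont g'_cont by (auto intro: borel_measurable_continuous_onI)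
  have meas: "case_prod f \<in> borel_measurable (lborel \<Otimes>\<^sub>M (lborel :: (real \<times> real) measure))"
  proof -
    have "(\<lambda>x. cauchy_kernel R (g (fst x)) (snd x)) \<in> borel_measurable (lborel \<Otimes>\<^sub>M (lborel :: (real \<times> real) measure))"
      using g_meas by (intro cauchy_kernel_measurable) (auto intro: measurable_compose[of fst])
    moreover have "(\<lambda>x. g' (fst x)) \<in> borel_measurable (lborel \<Otimes>\<^sub>M (lborel :: (real \<times> real) measure))"
      using g'_meas by (auto intro: measurable_compose[of fst])
    ultimately show ?thesis
      unfolding f_def case_prod_beta by measurable
  qed
  have kernel: "integrable lborel (cauchy_kernel R (g t))" 
    "(\<integral>p. norm (cauchy_kernel R (g t) p) \<partial>lborel) \<le> H" for t
    using cauchy_kernel_integrable[OF R'] by (auto simp: H_def)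
  have g'_int: "set_integrable lborel {0..1} (\<lambda>t. norm (g' t) * H)"
    by (intro borel_integrable_atLeastAtMost' continuous_intros continuous_on_subset[OF g'_cont]) auto
  have int_f: "integrable (lborel \<Otimes>\<^sub>M lborel) (case_prod f)"
  proof (rule lborel_pair.Fubini_integrable[OF meas])
    show "AE t in lborel. integrable lborel (\<lambda>p. case_prod f (t, p))"
      using kernel(1) by (simp add: f_def)
    show "integrable lborel (\<lambda>t. \<integral>p. norm (case_prod f (t, p)) \<partial>lborel)"
    proof (rule Bochner_Integration.integrable_bound[OF g'_int[unfolded set_integrable_def]])
      show "(\<lambda>t. \<integral>p. norm (case_prod f (t, p)) \<partial>lborel) \<in> borel_measurable lborel"
        using meas by (intro lborel.borel_measurable_lebesgue_integral) (simp add: case_prod_beta)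
      have "norm (\<integral>p. norm (case_prod f (t, p)) \<partial>lborel)
          \<le> norm (indicator {0..1} t *\<^sub>R (norm (g' t) * H))" for t
        using kernel(2)[of t] zero_le_power2[of "(\<integral>s. inverse_sqrt_near (2 * R) s \<partial>lborel)"]
        by (simp add: f_def norm_mult abs_mult mult_left_mono mult.left_commute H_def[symmetric])
      then show "AE t in lborel. norm (\<integral>p. norm (case_prod f (t, p)) \<partial>lborel)
          \<le> norm (indicator {0..1} t *\<^sub>R (norm (g' t) * H))" by simp
    qed
  qed
  \<comment> \<open>Defining \<open>W\<close> as an inner integral makes it measurable without any knowledge of
    \<open>winding_number\<close> at points of the loop.\<close>
  define W where "W \<equiv> \<lambda>p. (\<integral>t. f t p \<partial>lborel) / (2 * of_real pi * \<i>)"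
  have W_int: "integrable lborel W"
    unfolding W_def using lborel_pair.integrable_snd[OF int_f] by simp
  have W_eq: "W p = indicator ({-R..R} \<times> {-R..R}) p *\<^sub>R winding_number g (Complex (snd p) (fst p))"
    if p: "Complex (snd p) (fst p) \<notin> path_image g" for p
  proof -
    let ?z = "Complex (snd p) (fst p)"
    have "g t \<noteq> ?z" if "t \<in> {0..1}" for t using p that by (metis path_image_def image_eqI)
    then have "set_integrable lborel {0..1} (\<lambda>t. g' t / (g t - ?z))"
      by (intro borel_integrable_atLeastAtMost' continuous_intros continuous_on_subset[OF g'_cont] g_cont) auto
    then have "(LINT t:{0..1}|lborel. g' t / (g t - ?z)) = 2 * of_real pi * \<i> * winding_number g ?z"
      using winding_number_integral[OF p] by (simp add: set_borel_integral_eq_integral(2) integral_unique)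
    moreover have "f t p = indicator ({-R..R} \<times> {-R..R}) p *\<^sub>R (indicator {0..1} t *\<^sub>R (g' t / (g t - ?z)))" for t
      by (cases p) (simp add: f_def cauchy_kernel_def indicator_times)
    ultimately have "(\<integral>t. f t p \<partial>lborel)
        = indicator ({-R..R} \<times> {-R..R}) p *\<^sub>R (2 * of_real pi * \<i> * winding_number g ?z)"
      by (simp add: set_lebesgue_integral_def del: scaleR_scaleR)
    then show ?thesis
      by (cases "p \<in> {-R..R} \<times> {-R..R}") (simp_all add: W_def)
  qed
  have outer: "(\<integral>p. cauchy_kernel R z p \<partial>lborel)
      = integral {-R..R} (\<lambda>\<eta>. slice_log R \<eta> z) - 2 * of_real pi * \<i> * of_real (Im z)"
    if z: "\<bar>Re z\<bar> < R" "\<bar>Im z\<bar> < R" for z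
  proof -
    define J where "J \<equiv> \<lambda>\<eta>::real. slice_log R \<eta> z - \<i> * pi * sgn (Im z - \<eta>)"
    have "\<not> R \<le> Re z" "\<not> Re z + R \<le> 0" using z(1) by auto
    then have log_cont: "continuous_on S (\<lambda>\<eta>. slice_log R \<eta> z)" for S
      unfolding slice_log_def by (intro continuous_intros) (auto simp: complex_nonpos_Reals_iff)
    have J_meas: "J \<in> borel_measurable borel"
      unfolding J_def sgn_if
      using borel_measurable_continuous_onI[OF log_cont] by measurable
    have k_int: "integrable (lborel \<Otimes>\<^sub>M lborel) (cauchy_kernel R z)"
      unfolding lborel_prod by (rule cauchy_kernel_integrable) (use z in auto)
    have slice: "AE \<eta> in lborel. (\<integral>\<xi>. cauchy_kernel R z (\<eta>, \<xi>) \<partial>lborel) = indicator {-R..R} \<eta> *\<^sub>R J \<eta>"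
      using AE_lborel_singleton[of "Im z"]
    proof eventually_elim
      case (elim \<eta>)
      then show ?case
        using cauchy_kernel_slice_integral[OF z(1), of \<eta>]
        by (cases "\<eta> \<in> {-R..R}") (auto simp: J_def cauchy_kernel_def)
    qed
    have "integrable lborel (\<lambda>\<eta>. \<integral>\<xi>. cauchy_kernel R z (\<eta>, \<xi>) \<partial>lborel)"
      by (rule lborel_pair.integrable_fst'[OF k_int])
    then have J_int: "set_integrable lborel {-R..R} J"
      unfolding set_integrable_def
      by (rule integrable_cong_AE_imp[OF _ _ slice]) (use J_meas in measurable)
    have "(\<integral>p. cauchy_kernel R z p \<partial>lborel) = (\<integral>\<eta>. \<integral>\<xi>. cauchy_kernel R z (\<eta>, \<xi>) \<partial>lborel \<partial>lborel)"
      using lborel_pair.integral_fst'[OF k_int] by (simp add: lborel_prod)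
    also have "\<dots> = (LINT \<eta>:{-R..R}|lborel. J \<eta>)"
      unfolding set_lebesgue_integral_def
      using lborel_pair.integrable_fst'[OF k_int] J_int[unfolded set_integrable_def] slice
      by (intro integral_cong_AE) auto
    also have "\<dots> = integral {-R..R} J"
      by (rule set_borel_integral_eq_integral(2)[OF J_int])
    also have "\<dots> = integral {-R..R} (\<lambda>\<eta>. slice_log R \<eta> z) - \<i> * pi * (2 * Im z)"
    proof (rule integral_unique)
      have "((\<lambda>\<eta>. complex_of_real (sgn (Im z - \<eta>))) has_integral of_real (2 * Im z)) {-R..R}"
        using z by (intro has_integral_of_real integral_sgn_diff) auto
      then show "(J has_integral integral {-R..R} (\<lambda>\<eta>. slice_log R \<eta> z) - \<i> * pi * (2 * Im z)) {-R..R}"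
        unfolding J_def
        by (intro has_integral_diff has_integral_mult_right integrable_integral integrable_continuous_real log_cont)
           simp_all
    qed
    finally show ?thesis by (simp add: algebra_simps)
  qed
  define A where "A \<equiv> \<lambda>t. integral {-R..R} (\<lambda>\<eta>. slice_log R \<eta> (g t))"
  have f_outer: "(\<integral>p. f t p \<partial>lborel) = indicator {0..1} t *\<^sub>R (g' t * (A t - 2 * of_real pi * \<i> * of_real (Im (g t))))" for t
    using outer[OF R] by (simp add: f_def A_def)
  have set_int: "set_integrable lborel {0..1} (\<lambda>t. g' t * (A t - 2 * of_real pi * \<i> * of_real (Im (g t))))"
    using lborel_pair.integrable_fst[OF int_f] by (simp add: f_outer set_integrable_def)
  have y_int: "(\<lambda>t. of_real (Im (g t)) * g' t) integrable_on {0..1}"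
    by (intro integrable_continuous_real continuous_intros g_cont continuous_on_subset[OF g'_cont]) auto
  have A_zero: "integral {0..1} (\<lambda>t. g' t * A t) = 0"
  proof -
    have "integral {0..1} (\<lambda>t. integral {-R..R} (\<lambda>\<eta>. g' t * slice_log R \<eta> (g t)))
        = integral {-R..R} (\<lambda>\<eta>. integral {0..1} (\<lambda>t. g' t * slice_log R \<eta> (g t)))"
      using integral_swap_continuous[where a="0::real" and b="1::real" and c="-R" and d=R,
          OF continuous_slice_log[OF R(1)]] by simp
    also have "\<dots> = 0"
      using integral_unique[OF integral_slice_log[OF R(1)]] by simp
    finally show ?thesis by (simp add: A_def)
  qed
  have "2 * of_real pi * \<i> * (\<integral>p. W p \<partial>lborel) = (\<integral>p. \<integral>t. f t p \<partial>lborel \<partial>lborel)"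
    by (simp add: W_def)
  also have "\<dots> = (\<integral>t. \<integral>p. f t p \<partial>lborel \<partial>lborel)"
    by (rule lborel_pair.Fubini_integral[OF int_f])
  also have "\<dots> = integral {0..1} (\<lambda>t. g' t * (A t - 2 * of_real pi * \<i> * of_real (Im (g t))))"
    using set_borel_integral_eq_integral(2)[OF set_int] by (simp add: f_outer set_lebesgue_integral_def)
  also have "\<dots> = - (2 * of_real pi * \<i>) * integral {0..1} (\<lambda>t. of_real (Im (g t)) * g' t)"
  proof -
    have total: "(\<lambda>t. g' t * (A t - 2 * of_real pi * \<i> * of_real (Im (g t)))) integrable_on {0..1}"
      by (rule set_borel_integral_eq_integral(1)[OF set_int])
    have y: "(\<lambda>t. 2 * of_real pi * \<i> * (of_real (Im (g t)) * g' t)) integrable_on {0..1}"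
      by (rule integrable_on_mult_right[OF y_int])
    have "integral {0..1} (\<lambda>t. g' t * A t)
        = integral {0..1} (\<lambda>t. g' t * (A t - 2 * of_real pi * \<i> * of_real (Im (g t)))
            + 2 * of_real pi * \<i> * (of_real (Im (g t)) * g' t))"
      by (rule arg_cong[where f = "integral {0..1}"]) (simp add: fun_eq_iff right_diff_distrib mult_ac)
    also have "\<dots> = integral {0..1} (\<lambda>t. g' t * (A t - 2 * of_real pi * \<i> * of_real (Im (g t))))
        + 2 * of_real pi * \<i> * integral {0..1} (\<lambda>t. of_real (Im (g t)) * g' t)"
      by (simp only: Henstock_Kurzweil_Integration.integral_add[OF total y]
          Henstock_Kurzweil_Integration.integral_mult_right)
    finally have "0 = integral {0..1} (\<lambda>t. g' t * (A t - 2 * of_real pi * \<i> * of_real (Im (g t))))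
        + 2 * of_real pi * \<i> * integral {0..1} (\<lambda>t. of_real (Im (g t)) * g' t)"
      unfolding A_zero .
    moreover have "x = - c * y" if "0 = x + c * y" for x c y :: complex
      using that[symmetric] by (simp add: eq_neg_iff_add_eq_0)
    ultimately show ?thesis by blast
  qed
  finally have "2 * of_real pi * \<i> * (\<integral>p. W p \<partial>lborel)
      = 2 * of_real pi * \<i> * - integral {0..1} (\<lambda>t. of_real (Im (g t)) * g' t)"
    by (simp only: mult_minus_left mult_minus_right)
  then have "(\<integral>p. W p \<partial>lborel) = - integral {0..1} (\<lambda>t. of_real (Im (g t)) * g' t)"
    by (subst (asm) mult_cancel_left) simp
  from that[OF W_int W_eq this] show ?thesis .
qed

text \<open>
By the jump relation the winding number is \<open>-\<sigma>\<close> at points just opposite to the outward normal, hence on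
the whole inside. Its integral over the plane is \<open>-\<sigma>\<close> times the area of the inside.
\<close>

theorem outward_normal_area:
  fixes \<sigma> k :: real
  assumes k: "g' 0 = of_real k" "0 < k" and \<sigma>: "\<sigma> = 1 \<or> \<sigma> = -1"
    and out: "0 < \<epsilon>" "\<And>t. 0 < t \<Longrightarrow> t < \<epsilon> \<Longrightarrow> g 0 + of_real (\<sigma> * t) * \<i> \<in> outside (path_image g)"
  shows "0 < \<sigma> * integral {0..1} (\<lambda>t. Im (g t) * Re (g' t))"
proof -
  obtain \<epsilon>' where \<epsilon>': "0 < \<epsilon>'"
    "\<And>t. \<lbrakk>0 < t; t < \<epsilon>'; winding_number g (g 0 + of_real (\<sigma> * t) * \<i>) = 0;
           g 0 + of_real (\<sigma> * t) * \<i> \<notin> path_image g\<rbrakk>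
      \<Longrightarrow> g 0 - of_real (\<sigma> * t) * \<i> \<notin> path_image g
        \<and> \<sigma> * Re (winding_number g (g 0 - of_real (\<sigma> * t) * \<i>)) < 0"
    using winding_number_jump[OF k \<sigma>] by blast
  define t where "t = min (min \<epsilon> \<epsilon>') 1 / 2"
  have t: "0 < t" "t < \<epsilon>" "t < \<epsilon>'" "t < 1" using out(1) \<epsilon>'(1) by (auto simp: t_def)
  define z where "z = g 0 - of_real (\<sigma> * t) * \<i>"
  have path: "path g" using simple by (rule simple_path_imp_path)
  have outside: "winding_number g (g 0 + of_real (\<sigma> * t) * \<i>) = 0"
    "g 0 + of_real (\<sigma> * t) * \<i> \<notin> path_image g"
    using winding_number_zero_in_outside[OF path closed_path out(2)[OF t(1,2)]] out(2)[OF t(1,2)]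
    by (auto simp: outside_def)
  have z: "z \<notin> path_image g" "\<sigma> * Re (winding_number g z) < 0"
    using \<epsilon>'(2)[OF t(1,3) outside] by (auto simp: z_def)
  have "z \<notin> outside (path_image g)"
    using winding_number_zero_in_outside[OF path closed_path, of z] z(2) by auto
  then have z_in: "z \<in> inside (path_image g)"
    using z(1) inside_Un_outside[of "path_image g"] by blast
  obtain \<omega> where \<omega>: "\<omega> = 1 \<or> \<omega> = -1" "\<And>y. y \<in> inside (path_image g) \<Longrightarrow> winding_number g y = of_real \<omega>"
    using simple_closed_path_winding_number_inside[OF simple] by (metis of_real_1 of_real_minus)
  have \<omega>\<sigma>: "\<omega> = - \<sigma>" using z(2) \<omega>(2)[OF z_in] \<omega>(1) \<sigma> by auto
  obtain b where b: "\<And>y. y \<in> path_image g \<Longrightarrow> norm y \<le> b"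
    using bounded_path_image[OF path] by (auto simp: bounded_iff)
  have gb: "norm (g s) \<le> b" for s using b path_image_eq_range by auto
  define R where "R = b + 1"
  have R: "\<bar>Re (g s)\<bar> < R" "\<bar>Im (g s)\<bar> < R" for s
    using gb[of s] abs_Re_le_cmod[of "g s"] abs_Im_le_cmod[of "g s"] by (auto simp: R_def)
  obtain W where W: "integrable lborel W"
    "\<And>p. Complex (snd p) (fst p) \<notin> path_image g \<Longrightarrow>
           W p = indicator ({-R..R} \<times> {-R..R}) p *\<^sub>R winding_number g (Complex (snd p) (fst p))"
    "(\<integral>p. W p \<partial>lborel) = - integral {0..1} (\<lambda>t. of_real (Im (g t)) * g' t)"
    using integral_winding_number[OF R] by blast
  define h where "h \<equiv> \<lambda>p. - \<sigma> * Re (W p)"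
  have h_int: "integrable lborel h" using W(1) by (simp add: h_def)
  have "integral\<^sup>L lborel h = - \<sigma> * Re (\<integral>p. W p \<partial>lborel)"
    using W(1) by (simp add: h_def)
  also have "\<dots> = \<sigma> * Re (integral {0..1} (\<lambda>t. of_real (Im (g t)) * g' t))" by (simp add: W(3))
  also have "Re (integral {0..1} (\<lambda>t. of_real (Im (g t)) * g' t)) = integral {0..1} (\<lambda>t. Im (g t) * Re (g' t))"
  proof -
    have "(\<lambda>t. of_real (Im (g t)) * g' t) integrable_on {0..1}"
      by (intro integrable_continuous_real continuous_intros g_cont continuous_on_subset[OF g'_cont]) auto
    then have "((\<lambda>t. Re (of_real (Im (g t)) * g' t)) has_integral
        Re (integral {0..1} (\<lambda>t. of_real (Im (g t)) * g' t))) {0..1}"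
      by (intro has_integral_Re) (rule integrable_integral)
    then show ?thesis by (simp add: integral_unique)
  qed
  finally have h_integral: "integral\<^sup>L lborel h = \<sigma> * integral {0..1} (\<lambda>t. Im (g t) * Re (g' t))" .
  let ?N = "{p. Complex (snd p) (fst p) \<in> path_image g}"
  have h_in: "h p = 1" if "p \<in> {-R..R} \<times> {-R..R}" "Complex (snd p) (fst p) \<in> inside (path_image g)" for p
  proof -
    have "Complex (snd p) (fst p) \<notin> path_image g" using that(2) by (auto simp: inside_def)
    then show ?thesis using W(2)[of p] \<omega>(2)[OF that(2)] that(1) \<omega>\<sigma> \<sigma> by (auto simp: h_def)
  qed
  have h_out: "h p = 0" if "Complex (snd p) (fst p) \<notin> path_image g"
    "p \<notin> {-R..R} \<times> {-R..R} \<or> Complex (snd p) (fst p) \<notin> inside (path_image g)" for p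
  proof -
    have "Complex (snd p) (fst p) \<in> inside (path_image g) \<or> Complex (snd p) (fst p) \<in> outside (path_image g)"
      using that(1) inside_Un_outside[of "path_image g"] by blast
    then show ?thesis
      using W(2)[OF that(1)] that(2) winding_number_zero_in_outside[OF path closed_path, of "Complex (snd p) (fst p)"]
      by (auto simp: h_def)
  qed
  have nonneg: "AE p in lborel. 0 \<le> h p"
    using AE_not_in[OF null_set_loop]
  proof eventually_elim
    case (elim p)
    then show ?case using h_in[of p] h_out[of p] by fastforce
  qed
  have "integral\<^sup>L lborel h \<noteq> 0"
  proof
    assume "integral\<^sup>L lborel h = 0"
    then have zero: "AE p in lborel. h p = 0"
      using integral_nonneg_eq_0_iff_AE[OF h_int nonneg] by simp
    let ?S = "({-R<..<R} \<times> {-R<..<R}) \<inter> (\<lambda>p. Complex (snd p) (fst p)) -` inside (path_image g)"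
    have "open ?S"
    proof (intro open_Int open_vimage open_Times)
      show "open (inside (path_image g))"
        by (intro open_inside closed_path_image path)
      show "continuous_on UNIV (\<lambda>p::real \<times> real. Complex (snd p) (fst p))"
        unfolding Complex_eq by (intro continuous_intros)
    qed auto
    moreover have "(Im z, Re z) \<in> ?S"
    proof -
      have "norm z \<le> b + t"
        using gb[of 0] norm_triangle_ineq4[of "g 0" "of_real (\<sigma> * t) * \<i>"] \<sigma> t(1)
        by (auto simp: z_def norm_mult)
      then have "norm z < R" using t(4) by (simp add: R_def)
      then show ?thesis using abs_Re_le_cmod[of z] abs_Im_le_cmod[of z] z_in by auto
    qed
    ultimately have "\<not> negligible ?S" using open_not_negligible by blast
    moreover have S_sets: "?S \<in> sets lborel" using \<open>open ?S\<close> by simp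
    have "AE p in lborel. p \<notin> ?S"
      using zero
    proof eventually_elim
      case (elim p)
      then show ?case using h_in[of p] by auto
    qed
    then have "?S \<in> null_sets lborel" using AE_iff_null_sets[OF S_sets] by blast
    then have "negligible ?S"
      by (simp add: negligible_iff_null_sets null_sets_completionI)
    ultimately show False by blast
  qed
  moreover have "0 \<le> integral\<^sup>L lborel h" by (rule integral_nonneg_AE[OF nonneg])
  ultimately show ?thesis using h_integral by linarith
qed

end

section \<open>The sign of the flux through a closed orbit\<close>

definition to_complex :: "real^2 \<Rightarrow> complex" where
  "to_complex v = Complex (v $ 1) (v $ 2)"

lemma to_complex_simps: "Re (to_complex v) = v $ 1" "Im (to_complex v) = v $ 2"
  by (simp_all add: to_complex_def)

lemma bounded_linear_to_complex: "bounded_linear to_complex"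
  by (rule linear_conv_bounded_linear[THEN iffD1])
     (auto simp: linear_iff complex_eq_iff to_complex_simps)

lemma norm_to_complex: "norm (to_complex v) = norm v"
  by (simp add: norm_vec_def L2_set_def sum_2 cmod_def to_complex_simps)

lemma inj_to_complex: "inj to_complex"
  by (auto simp: inj_def complex_eq_iff to_complex_simps vec2_eq_iff)

text \<open>
The image of an unbounded connected subset of the complement is such a set again.
\<close>

lemma outside_to_complex:
  assumes "x \<in> outside S"
  shows "to_complex x \<in> outside (to_complex ` S)"
proof -
  let ?K = "connected_component_set (- S) x"
  have x: "x \<notin> S" "\<not> bounded ?K" using assms by (auto simp: outside_def)
  have "to_complex ` ?K \<subseteq> connected_component_set (- to_complex ` S) (to_complex x)"
  proof (rule connected_component_maximal)
    show "connected (to_complex ` ?K)"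
      by (intro connected_continuous_image linear_continuous_on bounded_linear_to_complex) simp
    show "to_complex x \<in> to_complex ` ?K"
      using x(1) by (intro imageI) simp
    show "to_complex ` ?K \<subseteq> - to_complex ` S"
      using connected_component_subset[of "- S" x] inj_to_complex by (auto dest: injD)
  qed
  moreover have "\<not> bounded (to_complex ` ?K)"
    using x(2) unfolding bounded_iff by (auto simp: norm_to_complex)
  ultimately have "\<not> bounded (connected_component_set (- to_complex ` S) (to_complex x))"
    using bounded_subset by blast
  moreover have "to_complex x \<notin> to_complex ` S" using x(1) inj_to_complex by (auto dest: injD)
  ultimately show ?thesis by (simp add: outside_def)
qed

context closed_orbit
begin

text \<open>
The symmetric part of the bilinear form \<open>wedge v (A *v w)\<close> contributes an exact term, and the antisymmetric
part is \<open>trace A / 2\<close> times the area form.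
\<close>

theorem flux_linear_field:
  assumes T0: "0 < T0" "u T0 = u 0"
  shows "flux (\<lambda>q. A *v (q - q0)) T0 = trace A * integral {0..T0} (\<lambda>x. F (u x) $ 1 * u x $ 2)"
proof -
  \<comment> \<open>The part of the integrand that is a derivative along the orbit.\<close>
  define E where "E x = A$2$1 * (u x $ 1 - q0 $ 1)\<^sup>2 / 2 - A$1$2 * (u x $ 2 - q0 $ 2)\<^sup>2 / 2
      - A$1$1 * ((u x $ 1 - q0 $ 1) * (u x $ 2 - q0 $ 2)) - trace A * q0 $ 2 * u x $ 1" for x
  define e where "e x = wedge (F (u x)) (A *v (u x - q0)) - trace A * (F (u x) $ 1 * u x $ 2)" for x
  have "(E has_real_derivative e x) (at x within {0..T0})" for x
    unfolding E_def e_def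
    by (auto intro!: derivative_eq_intros component_deriv
        simp: wedge_def matrix_vector_mult_def sum_2 trace_def power2_eq_square field_simps)
  then have "(e has_integral E T0 - E 0) {0..T0}"
    using T0(1) by (intro fundamental_theorem_of_calculus) (auto simp: has_real_derivative_iff_has_vector_derivative)
  then have "(e has_integral 0) {0..T0}" using T0(2) by (simp add: E_def)
  moreover have "((\<lambda>x. trace A * (F (u x) $ 1 * u x $ 2)) has_integral
      trace A * integral {0..T0} (\<lambda>x. F (u x) $ 1 * u x $ 2)) {0..T0}"
    by (intro has_integral_mult_right integrable_integral integrable_continuous_real continuous_intros Fu_cont u_cont)
  ultimately have "((\<lambda>x. e x + trace A * (F (u x) $ 1 * u x $ 2)) has_integral
      0 + trace A * integral {0..T0} (\<lambda>x. F (u x) $ 1 * u x $ 2)) {0..T0}"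
    by (rule has_integral_add)
  then show ?thesis
    unfolding flux_def e_def by (simp add: integral_unique)
qed

theorem outward_normal_signed_area:
  assumes T0: "0 < T0" "\<And>x. u (x + T0) = u x" "inj_on u {0..<T0}"
    and \<nu>: "\<nu> = \<sigma> *\<^sub>R axis 2 1" "\<sigma> = 1 \<or> \<sigma> = -1"
    and out: "0 < \<epsilon>" "\<And>t. 0 < t \<Longrightarrow> t < \<epsilon> \<Longrightarrow> u 0 + t *\<^sub>R \<nu> \<in> outside (range u)"
  shows "0 < \<sigma> * integral {0..T0} (\<lambda>x. F (u x) $ 1 * u x $ 2)"
proof -
  define g where "g t = to_complex (u (T0 * t))" for t
  define g' where "g' t = T0 *\<^sub>R to_complex (F (u (T0 * t)))" for t
  interpret C1_loop g g'
  proof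
    fix t :: real
    have "((\<lambda>t. T0 * t) has_vector_derivative T0) (at t)"
      by (auto intro!: derivative_eq_intros)
    from bounded_linear.has_vector_derivative[OF bounded_linear_to_complex vector_diff_chain_at[OF this u_deriv]]
    show "(g has_vector_derivative g' t) (at t)"
      using linear_scale[OF bounded_linear.linear[OF bounded_linear_to_complex]]
      by (simp add: g_def[abs_def] g'_def o_def)
    show "g (t + 1) = g t" using T0(2)[of "T0 * t"] by (simp add: g_def distrib_left)
  next
    show "continuous_on UNIV g'"
      unfolding g'_def[abs_def]
      by (intro continuous_intros bounded_linear.continuous_on[OF bounded_linear_to_complex]
          continuous_on_compose2[OF Fu_cont[of UNIV]]) auto
    show "inj_on g {0..<1}"
    proof (rule inj_onI)
      fix x y assume xy: "x \<in> {0..<1}" "y \<in> {0..<1}" "g x = g y"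
      then have "u (T0 * x) = u (T0 * y)" using inj_to_complex by (auto simp: g_def dest: injD)
      then have "T0 * x = T0 * y" using xy(1,2) T0(1) by (intro inj_onD[OF T0(3)]) auto
      then show "x = y" using T0(1) by simp
    qed
  qed
  have range: "path_image g = to_complex ` range u"
  proof -
    have "u x \<in> (\<lambda>t. u (T0 * t)) ` UNIV" for x
      using T0(1) by (intro image_eqI[of _ _ "x / T0"]) auto
    then have "range (\<lambda>t. u (T0 * t)) = range u" by auto
    moreover have "range g = to_complex ` range (\<lambda>t. u (T0 * t))" by (auto simp: g_def)
    ultimately show ?thesis unfolding path_image_eq_range by simp
  qed
  have "0 < \<sigma> * integral {0..1} (\<lambda>t. Im (g t) * Re (g' t))"
  proof (rule outward_normal_area)
    show "g' 0 = of_real T0" by (simp add: g'_def u_start complex_eq_iff to_complex_simps axis_def)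
    show "g 0 + of_real (\<sigma> * t) * \<i> \<in> outside (path_image g)" if "0 < t" "t < \<epsilon>" for t
    proof -
      have "to_complex (u 0 + t *\<^sub>R \<nu>) = g 0 + of_real (\<sigma> * t) * \<i>"
        by (simp add: g_def complex_eq_iff to_complex_simps \<nu>(1) axis_def)
      then show ?thesis using outside_to_complex[OF out(2)[OF that]] by (simp add: range)
    qed
  qed (use T0 \<nu> out in auto)
  also have "integral {0..1} (\<lambda>t. Im (g t) * Re (g' t)) = integral {0..T0} (\<lambda>x. F (u x) $ 1 * u x $ 2)"
  proof -
    define A where "A x = integral {0..x} (\<lambda>x. F (u x) $ 1 * u x $ 2)" for x
    have A: "(A has_real_derivative F (u x) $ 1 * u x $ 2) (at x within {0..T0})" if "x \<in> {0..T0}" for x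
      unfolding A_def using that
      by (intro integral_has_real_derivative continuous_intros Fu_cont u_cont)
    have "((\<lambda>t. A (T0 * t)) has_vector_derivative Im (g t) * Re (g' t)) (at t within {0..1})" if "t \<in> {0..1}" for t
    proof -
      have "((\<lambda>t. T0 * t) has_real_derivative T0) (at t within {0..1})"
        by (auto intro!: derivative_eq_intros)
      moreover have "(A has_real_derivative F (u (T0 * t)) $ 1 * u (T0 * t) $ 2) (at (T0 * t) within (\<lambda>t. T0 * t) ` {0..1})"
        using T0(1) that by (intro DERIV_subset[OF A]) (auto simp: mult_left_le)
      ultimately have "((\<lambda>t. A (T0 * t)) has_real_derivative F (u (T0 * t)) $ 1 * u (T0 * t) $ 2 * T0) (at t within {0..1})"
        using DERIV_image_chain[of A _ "\<lambda>t. T0 * t" t "{0..1}" T0] by (simp add: o_def)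
      then show ?thesis
        by (simp add: has_real_derivative_iff_has_vector_derivative g_def g'_def to_complex_simps mult_ac)
    qed
    then have "((\<lambda>t. Im (g t) * Re (g' t)) has_integral A (T0 * 1) - A (T0 * 0)) {0..1}"
      by (intro fundamental_theorem_of_calculus) auto
    then show ?thesis by (simp add: A_def integral_unique)
  qed
  finally show ?thesis .
qed

end

section \<open>The transversality coefficient and the period\<close>

lemma solves_tw_iff:
  assumes B: "matrix_inv B ** B = mat 1" "B ** matrix_inv B = mat 1"
  shows "solves_tw f B v s S u \<longleftrightarrow>
    (\<forall>x\<in>S. (u has_vector_derivative tw_field f B v s (u x)) (at x within S))"
proof -
  have eq: "B *v d = r \<longleftrightarrow> d = matrix_inv B *v r" for d r
    by (metis B matrix_vector_mul_assoc matrix_vector_mul_lid)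
  show ?thesis
    unfolding solves_tw_def tw_field_def eq
  proof
    assume "\<forall>x\<in>S. (u has_vector_derivative matrix_inv B *v (f (u x) - f v - s *\<^sub>R (u x - v))) (at x within S)"
    then show "\<exists>u'. \<forall>x\<in>S. (u has_vector_derivative u' x) (at x within S) \<and>
        u' x = matrix_inv B *v (f (u x) - f v - s *\<^sub>R (u x - v))"
      by (intro exI[of _ "\<lambda>x. matrix_inv B *v (f (u x) - f v - s *\<^sub>R (u x - v))"]) simp
  qed force
qed

lemma tw_field_speed:
  "tw_field f B v s q = tw_field f B v 0 q - s *\<^sub>R (matrix_inv B *v (q - v))"
  by (simp add: tw_field_def matrix_vector_mult_diff_distrib matrix_vector_mult_scaleR scaleR_diff_right)

lemma divergence_free_tw_field:
  assumes "C2 f" and "planar_hamiltonian f B v 0"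
  obtains F' where "divergence_free_field (tw_field f B v 0) F'"
proof -
  obtain f' :: "real^2 \<Rightarrow> (real^2) \<Rightarrow>\<^sub>L (real^2)" and f'' where
    f: "\<And>x. (f has_derivative blinfun_apply (f' x)) (at x)"
    and f': "\<And>x. (f' has_derivative blinfun_apply (f'' x)) (at x)" and f'': "continuous_on UNIV f''"
    using assms(1) unfolding C2_def by blast
  define L where "L = Blinfun ((*v) (matrix_inv B))"
  have L: "blinfun_apply L = (*v) (matrix_inv B)"
    unfolding L_def by (rule bounded_linear_Blinfun_apply) (rule matrix_vector_mul_bounded_linear)
  define F' where "F' x = L o\<^sub>L f' x" for x
  have F_eq: "tw_field f B v 0 x = L (f x - f v)" for x by (simp add: tw_field_def L)
  have F_deriv: "(tw_field f B v 0 has_derivative blinfun_apply (F' x)) (at x)" for x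
    unfolding F_eq[abs_def] F'_def
    by (rule has_derivative_eq_rhs[OF bounded_linear.has_derivative[OF blinfun.bounded_linear_right
            has_derivative_diff[OF f has_derivative_const]]])
       (simp add: fun_eq_iff)
  have cont: "continuous_on UNIV F'"
    unfolding F'_def using f'
    by (intro continuous_intros continuous_at_imp_continuous_on ballI has_derivative_continuous[OF f'])
  have taylor: "\<exists>K\<ge>0. \<forall>x y. norm x \<le> R \<longrightarrow> norm y \<le> R \<longrightarrow>
      norm (tw_field f B v 0 y - tw_field f B v 0 x - F' x (y - x)) \<le> K * (norm (y - x))\<^sup>2" for R
  proof -
    obtain K where K: "0 \<le> K" "\<And>x y. norm x \<le> R \<Longrightarrow> norm y \<le> R \<Longrightarrow>
        norm (f y - f x - f' x (y - x)) \<le> K * (norm (y - x))\<^sup>2"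
      using C2_taylor[OF f f' f'', of R] by blast
    have "norm (tw_field f B v 0 y - tw_field f B v 0 x - F' x (y - x)) \<le> norm L * K * (norm (y - x))\<^sup>2"
      if "norm x \<le> R" "norm y \<le> R" for x y
    proof -
      have "tw_field f B v 0 y - tw_field f B v 0 x - F' x (y - x) = L (f y - f x - f' x (y - x))"
        by (simp add: F_eq F'_def blinfun.diff_right)
      then show ?thesis
        using order_trans[OF norm_blinfun mult_left_mono[OF K(2)[OF that] norm_ge_zero[of L]]]
        by (simp add: mult.assoc)
    qed
    then show ?thesis using K(1) by (intro exI[of _ "norm L * K"]) auto
  qed
  have "wedge (F' x a) b + wedge a (F' x b) = 0" for x a b
  proof -
    let ?J = "jacobian (tw_field f B v 0) (at x)"
    have "frechet_derivative (tw_field f B v 0) (at x) = blinfun_apply (F' x)"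
      by (rule frechet_derivative_at[OF F_deriv, symmetric])
    then have "?J *v a = F' x a" for a
      unfolding jacobian_def by (simp add: matrix_works blinfun.bounded_linear_right bounded_linear.linear)
    then show ?thesis
      using wedge_trace[of ?J a b] assms(2) by (simp add: planar_hamiltonian_def)
  qed
  with F_deriv cont taylor have "divergence_free_field (tw_field f B v 0) F'"
    by unfold_locales auto
  then show ?thesis by (rule that)
qed

lemma axis_2_cases:
  fixes \<nu> :: "real^2"
  assumes "norm \<nu> = 1" "\<nu> \<bullet> axis 1 1 = 0"
  obtains \<sigma> :: real where "\<nu> = \<sigma> *\<^sub>R axis 2 1" "\<sigma> = 1 \<or> \<sigma> = -1"
proof (rule that[of "\<nu> $ 2"])
  have "\<nu> $ 1 = 0" using assms(2) by (simp add: inner_axis)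
  then show "\<nu> = (\<nu> $ 2) *\<^sub>R axis 2 1" by (simp add: vec2_eq_iff axis_def)
  have "(\<nu> $ 2)\<^sup>2 = 1"
    using assms(1) \<open>\<nu> $ 1 = 0\<close> by (simp add: norm_eq_1 inner_vec2 power2_eq_square)
  then show "\<nu> $ 2 = 1 \<or> \<nu> $ 2 = -1" by (simp add: power2_eq_1_iff)
qed

theorem lemma6p4:
  fixes f :: "real^2 \<Rightarrow> real^2"
    and B :: "real^2^2"
    and um :: "real^2"
    and ubar :: "real \<Rightarrow> real^2"
    and T :: real
    and U :: "real^2 \<Rightarrow> real^2 \<Rightarrow> real \<Rightarrow> real \<Rightarrow> real^2"
    and \<nu> :: "real^2"
    and c :: "real \<Rightarrow> real^2"
  assumes wave: "solves_tw f B um 0 UNIV ubar"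
    and T_pos: "T > 0"
    and periodic: "\<forall>x. ubar (x + T) = ubar x"
    and nonconstant: "\<not> ubar constant_on UNIV"
    and coords: "vector_derivative ubar (at 0) = axis 1 1"
    and normal: "outward_unit_normal ubar \<nu>"
    and variation: "tw_variation f B T um (ubar 0) U"
    and curve: "c 0 = ubar 0" "(c has_vector_derivative \<nu>) (at 0)"
    and i: "C2 f"
    and ii: "\<forall>l\<in>complex_spectrum B. Re l > 0"
    and iii: "invertible (jacobian f (at um))"
    and iv: "transversality_coeff T um (ubar 0) U \<noteq> 0"
    and v: "planar_hamiltonian f B um 0"
  shows "\<exists>\<delta> V P D. \<delta> > 0 \<and> periodic_family f B um 0 c \<delta> V P \<and> V 0 = ubar \<and>
           (P has_real_derivative D) (at 0) \<and>
           sgn (transversality_coeff T um (ubar 0) U) = sgn D"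
proof -
  note B = spectrum_right_half_plane[OF ii]
  have "invertible B" using B(1) by (simp add: invertible_det_nz)
  then have "\<exists>A. B ** A = mat 1 \<and> A ** B = mat 1" by (simp add: invertible_def)
  then have inv: "matrix_inv B ** B = mat 1" "B ** matrix_inv B = mat 1"
    unfolding matrix_inv_def by (rule someI2_ex, blast)+
  have "trace (matrix_inv B) * det B = trace B" by (rule trace_inverse[OF inv(1)])
  then have tr: "0 < trace (matrix_inv B)" using B by (metis zero_less_mult_pos2)
  note tw = solves_tw_iff[OF inv]
  define F where "F = tw_field f B um 0"
  define G where "G q = matrix_inv B *v (q - um)" for q
  obtain F' where "divergence_free_field F F'"
    unfolding F_def using divergence_free_tw_field[OF i v] .
  then interpret divergence_free_field F F' .
  have u_deriv: "(ubar has_vector_derivative F (ubar x)) (at x)" for x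
    using wave unfolding tw by (simp add: F_def)
  have start: "F (ubar 0) = axis 1 1"
    using vector_derivative_at[OF u_deriv[of 0]] coords by simp
  then have "F (ubar 0) \<noteq> 0" by (simp add: vec2_eq_iff axis_def)
  note nonzero = this
  have per: "\<And>x. ubar (x + T) = ubar x" using periodic by simp
  interpret closed_orbit F F' ubar
    using u_deriv start periodic_orbit_regular[OF u_deriv T_pos per nonzero] by unfold_locales auto
  obtain T0 k where T0: "0 < T0" "\<And>x. ubar (x + T0) = ubar x" "\<And>x. 0 < x \<Longrightarrow> x < T0 \<Longrightarrow> ubar x \<noteq> ubar 0"
    "inj_on ubar {0..<T0}" "T = real k * T0" "0 < k"
    using least_period[OF u_deriv T_pos per nonzero] by blast
  have T0_closed: "ubar T0 = ubar 0" using T0(2)[of 0] by simp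
  have T_closed: "ubar T = ubar 0" using per[of 0] by simp
  have "1 * T0 \<le> real k * T0" using T0(1,6) by (intro mult_right_mono) auto
  then have T0_le: "T0 \<le> T" using T0(5) by simp

  have "norm \<nu> = 1" "\<nu> \<bullet> axis 1 1 = 0"
    using normal coords by (auto simp: outward_unit_normal_def)
  then obtain \<sigma> where \<sigma>: "\<nu> = \<sigma> *\<^sub>R axis 2 1" "\<sigma> = 1 \<or> \<sigma> = -1" by (rule axis_2_cases)
  obtain \<epsilon> where \<epsilon>: "0 < \<epsilon>" "\<And>t. 0 < t \<Longrightarrow> t < \<epsilon> \<Longrightarrow> ubar 0 + t *\<^sub>R \<nu> \<in> outside (range ubar)"
    using normal unfolding outward_unit_normal_def by blast
  have G_lip: "norm (G y - G x) \<le> onorm ((*v) (matrix_inv B)) * norm (y - x)" for x y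
  proof -
    have "G y - G x = matrix_inv B *v (y - x)" by (simp add: G_def matrix_vector_mult_diff_distrib)
    then show ?thesis using onorm[OF matrix_vector_mul_bounded_linear, of "matrix_inv B" "y - x"] by simp
  qed
  have G_cont: "continuous_on UNIV G"
    unfolding G_def
    by (intro bounded_linear.continuous_on[OF matrix_vector_mul_bounded_linear] continuous_intros)

  have flux_sign: "0 < \<sigma> * flux G T0"
  proof -
    have "flux G T0 = trace (matrix_inv B) * integral {0..T0} (\<lambda>x. F (ubar x) $ 1 * ubar x $ 2)"
      unfolding G_def[abs_def] by (rule flux_linear_field[OF T0(1) T0_closed])
    then have "\<sigma> * flux G T0 = trace (matrix_inv B) * (\<sigma> * integral {0..T0} (\<lambda>x. F (ubar x) $ 1 * ubar x $ 2))"
      by (simp only: mult.left_commute)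
    also have "\<dots> > 0"
      by (intro mult_pos_pos tr outward_normal_signed_area[OF T0(1,2,4) \<sigma> \<epsilon>])
    finally show ?thesis .
  qed

  have ev: "\<forall>\<^sub>F (v, p, s) in nhds (um, ubar 0, 0). solves_tw f B v s {0..T} (U v p s) \<and> U v p s 0 = p"
    using variation by (simp add: tw_variation_def)
  have ev_p: "\<forall>\<^sub>F p in nhds (ubar 0). solves T (U um p 0) \<and> U um p 0 0 = p"
  proof -
    have "filterlim (\<lambda>p. (um, p, 0::real)) (nhds (um, ubar 0, 0)) (nhds (ubar 0))"
      by (intro tendsto_Pair tendsto_const filterlim_ident)
    from eventually_compose_filterlim[OF ev this] show ?thesis
      by (simp add: tw solves_def F_def[symmetric])
  qed
  have ev_s: "\<forall>\<^sub>F s in nhds 0. (\<forall>x\<in>{0..T}. (U um (ubar 0) s has_vector_derivative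
      F (U um (ubar 0) s x) - s *\<^sub>R G (U um (ubar 0) s x)) (at x within {0..T})) \<and> U um (ubar 0) s 0 = ubar 0"
  proof -
    have "filterlim (\<lambda>s. (um, ubar 0, s::real)) (nhds (um, ubar 0, 0)) (nhds 0)"
      by (intro tendsto_Pair tendsto_const filterlim_ident)
    from eventually_compose_filterlim[OF ev this] show ?thesis
      by (simp add: tw F_def G_def tw_field_speed[of f B um _ _, symmetric])
  qed
  have w: "w U um (ubar 0) 2 x = variation (axis 2 1) x" if "x \<in> {0..T}" for x
    unfolding w_def using frechet_derivative_at[OF first_variation_initial(1)[OF ev_p that]] by metis
  have z1: "z1 U um (ubar 0) x = drift G x *\<^sub>R F (ubar x) + flux G x *\<^sub>R normal x" if "x \<in> {0..T}" for x
    unfolding z1_def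
    using vector_derivative_at[OF first_variation_speed[OF ev_s _ G_lip G_cont that]]
    by (simp add: onorm_pos_le[OF matrix_vector_mul_bounded_linear])
  have jw: "jump T (w U um (ubar 0) 2) = shear T *\<^sub>R axis 1 1"
    using T_pos by (simp add: jump_def w variation_return[OF T_closed] variation_return[of 0] axis_def)
  have jz: "jump T (z1 U um (ubar 0)) = drift G T *\<^sub>R axis 1 1 + flux G T *\<^sub>R axis 2 1"
  proof -
    have "normal T = normal 0" by (simp add: normal_def T_closed)
    then show ?thesis
      using T_pos by (simp add: jump_def z1 T_closed start normal_start) (simp add: drift_def flux_def)
  qed
  have \<gamma>: "transversality_coeff T um (ubar 0) U = - (shear T * flux G T)"
    by (simp add: transversality_coeff_def jw jz det_2 transpose_def axis_def)

  \<comment> \<open>If \<open>T\<close> is the least period, nearby orbits may return only after time \<open>T\<close>, so solutions are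
    continued to \<open>[0, 2T]\<close> by starting again at their value at \<open>T\<close>, which is near \<open>ubar 0\<close>.\<close>
  define \<Phi> where "\<Phi> p x = (if x \<le> T then U um p 0 x else U um (U um p 0 T) 0 (x - T))" for p x
  have ev_\<Phi>: "\<forall>\<^sub>F p in nhds (ubar 0). solves (T + T) (\<Phi> p) \<and> \<Phi> p 0 = p"
  proof -
    have TT: "T \<in> {0..T}" using T_pos by simp
    have "isCont (\<lambda>p. U um p 0 T) (ubar 0)"
      by (rule has_derivative_continuous[OF first_variation_initial(1)[OF ev_p TT]])
    then have "((\<lambda>p. U um p 0 T) \<longlongrightarrow> U um (ubar 0) 0 T) (nhds (ubar 0))"
      unfolding isCont_def by (subst (asm) tendsto_at_iff_tendsto_nhds)
    then have "filterlim (\<lambda>p. U um p 0 T) (nhds (ubar 0)) (nhds (ubar 0))"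
      using first_variation_initial(2)[OF ev_p TT] T_closed by simp
    from ev_p eventually_compose_filterlim[OF ev_p this] show ?thesis
    proof eventually_elim
      case (elim p)
      then show ?case
        using solves_glue[of T "U um p 0" T "U um (U um p 0 T) 0"] T_pos
        by (simp add: \<Phi>_def[abs_def])
    qed
  qed
  have beyond: "T0 < T + T" using T0_le T_pos by simp
  obtain \<rho> \<tau> where \<rho>: "0 < \<rho>"
    and \<tau>: "\<forall>p. norm (p - ubar 0) < \<rho> \<longrightarrow> solves (T + T) (\<Phi> p) \<and> \<Phi> p 0 = p \<and> 0 < \<tau> p \<and> \<tau> p \<le> T + T \<and>
        \<Phi> p (\<tau> p) = p \<and> (\<forall>x. 0 < x \<and> x < \<tau> p \<longrightarrow> \<Phi> p x \<noteq> p)"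
    and \<tau>_base: "\<tau> (ubar 0) = T0"
    and \<tau>_deriv: "(\<tau> has_derivative (\<lambda>h. - (shear T0 * h $ 2))) (at (ubar 0))"
    using return_time[OF T0(1) T0_closed T0(3) beyond ev_\<Phi>] by blast
  have "isCont c 0" using curve(2) by (rule has_vector_derivative_continuous)
  then obtain \<delta> where \<delta>: "0 < \<delta>" "\<And>a. \<bar>a\<bar> < \<delta> \<Longrightarrow> norm (c a - ubar 0) < \<rho>"
    using \<rho> unfolding continuous_at_eps_delta dist_norm curve(1) by (metis diff_zero real_norm_def)
  have "\<exists>V. (\<forall>x. (V has_vector_derivative F (V x)) (at x)) \<and> V 0 = c a \<and> minimal_period V (\<tau> (c a))"
    if a: "\<bar>a\<bar> < \<delta>" for a
  proof -
    note ca = \<tau>[rule_format, OF \<delta>(2)[OF a]]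
    have "solves (\<tau> (c a)) (\<Phi> (c a))"
      unfolding solves_def
    proof
      fix x assume x: "x \<in> {0..\<tau> (c a)}"
      then have "(\<Phi> (c a) has_vector_derivative F (\<Phi> (c a) x)) (at x within {0..T + T})"
        using ca by (auto simp: solves_def)
      then show "(\<Phi> (c a) has_vector_derivative F (\<Phi> (c a) x)) (at x within {0..\<tau> (c a)})"
        by (rule has_vector_derivative_within_subset) (use ca in auto)
    qed
    then obtain V where V: "\<And>x. (V has_vector_derivative F (V x)) (at x)" "\<And>x. V (x + \<tau> (c a)) = V x"
      "\<And>x. 0 \<le> x \<Longrightarrow> x < \<tau> (c a) \<Longrightarrow> V x = \<Phi> (c a) x"
      using periodic_extension[of "\<tau> (c a)" "\<Phi> (c a)"] ca by metis
    have V0: "V 0 = c a" using V(3)[of 0] ca by simp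
    have "V (0 + Q) \<noteq> V 0" if "0 < Q" "Q < \<tau> (c a)" for Q
      using ca V(3)[of Q] that V0 by simp
    then have "minimal_period V (\<tau> (c a))"
      using V(2) ca unfolding minimal_period_def by blast
    with V(1) V0 show ?thesis by blast
  qed
  then obtain V' where V': "\<And>a x. \<bar>a\<bar> < \<delta> \<Longrightarrow> (V' a has_vector_derivative F (V' a x)) (at x)"
    "\<And>a. \<bar>a\<bar> < \<delta> \<Longrightarrow> V' a 0 = c a" "\<And>a. \<bar>a\<bar> < \<delta> \<Longrightarrow> minimal_period (V' a) (\<tau> (c a))"
    by metis
  have base: "minimal_period ubar T0"
    unfolding minimal_period_def using T0(1-3) by (metis add_0)
  define V where "V a = (if a = 0 then ubar else V' a)" for a
  define P where "P a = \<tau> (c a)" for a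
  have family: "periodic_family f B um 0 c \<delta> V P"
    unfolding periodic_family_def tw V_def P_def
    using V' base u_deriv curve(1) \<tau>_base by (auto simp: F_def[symmetric])
  have P_deriv: "(P has_real_derivative - (shear T0 * \<sigma>)) (at 0)"
  proof -
    have "((\<lambda>a. \<tau> (c a)) has_derivative (\<lambda>h. - (shear T0 * (h *\<^sub>R \<nu>) $ 2))) (at 0)"
      using curve(2) \<tau>_deriv
      by (intro has_derivative_compose[of c _ 0 UNIV \<tau>]) (auto simp: has_vector_derivative_def curve(1))
    then show ?thesis
      unfolding has_field_derivative_def P_def[abs_def]
      by (rule has_derivative_eq_rhs) (simp add: fun_eq_iff \<sigma>(1) axis_def)
  qed
  \<comment> \<open>Passing from \<open>T0\<close> to \<open>T\<close> multiplies both factors of the coefficient by \<open>k\<close>.\<close>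
  have "sgn (transversality_coeff T um (ubar 0) U) = sgn (- (shear T0 * \<sigma>))"
  proof -
    have "shear T = real k * shear T0" "flux G T = real k * flux G T0"
      using periodic_coefficients[OF T0(2) less_imp_le[OF T0(1)]] G_cont unfolding T0(5) by auto
    moreover have "sgn (flux G T0) = \<sigma>"
      using flux_sign \<sigma>(2) by (auto simp: sgn_if zero_less_mult_iff)
    moreover have "sgn \<sigma> = \<sigma>" using \<sigma>(2) by auto
    ultimately show ?thesis using T0(6) by (simp add: \<gamma> sgn_mult sgn_minus)
  qed
  then show ?thesis
    using \<delta>(1) family P_deriv by (intro exI[of _ \<delta>] exI[of _ V] exI[of _ P] exI[of _ "- (shear T0 * \<sigma>)"]) (simp add: V_def)
qed

end
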